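(* Let $(\mathcal{X},d)$ be a metric space, let $\alpha\in(0,2]$ and let $N\subset\mathbb{N}$ be an infinite subset. For $n\in N$ let $X_n$ be a random variable with law $\nu_\alpha^n$ on $\mathbb{R}^n$, and let $f_n,F_n:\mathbb{R}^n\to\mathcal{X}$ be measurable functions. Let $(v(n))_{n\in N}$ be a sequence going to $+\infty$. For $\delta>0$, $n\in N$ and $x\in\mathcal{X}$ define $$I_{n,\delta}(x)=\inf\{\|h\|_{\ell^\alpha}^\alpha : d(F_n(h),x)<\delta,\ h\in\mathbb{R}^n\},\qquad I_\alpha(x)=\sup_{\delta>0}\inf_{n\in N}I_{n,\delta}(x).$$ Assume: (i) For any $r>0$, $$\sup_{h_n\in rB_{\ell^\alpha}} d\big(f_n(X_n+v(n)^{1/\alpha}h_n),F_n(h_n)\big)\to 0$$ in probability as $n\to+\infty$, $n\in N$. (ii) If $\alpha<2$, then for any $\delta>0$ and $r>0$ there is a sequence $t_\delta(n)$ such that $$\mathbb{E}\sup_{\|h\|_{\ell^2}\le t_\delta(n)}\mathcal{L}_n(h)\le\delta,\qquad\text{where}\quad \mathcal{L}_n(h)=\sup_{x\in X_n+rv(n)^{1/\alpha}B_{\ell^\alpha}} d\big(f_n(x+h),f_n(x)\big),$$ and such that $(\log n)^{\alpha/2}=o\big(\log\frac{t_\delta(n)^2}{v(n)}\big)$ if $\alpha\ne1$, or $v(n)=o(t_\delta(n)^2)$ if $\alpha=1$. (iii) For any $r>0$, $\bigcup_{n\in N}F_n(rB_{\ell^\alpha})$ is relatively compact in $\mathcal{X}$.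 (iv) For any $x\in\mathcal{X}$, $$I_\alpha(x)=\sup_{\delta>0}\ \limsup_{n\to+\infty,\ n\in N} I_{n,\delta}(x).$$ Then $(f_n(X_n))_{n\in N}$ satisfies a large deviations principle with speed $v(n)$ and good rate function $I_\alpha$.
   Context: $\nu_\alpha$ is the probability measure on $\mathbb{R}$ with density $Y_\alpha^{-1}e^{-|x|^\alpha}$ with respect to Lebesgue measure ($Y_\alpha$ the normalizing constant), and $\nu_\alpha^n$ is its $n$-fold product on $\mathbb{R}^n$. For $p>0$ and $h\in\mathbb{R}^n$, $\|h\|_{\ell^p}=(\sum_{i=1}^n|h_i|^p)^{1/p}$ and $B_{\ell^p}=\{h\in\mathbb{R}^n:\|h\|_{\ell^p}\le1\}$. The infimum of the empty set is $+\infty$. Large deviations principle (LDP): random variables $(Z_n)$ in a topological space $\mathcal{X}$ with its Borel $\sigma$-field satisfy an LDP with speed $v(n)\to+\infty$ and rate function $J:\mathcal{X}\to[0,+\infty]$ if $J$ is lower semicontinuous and for every Borel set $B$, $$-\inf_{B^\circ}J\le\liminf_n\frac1{v(n)}\log\mathbb{P}(Z_n\in B)\le\limsup_n\frac1{v(n)}\log\mathbb{P}(Z_n\in B)\le-\inf_{\overline B}J.$$ $J$ is a good rate function if all level sets $\{J\le t\}$, $t\in[0,+\infty)$, are compact. *)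

theory Defs
  imports "HOL-Probability.Probability"
begin

text \<open>
  The dimension \<open>n\<close> varies, so \<open>\<real>\<^sup>n\<close> is the space of the product measure over the index set
  \<open>{..<n}\<close>, i.e. the functions \<open>nat \<Rightarrow> real\<close> that are \<open>undefined\<close> outside \<open>{..<n}\<close>.
  All operations below return such functions.
\<close>

abbreviation borel_Rn :: "nat \<Rightarrow> (nat \<Rightarrow> real) measure" where
  "borel_Rn n \<equiv> Pi\<^sub>M {..<n} (\<lambda>_. borel)"

abbreviation Rn :: "nat \<Rightarrow> (nat \<Rightarrow> real) set" where
  "Rn n \<equiv> space (borel_Rn n)"

definition vadd :: "nat \<Rightarrow> (nat \<Rightarrow> real) \<Rightarrow> (nat \<Rightarrow> real) \<Rightarrow> nat \<Rightarrow> real" where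
  "vadd n x y = (\<lambda>i\<in>{..<n}. x i + y i)"

definition vscale :: "nat \<Rightarrow> real \<Rightarrow> (nat \<Rightarrow> real) \<Rightarrow> nat \<Rightarrow> real" where
  "vscale n c x = (\<lambda>i\<in>{..<n}. c * x i)"

definition lp_norm :: "real \<Rightarrow> nat \<Rightarrow> (nat \<Rightarrow> real) \<Rightarrow> real" where
  "lp_norm p n h = (\<Sum>i<n. \<bar>h i\<bar> powr p) powr (1 / p)"

definition lp_unit_ball :: "real \<Rightarrow> nat \<Rightarrow> (nat \<Rightarrow> real) set" where
  "lp_unit_ball p n = {h \<in> Rn n. lp_norm p n h \<le> 1}"

definition scaled_ball :: "real \<Rightarrow> nat \<Rightarrow> real \<Rightarrow> (nat \<Rightarrow> real) set" where
  "scaled_ball p n r = vscale n r ` lp_unit_ball p n"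

definition Y :: "real \<Rightarrow> real" where
  "Y \<alpha> = (LINT x|lborel. exp (- (\<bar>x\<bar> powr \<alpha>)))"

definition \<nu> :: "real \<Rightarrow> real measure" where
  "\<nu> \<alpha> = density lborel (\<lambda>x. ennreal (exp (- (\<bar>x\<bar> powr \<alpha>)) / Y \<alpha>))"

definition \<nu>_prod :: "real \<Rightarrow> nat \<Rightarrow> (nat \<Rightarrow> real) measure" where
  "\<nu>_prod \<alpha> n = Pi\<^sub>M {..<n} (\<lambda>_. \<nu> \<alpha>)"

abbreviation edist :: "'x::metric_space \<Rightarrow> 'x \<Rightarrow> ennreal" where
  "edist x y \<equiv> ennreal (dist x y)"

text \<open>\<open>n \<rightarrow> \<infinity>\<close> along \<open>n \<in> N\<close>.\<close>

definition along :: "nat set \<Rightarrow> nat filter" where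
  "along N = inf sequentially (principal N)"

text \<open>
  The random suprema to which the next two notions are applied range over uncountable sets and
  need not be measurable. Outer probability and upper expectation are therefore used; they agree
  with probability and expectation on measurable functions. (For a non-measurable function
  \<open>nn_integral\<close> would be a lower integral.)
\<close>

definition tendsto_0_in_prob ::
    "nat set \<Rightarrow> (nat \<Rightarrow> 'w measure) \<Rightarrow> (nat \<Rightarrow> 'w \<Rightarrow> ennreal) \<Rightarrow> bool" where
  "tendsto_0_in_prob N M S \<longleftrightarrow>
     (\<forall>\<epsilon>>0. ((\<lambda>n. outer_measure_of (M n) {\<omega> \<in> space (M n). S n \<omega> > ennreal \<epsilon>})
              \<longlongrightarrow> 0) (along N))"

definition upper_expectation :: "'w measure \<Rightarrow> ('w \<Rightarrow> ennreal) \<Rightarrow> ennreal" where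
  "upper_expectation M S =
     (INF g \<in> {g \<in> borel_measurable M. \<forall>\<omega>\<in>space M. S \<omega> \<le> g \<omega>}. \<integral>\<^sup>+\<omega>. g \<omega> \<partial>M)"

definition log_prob :: "real \<Rightarrow> ereal" where
  "log_prob p = (if p = 0 then -\<infinity> else ereal (ln p))"

definition lower_semicontinuous :: "('x::topological_space \<Rightarrow> ennreal) \<Rightarrow> bool" where
  "lower_semicontinuous J \<longleftrightarrow> (\<forall>x. J x \<le> Liminf (at x) J)"

definition good_rate_function :: "('x::topological_space \<Rightarrow> ennreal) \<Rightarrow> bool" where
  "good_rate_function J \<longleftrightarrow> (\<forall>t::real. 0 \<le> t \<longrightarrow> compact {x. J x \<le> ennreal t})"

definition satisfies_LDP ::
    "nat set \<Rightarrow> (nat \<Rightarrow> 'w measure) \<Rightarrow> (nat \<Rightarrow> 'w \<Rightarrow> 'x::topological_space) \<Rightarrow>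
     (nat \<Rightarrow> real) \<Rightarrow> ('x \<Rightarrow> ennreal) \<Rightarrow> bool" where
  "satisfies_LDP N M Z v J \<longleftrightarrow>
     (\<forall>n\<in>N. Z n \<in> borel_measurable (M n)) \<and>
     filterlim v at_top (along N) \<and>
     lower_semicontinuous J \<and>
     (\<forall>B \<in> sets borel.
        let logP = (\<lambda>n. ereal (1 / v n) *
                        log_prob (measure (M n) {\<omega> \<in> space (M n). Z n \<omega> \<in> B}))
        in - enn2ereal (INF x\<in>interior B. J x) \<le> Liminf (along N) logP \<and>
           Liminf (along N) logP \<le> Limsup (along N) logP \<and>
           Limsup (along N) logP \<le> - enn2ereal (INF x\<in>closure B. J x))"

definition I_delta ::
    "real \<Rightarrow> (nat \<Rightarrow> (nat \<Rightarrow> real) \<Rightarrow> 'x::metric_space) \<Rightarrow> nat \<Rightarrow> real \<Rightarrow> 'x \<Rightarrow> ennreal" where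
  "I_delta \<alpha> F n \<delta> x =
     (INF h \<in> {h \<in> Rn n. dist (F n h) x < \<delta>}. ennreal (lp_norm \<alpha> n h powr \<alpha>))"

definition I_rate ::
    "real \<Rightarrow> nat set \<Rightarrow> (nat \<Rightarrow> (nat \<Rightarrow> real) \<Rightarrow> 'x::metric_space) \<Rightarrow> 'x \<Rightarrow> ennreal" where
  "I_rate \<alpha> N F x = (SUP \<delta>\<in>{0<..}. INF n\<in>N. I_delta \<alpha> F n \<delta> x)"

text \<open>\<open>\<L>\<^sub>n(h)\<close> for \<open>g = f\<^sub>n\<close>, \<open>\<xi> = X\<^sub>n(\<omega>)\<close>, \<open>w = v(n)\<close>.\<close>

definition osc ::
    "real \<Rightarrow> nat \<Rightarrow> ((nat \<Rightarrow> real) \<Rightarrow> 'x::metric_space) \<Rightarrow> (nat \<Rightarrow> real) \<Rightarrow> real \<Rightarrow> real \<Rightarrow>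
     (nat \<Rightarrow> real) \<Rightarrow> ennreal" where
  "osc \<alpha> n g \<xi> w r h =
     (SUP x \<in> vadd n \<xi> ` scaled_ball \<alpha> n (r * w powr (1 / \<alpha>)). edist (g (vadd n x h)) (g x))"

text \<open>
  Since \<open>smallo\<close> compares absolute values, positivity of the logarithm has to be
  required separately.
\<close>

definition t_growth :: "real \<Rightarrow> nat set \<Rightarrow> (nat \<Rightarrow> real) \<Rightarrow> (nat \<Rightarrow> real) \<Rightarrow> bool" where
  "t_growth \<alpha> N v t \<longleftrightarrow>
     (if \<alpha> \<noteq> 1
      then (\<lambda>n. ln (real n) powr (\<alpha> / 2)) \<in> o[along N](\<lambda>n. ln ((t n)\<^sup>2 / v n)) \<and>
           (\<forall>\<^sub>F n in along N. 0 < ln ((t n)\<^sup>2 / v n))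
      else v \<in> o[along N](\<lambda>n. (t n)\<^sup>2))"

end

theory Submission
  imports Defs "HOL-Real_Asymp.Real_Asymp"
begin

text \<open>
  Lower bound. By the first hypothesis, \<open>f\<^sub>n\<close> maps \<open>X\<^sub>n + v(n)\<^sup>1\<^sup>/\<^sup>\<alpha> h\<close> close to \<open>F\<^sub>n(h)\<close> with high
  probability, for \<open>h\<close> in a ball. Removing the translation costs at most a factor
  \<open>2 exp(v(n) \<parallel>h\<parallel>\<^sup>\<alpha>)\<close>: the density is even, and the two-point inequality
  \<open>\<bar>h + x\<bar>\<^sup>\<alpha> + \<bar>h - x\<bar>\<^sup>\<alpha> \<le> 2 \<bar>x\<bar>\<^sup>\<alpha> + 2 \<bar>h\<bar>\<^sup>\<alpha>\<close> controls the mean of a translation and its reflection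
  (\<open>translation_lower_bound\<close>). The limsup form of the rate function supplies a suitable \<open>h\<close> for all
  large \<open>n\<close>.

  Upper bound. If a set of measure at least \<open>3/4\<close> is enlarged by the \<open>\<ell>\<^sup>\<alpha>\<close>-ball of energy \<open>r v(n)\<close> and,
  for \<open>\<alpha> < 2\<close>, by the Euclidean ball of radius \<open>t(n)\<close>, the complement of the result has, for large \<open>n\<close>,
  measure at most \<open>C exp(- (1 - e) r v(n))\<close> (\<open>asymptotic_concentration\<close>). Enlarge the event on which the suprema
  in the first two hypotheses are small: there \<open>f\<^sub>n\<close> is close to images under \<open>F\<^sub>n\<close> of points of energy
  at most \<open>r\<close>, and by relative compactness these images stay away from any closed set on which the
  rate exceeds \<open>r\<close> (\<open>far_from_low_energy\<close>).

  Concentration with the sharp constant is the heart of the matter. It is expressed by an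
  inequality for two functions (\<open>property_tau\<close>): if \<open>f(x)\<^sup>1\<^sup>-\<^sup>l g(y)\<^sup>l \<le> K exp(l c(x, y))\<close> for all \<open>x\<close> and
  \<open>y\<close>, then \<open>(\<integral>f)\<^sup>1\<^sup>-\<^sup>l (\<integral>g)\<^sup>l \<le> K\<close>. For indicator functions this bounds the measure of sets that are
  far apart in the cost \<open>c\<close>; it passes to images under maps, and to product measures with the costs
  added up. So everything happens on the line, where it follows from the monotone transport \<open>T\<close>
  between the two weighted measures by comparing the mass swept by an interpolation between \<open>x\<close> and
  \<open>T x\<close> (\<open>two_function_continuous\<close>). The linear interpolation with small \<open>l\<close> gives the Gaussian case
  \<open>\<alpha> = 2\<close>. A bent interpolation on the half line gives the exponential law with a cost that is
  quadratic for short and almost \<open>\<bar>y - x\<bar>\<close> for long displacements, and the difference of two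
  exponential variables gives \<open>\<alpha> = 1\<close>. Short displacements are the ones that the Euclidean ball
  takes care of. The other exponents are images of \<open>\<alpha> = 1\<close> under a monotone map. After truncating
  the coordinates at \<open>(2 ln n)\<^sup>1\<^sup>/\<^sup>\<alpha>\<close> its distortion is a power of \<open>ln n\<close> for short displacements,
  which the growth condition on \<open>t\<close> absorbs, and long displacements are unaffected to leading order
  (\<open>truncated_cost\<close>).

  The events in the hypotheses are given on the sample space, and their images in \<open>\<real>\<^sup>n\<close> need not be
  measurable. Since the costs are continuous, they may be replaced by measurable hulls contained in
  their closures (\<open>sequential_hull\<close>).
\<close>

section \<open>Two-function inequalities and tensorisation\<close>

text \<open>
  Maurey's property (\<open>\<tau>\<close>), in the form of an inequality for two functions with weights
  \<open>1 - l\<close> and \<open>l\<close>. Boundedness of the functions keeps all integrals, also those of sections in a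
  product space, finite.
\<close>

definition property_tau :: "real \<Rightarrow> ('a \<Rightarrow> 'a \<Rightarrow> real) \<Rightarrow> 'a measure \<Rightarrow> bool" where
  "property_tau l c M \<longleftrightarrow> (\<forall>f g B K.
     f \<in> borel_measurable M \<longrightarrow> g \<in> borel_measurable M \<longrightarrow>
     (\<forall>x\<in>space M. 0 \<le> f x \<and> f x \<le> B \<and> 0 \<le> g x \<and> g x \<le> B) \<longrightarrow>
     (\<forall>x\<in>space M. \<forall>y\<in>space M. f x powr (1 - l) * g y powr l \<le> K * exp (l * c x y)) \<longrightarrow>
     (\<integral>x. f x \<partial>M) powr (1 - l) * (\<integral>x. g x \<partial>M) powr l \<le> (K::real))"

lemma property_tauI:
  assumes "\<And>f g B K. f \<in> borel_measurable M \<Longrightarrow> g \<in> borel_measurable M \<Longrightarrow>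
     (\<And>x. x \<in> space M \<Longrightarrow> 0 \<le> f x) \<Longrightarrow> (\<And>x. x \<in> space M \<Longrightarrow> f x \<le> B) \<Longrightarrow>
     (\<And>x. x \<in> space M \<Longrightarrow> 0 \<le> g x) \<Longrightarrow> (\<And>x. x \<in> space M \<Longrightarrow> g x \<le> B) \<Longrightarrow>
     (\<And>x y. x \<in> space M \<Longrightarrow> y \<in> space M \<Longrightarrow> f x powr (1 - l) * g y powr l \<le> K * exp (l * c x y)) \<Longrightarrow>
     (\<integral>x. f x \<partial>M) powr (1 - l) * (\<integral>x. g x \<partial>M) powr l \<le> K"
  shows "property_tau l c M"
  unfolding property_tau_def
proof (intro allI impI)
  fix f g :: "'a \<Rightarrow> real" and B K :: real
  assume "f \<in> borel_measurable M" "g \<in> borel_measurable M"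
    and "\<forall>x\<in>space M. 0 \<le> f x \<and> f x \<le> B \<and> 0 \<le> g x \<and> g x \<le> B"
    and "\<forall>x\<in>space M. \<forall>y\<in>space M. f x powr (1 - l) * g y powr l \<le> K * exp (l * c x y)"
  then show "(\<integral>x. f x \<partial>M) powr (1 - l) * (\<integral>x. g x \<partial>M) powr l \<le> K"
    by (intro assms[of f g B K]) blast+
qed

lemma property_tauD:
  assumes "property_tau l c M"
    and "f \<in> borel_measurable M" "g \<in> borel_measurable M"
    and "\<And>x. x \<in> space M \<Longrightarrow> 0 \<le> f x" "\<And>x. x \<in> space M \<Longrightarrow> f x \<le> B"
    and "\<And>x. x \<in> space M \<Longrightarrow> 0 \<le> g x" "\<And>x. x \<in> space M \<Longrightarrow> g x \<le> B"
    and "\<And>x y. x \<in> space M \<Longrightarrow> y \<in> space M \<Longrightarrow>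
      f x powr (1 - l) * g y powr l \<le> K * exp (l * c x y)"
  shows "(\<integral>x. f x \<partial>M) powr (1 - l) * (\<integral>x. g x \<partial>M) powr l \<le> K"
  by (rule assms(1)[unfolded property_tau_def, rule_format, of f g B])
    (simp_all add: assms(2-8))

text \<open>
  A map carries the inequality along, whatever its regularity: only the cost has to be compared,
  and only at image points.
\<close>

lemma property_tau_distr:
  assumes tau: "property_tau l c M" and T: "T \<in> measurable M N"
    and le: "\<And>x y. x \<in> space M \<Longrightarrow> y \<in> space M \<Longrightarrow> c' (T x) (T y) \<le> c x y"
    and l: "0 \<le> l"
  shows "property_tau l c' (distr M N T)"
proof (rule property_tauI)
  fix f g :: "'b \<Rightarrow> real" and B K :: real
  assume fm: "f \<in> borel_measurable (distr M N T)" and gm: "g \<in> borel_measurable (distr M N T)"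
    and f0: "\<And>x. x \<in> space (distr M N T) \<Longrightarrow> 0 \<le> f x"
    and fB: "\<And>x. x \<in> space (distr M N T) \<Longrightarrow> f x \<le> B"
    and g0: "\<And>x. x \<in> space (distr M N T) \<Longrightarrow> 0 \<le> g x"
    and gB: "\<And>x. x \<in> space (distr M N T) \<Longrightarrow> g x \<le> B"
    and fg: "\<And>x y. x \<in> space (distr M N T) \<Longrightarrow> y \<in> space (distr M N T) \<Longrightarrow>
      f x powr (1 - l) * g y powr l \<le> K * exp (l * c' x y)"
  have fm': "f \<in> borel_measurable N" and gm': "g \<in> borel_measurable N" using fm gm by simp_all
  have TN: "T x \<in> space N" if "x \<in> space M" for x using T that by (rule measurable_space)
  have "(\<integral>x. f (T x) \<partial>M) powr (1 - l) * (\<integral>x. g (T x) \<partial>M) powr l \<le> K"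
  proof (rule property_tauD[OF tau, where B = B])
    show "(\<lambda>x. f (T x)) \<in> borel_measurable M" "(\<lambda>x. g (T x)) \<in> borel_measurable M"
      using fm' gm' T by measurable
    fix x y assume x: "x \<in> space M" and y: "y \<in> space M"
    have 1: "f (T x) powr (1 - l) * g (T y) powr l \<le> K * exp (l * c' (T x) (T y))"
      using fg x y TN by simp
    have "0 \<le> f (T x) powr (1 - l) * g (T y) powr l" by simp
    with 1 have "0 \<le> K * exp (l * c' (T x) (T y))" by linarith
    then have "0 \<le> K" by (simp add: zero_le_mult_iff)
    then have "K * exp (l * c' (T x) (T y)) \<le> K * exp (l * c x y)"
      using le[OF x y] l by (intro mult_left_mono) (auto intro!: mult_left_mono)
    with 1 show "f (T x) powr (1 - l) * g (T y) powr l \<le> K * exp (l * c x y)" by linarith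
  qed (use f0 fB g0 gB TN in auto)
  then show "(\<integral>x. f x \<partial>distr M N T) powr (1 - l) * (\<integral>x. g x \<partial>distr M N T) powr l \<le> K"
    using T fm' gm' by (simp add: integral_distr)
qed

text \<open>
  Integrating out the second variable for frozen first variables \<open>a\<close>, \<open>a'\<close> gives a pair of functions
  of the first variable that satisfies the hypothesis with \<open>c1\<close>; the factor \<open>exp (l * c1 a a')\<close>
  is absorbed by the constant \<open>K\<close>. This is why \<open>K\<close> is part of the definition.
\<close>

lemma property_tau_pair:
  fixes M1 :: "'a measure" and M2 :: "'b measure"
  assumes M1: "prob_space M1" and M2: "prob_space M2"
    and tau1: "property_tau l c1 M1" and tau2: "property_tau l c2 M2"
  shows "property_tau l (\<lambda>x y. c1 (fst x) (fst y) + c2 (snd x) (snd y)) (M1 \<Otimes>\<^sub>M M2)"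
proof (rule property_tauI)
  interpret M1: prob_space M1 by fact
  interpret M2: prob_space M2 by fact
  interpret P: pair_prob_space M1 M2 ..
  fix f g :: "'a \<times> 'b \<Rightarrow> real" and B K :: real
  assume fm[measurable]: "f \<in> borel_measurable (M1 \<Otimes>\<^sub>M M2)"
    and gm[measurable]: "g \<in> borel_measurable (M1 \<Otimes>\<^sub>M M2)"
    and f0: "\<And>x. x \<in> space (M1 \<Otimes>\<^sub>M M2) \<Longrightarrow> 0 \<le> f x"
    and fB: "\<And>x. x \<in> space (M1 \<Otimes>\<^sub>M M2) \<Longrightarrow> f x \<le> B"
    and g0: "\<And>x. x \<in> space (M1 \<Otimes>\<^sub>M M2) \<Longrightarrow> 0 \<le> g x"
    and gB: "\<And>x. x \<in> space (M1 \<Otimes>\<^sub>M M2) \<Longrightarrow> g x \<le> B"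
    and fg: "\<And>x y. x \<in> space (M1 \<Otimes>\<^sub>M M2) \<Longrightarrow> y \<in> space (M1 \<Otimes>\<^sub>M M2) \<Longrightarrow>
      f x powr (1 - l) * g y powr l \<le> K * exp (l * (c1 (fst x) (fst y) + c2 (snd x) (snd y)))"
  have sp: "(a, b) \<in> space (M1 \<Otimes>\<^sub>M M2)" if "a \<in> space M1" "b \<in> space M2" for a b
    using that by (simp add: space_pair_measure)
  have int2: "integrable M2 (\<lambda>b. h (a, b))" "0 \<le> (\<integral>b. h (a, b) \<partial>M2)" "(\<integral>b. h (a, b) \<partial>M2) \<le> B"
    if a: "a \<in> space M1" and h[measurable]: "h \<in> borel_measurable (M1 \<Otimes>\<^sub>M M2)"
      and h0: "\<And>x. x \<in> space (M1 \<Otimes>\<^sub>M M2) \<Longrightarrow> 0 \<le> h x"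
      and hB: "\<And>x. x \<in> space (M1 \<Otimes>\<^sub>M M2) \<Longrightarrow> h x \<le> B" for a and h :: "'a \<times> 'b \<Rightarrow> real"
  proof -
    show i: "integrable M2 (\<lambda>b. h (a, b))"
      by (rule M2.integrable_const_bound[where B = B])
        (use h0 hB sp a in \<open>auto intro!: AE_I2\<close>)
    show "0 \<le> (\<integral>b. h (a, b) \<partial>M2)" using h0 sp a by (intro integral_nonneg_AE AE_I2) auto
    have "(\<integral>b. h (a, b) \<partial>M2) \<le> (\<integral>b. B \<partial>M2)"
      using hB sp a i by (intro integral_mono) auto
    then show "(\<integral>b. h (a, b) \<partial>M2) \<le> B" by (simp add: M2.prob_space)
  qed
  have fst_int: "(\<integral>x. h x \<partial>(M1 \<Otimes>\<^sub>M M2)) = (\<integral>a. \<integral>b. h (a, b) \<partial>M2 \<partial>M1)"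
    if h[measurable]: "h \<in> borel_measurable (M1 \<Otimes>\<^sub>M M2)"
      and h0: "\<And>x. x \<in> space (M1 \<Otimes>\<^sub>M M2) \<Longrightarrow> 0 \<le> h x"
      and hB: "\<And>x. x \<in> space (M1 \<Otimes>\<^sub>M M2) \<Longrightarrow> h x \<le> B" for h :: "'a \<times> 'b \<Rightarrow> real"
    by (rule P.integral_fst'[symmetric], rule P.integrable_const_bound[where B = B])
        (use h0 hB in \<open>auto intro!: AE_I2\<close>)
  note intf = int2[OF _ fm f0 fB] and intg = int2[OF _ gm g0 gB]
  have "(\<integral>a. \<integral>b. f (a, b) \<partial>M2 \<partial>M1) powr (1 - l) * (\<integral>a. \<integral>b. g (a, b) \<partial>M2 \<partial>M1) powr l \<le> K"
  proof (rule property_tauD[OF tau1, where B = B])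
    fix a a' assume a: "a \<in> space M1" and a': "a' \<in> space M1"
    show "(\<integral>b. f (a, b) \<partial>M2) powr (1 - l) * (\<integral>b. g (a', b) \<partial>M2) powr l \<le> K * exp (l * c1 a a')"
    proof (rule property_tauD[OF tau2, where B = B])
      fix b b' assume b: "b \<in> space M2" and b': "b' \<in> space M2"
      show "f (a, b) powr (1 - l) * g (a', b') powr l \<le> K * exp (l * c1 a a') * exp (l * c2 b b')"
        using fg[of "(a, b)" "(a', b')"] sp a a' b b' by (simp add: algebra_simps exp_add)
    qed (use f0 g0 fB gB sp a a' in auto)
  qed (use intf intg in auto)
  then show "(\<integral>x. f x \<partial>(M1 \<Otimes>\<^sub>M M2)) powr (1 - l) * (\<integral>x. g x \<partial>(M1 \<Otimes>\<^sub>M M2)) powr l \<le> K"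
    using fst_int[OF fm f0 fB] fst_int[OF gm g0 gB] by simp
qed

lemma property_tau_PiM:
  fixes n :: nat
  assumes M: "prob_space M" and tau: "property_tau l c M" and l: "0 < l" "l < 1"
  shows "property_tau l (\<lambda>x y. \<Sum>i<n. c (x i) (y i)) (Pi\<^sub>M {..<n} (\<lambda>_. M))"
proof (induction n)
  case 0
  show ?case
  proof (rule property_tauI)
    interpret P0: prob_space "Pi\<^sub>M {..<0::nat} (\<lambda>_. M)" using M by (intro prob_space_PiM)
    fix f g :: "(nat \<Rightarrow> 'a) \<Rightarrow> real" and B K :: real
    assume fg: "\<And>x y. x \<in> space (Pi\<^sub>M {..<0} (\<lambda>_. M)) \<Longrightarrow> y \<in> space (Pi\<^sub>M {..<0} (\<lambda>_. M)) \<Longrightarrow>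
      f x powr (1 - l) * g y powr l \<le> K * exp (l * (\<Sum>i<(0::nat). c (x i) (y i)))"
    define u :: "nat \<Rightarrow> 'a" where "u = (\<lambda>k. undefined)"
    have sp: "space (Pi\<^sub>M {..<0::nat} (\<lambda>_. M)) = {u}" by (simp add: space_PiM u_def)
    have "(\<integral>x. h x \<partial>Pi\<^sub>M {..<0} (\<lambda>_. M)) = h u" for h :: "(nat \<Rightarrow> 'a) \<Rightarrow> real"
    proof -
      have "(\<integral>x. h x \<partial>Pi\<^sub>M {..<0} (\<lambda>_. M)) = (\<integral>x. h u \<partial>Pi\<^sub>M {..<0::nat} (\<lambda>_. M))"
        by (rule Bochner_Integration.integral_cong[OF refl]) (use sp in auto)
      also have "\<dots> = h u" using P0.prob_space by simp
      finally show ?thesis .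
    qed
    then show "(\<integral>x. f x \<partial>Pi\<^sub>M {..<0} (\<lambda>_. M)) powr (1 - l) * (\<integral>x. g x \<partial>Pi\<^sub>M {..<0} (\<lambda>_. M)) powr l \<le> K"
      using fg[of u u] sp by simp
  qed
next
  case (Suc n)
  have P: "prob_space (Pi\<^sub>M {..<n} (\<lambda>_. M))" using M by (intro prob_space_PiM)
  have eq: "Pi\<^sub>M {..<Suc n} (\<lambda>_. M) = distr (M \<Otimes>\<^sub>M Pi\<^sub>M {..<n} (\<lambda>_. M))
      (Pi\<^sub>M (insert n {..<n}) (\<lambda>_. M)) (\<lambda>(x, X). X(n := x))"
    using distr_pair_PiM_eq_PiM[of "{..<n}" "\<lambda>_. M" n] M by (simp add: lessThan_Suc)
  show ?case
    unfolding eq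
    by (rule property_tau_distr[OF property_tau_pair[OF M P tau Suc.IH]])
      (use l in \<open>auto simp: lessThan_Suc space_pair_measure intro!: sum.cong\<close>)
qed

text \<open>
  The inequality for indicator functions is a concentration statement: two sets at cost at least
  \<open>\<kappa>\<close> from each other cannot both be large.
\<close>

lemma property_tau_sets:
  assumes M: "prob_space M" and tau: "property_tau l c M" and l: "0 < l" "l < 1"
    and A: "A \<in> sets M" and B: "B \<in> sets M"
    and AB: "\<And>x y. x \<in> A \<Longrightarrow> y \<in> B \<Longrightarrow> \<kappa> \<le> c x y"
  shows "measure M A powr (1 - l) * measure M B powr l \<le> exp (- (l * \<kappa>))"
proof -
  interpret prob_space M by fact
  have "(\<integral>x. indicator A x \<partial>M) powr (1 - l) * (\<integral>x. indicator B x \<partial>M) powr l \<le> exp (- (l * \<kappa>))"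
  proof (rule property_tauD[OF tau, where B = 1])
    fix x y assume "x \<in> space M" "y \<in> space M"
    show "indicator A x powr (1 - l) * indicator B y powr l \<le> exp (- (l * \<kappa>)) * exp (l * c x y)"
    proof (cases "x \<in> A \<and> y \<in> B")
      case True
      then have "l * \<kappa> \<le> l * c x y" using AB l by (intro mult_left_mono) auto
      then show ?thesis using True by (simp flip: exp_add)
    qed (auto simp: indicator_def)
  qed (use A B in \<open>auto simp: indicator_def\<close>)
  then show ?thesis using A B by simp
qed

lemma property_tau_half:
  assumes M: "prob_space M" and tau: "property_tau l c M" and l: "0 < l" "l < 1"
    and A: "A \<in> sets M" and B: "B \<in> sets M" and half: "1 / 2 \<le> measure M A"
    and AB: "\<And>x y. x \<in> A \<Longrightarrow> y \<in> B \<Longrightarrow> \<kappa> \<le> c x y"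
  shows "measure M B \<le> 2 powr ((1 - l) / l) * exp (- \<kappa>)"
proof -
  have "(1 / 2) powr (1 - l) * measure M B powr l \<le> measure M A powr (1 - l) * measure M B powr l"
    using half l by (intro mult_right_mono powr_mono2) auto
  also have "\<dots> \<le> exp (- (l * \<kappa>))" by (rule property_tau_sets[OF M tau l A B AB])
  finally have "measure M B powr l \<le> 2 powr (1 - l) * exp (- (l * \<kappa>))"
    by (simp add: powr_divide field_simps)
  then have "(measure M B powr l) powr (1 / l) \<le> (2 powr (1 - l) * exp (- (l * \<kappa>))) powr (1 / l)"
    using l by (intro powr_mono2) auto
  then show ?thesis using l by (simp add: powr_powr powr_mult exp_powr_real)
qed

section \<open>Monotone transport on the line\<close>

text \<open>
  The passage from extended nonnegative integrals to real ones, for a density of finite mass.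
\<close>

lemma measure_density_lborel:
  fixes p :: "real \<Rightarrow> real"
  assumes [measurable]: "p \<in> borel_measurable borel" and p0: "\<And>x. 0 \<le> p x"
    and fin: "finite_measure (density lborel (\<lambda>x. ennreal (p x)))" and A[measurable]: "A \<in> sets borel"
  shows "set_integrable lborel A p"
    and "measure (density lborel (\<lambda>x. ennreal (p x))) A = (LINT x:A|lborel. p x)"
proof -
  interpret finite_measure "density lborel (\<lambda>x. ennreal (p x))" by fact
  have e: "emeasure (density lborel (\<lambda>x. ennreal (p x))) A = (\<integral>\<^sup>+x. ennreal (indicator A x * p x) \<partial>lborel)"
    by (subst emeasure_density) (auto intro!: nn_integral_cong simp: indicator_def)
  show i: "set_integrable lborel A p"
    unfolding set_integrable_def
  proof (rule integrableI_bounded)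
    show "(\<integral>\<^sup>+x. ennreal (norm (indicator A x *\<^sub>R p x)) \<partial>lborel) < \<infinity>"
      using e p0 emeasure_finite[of A] by (simp add: top.not_eq_extremum abs_mult)
  qed measurable
  show "measure (density lborel (\<lambda>x. ennreal (p x))) A = (LINT x:A|lborel. p x)"
    using i p0 unfolding measure_def e set_integrable_def set_lebesgue_integral_def
    by (subst nn_integral_eq_integral) (auto intro!: integral_nonneg_AE)
qed

lemma cdf_has_real_derivative:
  fixes p :: "real \<Rightarrow> real"
  assumes p[measurable]: "p \<in> borel_measurable borel" and p0: "\<And>x. 0 \<le> p x"
    and fin: "finite_measure (density lborel (\<lambda>x. ennreal (p x)))"
    and S: "open S" "continuous_on S p" "x \<in> S"
  shows "(cdf (density lborel (\<lambda>x. ennreal (p x))) has_real_derivative p x) (at x)"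
proof -
  let ?M = "density lborel (\<lambda>x. ennreal (p x))"
  interpret finite_measure ?M by fact
  interpret finite_borel_measure ?M by standard simp
  obtain e where e: "0 < e" "cball x e \<subseteq> S" using S open_contains_cball by blast
  have sub: "{x - e..x + e} \<subseteq> S" using e by (auto simp: cball_def dist_real_def subset_iff)
  have eq: "cdf ?M y = cdf ?M (x - e) + integral {x - e..y} p" if y: "y \<in> {x - e..x + e}" for y
  proof -
    have "cdf ?M y - cdf ?M (x - e) = measure ?M {x - e<..y}" 
      using y by (cases "y = x - e") (auto simp: cdf_diff_eq)
    also have "\<dots> = (LINT z:{x - e<..y}|lborel. p z)"
      by (rule measure_density_lborel[OF p p0 fin]) simp
    also have "\<dots> = (LINT z:{x - e..y}|lborel. p z)"
      unfolding set_lebesgue_integral_def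
      by (rule integral_cong_AE) (auto intro!: eventually_mono[OF AE_lborel_singleton[of "x - e"]] simp: indicator_def)
    also have "\<dots> = integral {x - e..y} p"
      by (intro set_borel_integral_eq_integral measure_density_lborel[OF p p0 fin]) simp
    finally show ?thesis by simp
  qed
  have "((\<lambda>y. cdf ?M (x - e) + integral {x - e..y} p) has_real_derivative p x) (at x within {x - e..x + e})"
  proof -
    have "((\<lambda>y. integral {x - e..y} p) has_real_derivative p x) (at x within {x - e..x + e})"
      using e continuous_on_subset[OF S(2) sub] by (intro integral_has_real_derivative) auto
    from DERIV_add[OF DERIV_const this] show ?thesis by simp
  qed
  then have "(cdf ?M has_real_derivative p x) (at x within {x - e..x + e})"
    by (rule has_field_derivative_transform_within[where d=1]) (use e in \<open>simp_all add: eq[symmetric]\<close>)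
  moreover have "at x within {x - e..x + e} = at x"
    using e by (intro at_within_interior) (auto simp: interior_atLeastAtMost_real)
  ultimately show ?thesis by simp
qed

text \<open>
  The interval \<open>S\<close> carries the measure: it is the whole line for \<open>\<nu> \<alpha>\<close> and the open half line for the
  exponential law.
\<close>

locale positive_density =
  fixes p :: "real \<Rightarrow> real" and S :: "real set"
  assumes meas[measurable]: "p \<in> borel_measurable borel" and nonneg: "0 \<le> p x"
    and prob: "prob_space (density lborel (\<lambda>x. ennreal (p x)))"
    and S: "open S" "is_interval S" and cont: "continuous_on S p"
    and pos: "x \<in> S \<Longrightarrow> 0 < p x" and zero: "x \<notin> S \<Longrightarrow> p x = 0"
begin

abbreviation law where "law \<equiv> density lborel (\<lambda>x. ennreal (p x))"

sublocale prob_space law by (rule prob)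
sublocale real_distribution law by standard simp_all

lemma cdf_deriv: "x \<in> S \<Longrightarrow> (cdf law has_real_derivative p x) (at x)"
  by (rule cdf_has_real_derivative[OF meas nonneg _ S(1) cont]) (auto intro: finite_measure_axioms)

lemma cdf_isCont: "isCont (cdf law) x"
  unfolding isCont_cdf measure_def by (simp add: emeasure_density)

lemma cdf_strict: assumes "x \<in> S" "y \<in> S" "x < y" shows "cdf law x < cdf law y"
proof (rule DERIV_pos_imp_increasing[where f = "cdf law"])
  fix z assume "x \<le> z" "z \<le> y"
  then have "z \<in> S" using S(2) assms unfolding is_interval_1 by blast
  then show "\<exists>d. (cdf law has_real_derivative d) (at z) \<and> 0 < d" using cdf_deriv pos by blast
qed fact

text \<open>
  Since \<open>S\<close> is an interval, a point outside it has the whole mass on one side.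
\<close>

lemma cdf_outside: assumes y: "y \<notin> S" shows "cdf law y = 0 \<or> cdf law y = 1"
proof (cases "\<exists>s\<in>S. s \<le> y")
  case False
  then have z: "p x = 0" if "x \<le> y" for x using that zero by auto
  have "measure law {..y} = (LINT x:{..y}|lborel. p x)"
    by (rule measure_density_lborel) (auto simp: nonneg intro: finite_measure_axioms)
  also have "\<dots> = (LINT x:{..y}|lborel. 0)"
    unfolding set_lebesgue_integral_def using z by (intro Bochner_Integration.integral_cong) (auto simp: indicator_def)
  finally show ?thesis by (simp add: cdf_def)
next
  case True
  then obtain s where s: "s \<in> S" "s \<le> y" by blast
  have z: "p x = 0" if "x > y" for x 
    using that zero s y S(2) unfolding is_interval_1 by (metis less_imp_le)
  have "measure law {y<..} = (LINT x:{y<..}|lborel. p x)"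
    by (rule measure_density_lborel) (auto simp: nonneg intro: finite_measure_axioms)
  also have "\<dots> = (LINT x:{y<..}|lborel. 0)"
    unfolding set_lebesgue_integral_def using z by (intro Bochner_Integration.integral_cong) (auto simp: indicator_def)
  finally have "measure law {y<..} = 0" by simp
  moreover have "measure law {..y} = 1 - measure law {y<..}"
    using prob_compl[of "{y<..}"] by (simp add: Compl_eq_Diff_UNIV[symmetric] Compl_greaterThan)
  ultimately show ?thesis by (simp add: cdf_def)
qed

lemma cdf_surj: assumes "0 < t" "t < 1" obtains y where "y \<in> S" "cdf law y = t"
proof -
  obtain a where a: "cdf law a < t"
    using order_tendstoD(2)[OF cdf_lim_at_bot \<open>0 < t\<close>] by (auto simp: eventually_at_bot_linorder)
  obtain b where b: "t < cdf law b"
    using order_tendstoD(1)[OF cdf_lim_at_top_prob \<open>t < 1\<close>] by (auto simp: eventually_at_top_linorder)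
  have "a \<le> b" using a b cdf_nondecreasing[of b a] by linarith
  then obtain y where y: "cdf law y = t"
    using IVT[of "cdf law" a t b] a b cdf_isCont by (meson less_imp_le)
  with cdf_outside[of y] assms have "y \<in> S" by auto
  with y that show ?thesis by blast
qed

lemma cdf_in: assumes "x \<in> S" shows "0 < cdf law x" "cdf law x < 1"
proof -
  obtain e where e: "0 < e" "cball x e \<subseteq> S" using S assms open_contains_cball by blast
  then have "x - e \<in> S" "x + e \<in> S" by (auto simp: cball_def dist_real_def subset_iff)
  then show "0 < cdf law x" "cdf law x < 1"
    using cdf_strict[of "x - e" x] cdf_strict[of x "x + e"] assms e cdf_nonneg[of "x - e"] cdf_bounded_prob[of "x + e"]
    by linarith+
qed

end

text \<open>
  The increasing rearrangement that carries the first measure to the second. It is obtained by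
  inverting the second distribution function, which is strictly increasing and continuously
  differentiable where its density is positive, so the inverse function theorem gives the
  derivative.
\<close>

lemma monotone_transport:
  assumes "positive_density p S" "positive_density q S'"
  obtains T where "\<And>x. x \<in> S \<Longrightarrow> T x \<in> S'"
    and "\<And>x. x \<in> S \<Longrightarrow> cdf (density lborel (\<lambda>x. ennreal (q x))) (T x) = cdf (density lborel (\<lambda>x. ennreal (p x))) x"
    and "\<And>x. x \<in> S \<Longrightarrow> (T has_real_derivative p x / q (T x)) (at x)"
proof -
  interpret p: positive_density p S by fact
  interpret q: positive_density q S' by fact
  define Q where "Q = inv_into S' (cdf q.law)"
  have inj: "inj_on (cdf q.law) S'"
    by (rule linorder_inj_onI) (use q.cdf_strict in \<open>fastforce+\<close>)
  have Q: "Q t \<in> S'" "cdf q.law (Q t) = t" if "0 < t" "t < 1" for t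
  proof -
    have "t \<in> cdf q.law ` S'" using q.cdf_surj[OF that] by blast
    then show "Q t \<in> S'" "cdf q.law (Q t) = t" unfolding Q_def by (auto intro: inv_into_into f_inv_into_f)
  qed
  have Qd: "(Q has_real_derivative inverse (q y)) (at (cdf q.law y))" if y: "y \<in> S'" for y
    unfolding has_field_derivative_def
  proof (rule has_derivative_inverse_strong[OF q.S(1) y])
    show "(cdf q.law has_derivative (*) (q y)) (at y)"
      using q.cdf_deriv[OF y] by (simp add: has_field_derivative_def)
    show "(*) (q y) \<circ> (*) (inverse (q y)) = id" using q.pos[OF y] by (auto simp: fun_eq_iff)
    show "continuous_on S' (cdf q.law)" using q.cdf_isCont by (simp add: continuous_at_imp_continuous_on)
    show "\<And>x. x \<in> S' \<Longrightarrow> Q (cdf q.law x) = x" using inj by (simp add: Q_def)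
  qed
  show thesis
  proof (rule that[of "\<lambda>x. Q (cdf p.law x)"])
    fix x assume x: "x \<in> S"
    note t = p.cdf_in[OF x]
    show "Q (cdf p.law x) \<in> S'" "cdf q.law (Q (cdf p.law x)) = cdf p.law x" using Q t by blast+
    have "(Q has_real_derivative inverse (q (Q (cdf p.law x)))) (at (cdf p.law x))"
      using Qd[OF Q(1)[OF t]] Q(2)[OF t] by simp
    from DERIV_chain2[OF this p.cdf_deriv[OF x]]
    show "((\<lambda>x. Q (cdf p.law x)) has_real_derivative p x / q (Q (cdf p.law x))) (at x)"
      by (simp add: divide_inverse mult.commute)
  qed
qed

section \<open>The two-function inequality on the line\<close>

lemma powr_split: "x powr (1 - l) * x powr l = x" if "0 \<le> x" for x l :: real
  using that by (simp flip: powr_add)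

lemma tilt_algebra1:
  fixes l a F m n K :: real
  assumes "0 < F" "0 < m"
  shows "(m powr (1 - l) * n powr l / K) * (a * F / m)
    = a * (F / m) powr l * (n powr l * F powr (1 - l) / K)"
proof -
  have "F / m = (F / m) powr (1 - l) * (F / m) powr l"
    using assms by (subst powr_split) auto
  moreover have "(F / m) powr (1 - l) = F powr (1 - l) / m powr (1 - l)"
    using assms by (simp add: powr_divide)
  ultimately have "a * F / m = a * (F powr (1 - l) / m powr (1 - l) * (F / m) powr l)"
    by (metis times_divide_eq_right)
  moreover have "m powr (1 - l) \<noteq> 0" using assms by simp
  ultimately show ?thesis by simp
qed

lemma tilt_algebra2:
  fixes l a F G m n E :: real
  assumes "0 < a" "0 < F" "0 < G" "0 < m" "0 < n"
  shows "a * (F / m) powr l * (n powr l * E / G powr l)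
    = E * (a powr (1 - l) * (a * (F * n / (G * m))) powr l)"
proof -
  have "(a * (F * n / (G * m))) powr l = a powr l * ((F / m) powr l * n powr l / G powr l)"
    using assms by (simp add: powr_mult powr_divide)
  then have "E * (a powr (1 - l) * (a * (F * n / (G * m))) powr l)
     = E * ((a powr (1 - l) * a powr l) * ((F / m) powr l * n powr l / G powr l))" by simp
  then show ?thesis using assms by (simp add: powr_split)
qed

context positive_density begin

lemma integral_bounds:
  assumes [measurable]: "f \<in> borel_measurable borel" and b: "\<And>x. a \<le> f x" "\<And>x. f x \<le> (b::real)"
  shows "integrable law f" "a \<le> (\<integral>x. f x \<partial>law)" "(\<integral>x. f x \<partial>law) \<le> b"
proof -
  have "norm (f x) \<le> max (- a) b" for x using b[of x] by auto
  then show i: "integrable law f"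
    by (intro integrable_const_bound[where B = "max (- a) b"]) (auto intro!: AE_I2)
  have "(\<integral>x. a \<partial>law) \<le> (\<integral>x. f x \<partial>law)" by (intro integral_mono i b) simp
  then show "a \<le> (\<integral>x. f x \<partial>law)" using prob_space by simp
  have "(\<integral>x. f x \<partial>law) \<le> (\<integral>x. b \<partial>law)" by (intro integral_mono i b) simp
  then show "(\<integral>x. f x \<partial>law) \<le> b" using prob_space by simp
qed

text \<open>
  Weighting the density by a positive continuous function keeps it in the class, so that the
  transport lemma applies between two such weights.
\<close>

lemma tilted_density:
  assumes f: "continuous_on UNIV f" and \<eta>: "0 < \<eta>" and b: "\<And>x. \<eta> \<le> f x" "\<And>x. f x \<le> (b::real)"
  shows "positive_density (\<lambda>x. p x * f x / (\<integral>x. f x \<partial>law)) S"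
proof (rule positive_density.intro)
  define m where "m = (\<integral>x. f x \<partial>law)"
  have fm[measurable]: "f \<in> borel_measurable borel" using f by (rule borel_measurable_continuous_onI)
  note i = integral_bounds[OF fm b]
  have m: "0 < m" unfolding m_def using i(2) \<eta> by linarith
  have f0: "0 < f x" for x using b(1)[of x] \<eta> by linarith
  show "(\<lambda>x. p x * f x / (\<integral>x. f x \<partial>law)) \<in> borel_measurable borel" by measurable
  fix x
  show "0 \<le> p x * f x / (\<integral>x. f x \<partial>law)" using m nonneg[of x] f0[of x] unfolding m_def by simp
  show "x \<in> S \<Longrightarrow> 0 < p x * f x / (\<integral>x. f x \<partial>law)" using m pos[of x] f0[of x] unfolding m_def by simp
  show "x \<notin> S \<Longrightarrow> p x * f x / (\<integral>x. f x \<partial>law) = 0" using zero[of x] by simp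
  show "continuous_on S (\<lambda>x. p x * f x / (\<integral>x. f x \<partial>law))"
    using m unfolding m_def by (intro continuous_intros cont continuous_on_subset[OF f]) auto
  have "(\<integral>\<^sup>+x. ennreal (p x * f x / m) \<partial>lborel) = (\<integral>\<^sup>+x. ennreal (f x / m) \<partial>law)"
    using m f0 nonneg by (subst nn_integral_density)
      (auto simp: ennreal_mult'[symmetric] less_imp_le simp flip: ennreal_mult')
  also have "\<dots> = ennreal (\<integral>x. f x / m \<partial>law)"
    using m f0 i by (intro nn_integral_eq_integral) (auto simp: less_imp_le)
  also have "(\<integral>x. f x / m \<partial>law) = 1" using m unfolding m_def by simp
  finally show "prob_space (density lborel (\<lambda>x. ennreal (p x * f x / (\<integral>x. f x \<partial>law))))"
    unfolding m_def[symmetric] by (intro prob_spaceI) (simp add: emeasure_density)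
qed (use S in auto)

text \<open>
  The transport argument for the two-function inequality. Let \<open>T\<close> be the increasing map from the
  measure with weight \<open>f\<close> to the one with weight \<open>g\<close>, and let \<open>z x = x + l * \<theta> (T x - x)\<close> be an
  interpolation between \<open>x\<close> and \<open>T x\<close>. The hypothesis \<open>key\<close>, applied with \<open>q\<close> the derivative
  of \<open>T\<close>, bounds the density at \<open>z x\<close> times the Jacobian of \<open>z\<close> from below by \<open>\<kappa>\<close> times the weighted
  density at \<open>x\<close>. As \<open>z\<close> cannot sweep more than the total mass 1, \<open>\<kappa>\<close> is at most 1, which is the
  claim. The linear choice of \<open>\<theta>\<close> gives the Prekopa-Leindler inequality; the freedom in \<open>\<theta>\<close> is
  needed for the exponential measure.
\<close>

lemma two_function_continuous:
  fixes l :: real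
  assumes l: "0 < l" "l < 1"
    and stay: "\<And>x y. x \<in> S \<Longrightarrow> y \<in> S \<Longrightarrow> x + l * \<theta> (y - x) \<in> S"
    and \<theta>: "\<And>d. (\<theta> has_real_derivative \<theta>' d) (at d)"
    and key: "\<And>x y q. x \<in> S \<Longrightarrow> y \<in> S \<Longrightarrow> 0 < q \<Longrightarrow>
      exp (l * c (y - x)) * (p x powr (1 - l) * (p y * q) powr l)
        \<le> p (x + l * \<theta> (y - x)) * (1 - l * \<theta>' (y - x) + l * \<theta>' (y - x) * q)"
    and f: "continuous_on UNIV f" and g: "continuous_on UNIV g" and \<eta>: "0 < \<eta>"
    and fb: "\<And>x. \<eta> \<le> f x" "\<And>x. f x \<le> B" and gb: "\<And>x. \<eta> \<le> g x" "\<And>x. g x \<le> B"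
    and fg: "\<And>x y. f x powr (1 - l) * g y powr l \<le> K * exp (l * c (y - x))"
  shows "(\<integral>x. f x \<partial>law) powr (1 - l) * (\<integral>x. g x \<partial>law) powr l \<le> K"
proof -
  define mf where "mf = (\<integral>x. f x \<partial>law)"
  define mg where "mg = (\<integral>x. g x \<partial>law)"
  interpret f: positive_density "\<lambda>x. p x * f x / mf" S
    unfolding mf_def by (rule tilted_density[OF f \<eta> fb])
  interpret g: positive_density "\<lambda>x. p x * g x / mg" S
    unfolding mg_def by (rule tilted_density[OF g \<eta> gb])
  have fm: "f \<in> borel_measurable borel" and gm: "g \<in> borel_measurable borel"
    using f g by (auto intro: borel_measurable_continuous_onI)
  have m: "0 < mf" "0 < mg"
    unfolding mf_def mg_def using integral_bounds(2)[OF fm fb] integral_bounds(2)[OF gm gb] \<eta> by linarith+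
  have pos_fg: "0 < f x" "0 < g x" for x using fb(1)[of x] gb(1)[of x] \<eta> by linarith+
  have K: "0 < K"
  proof -
    have "0 < f 0 powr (1 - l) * g 0 powr l" using pos_fg by (simp add: less_le)
    also note fg[of 0 0]
    finally show ?thesis by (simp add: zero_less_mult_iff)
  qed
  obtain T where T: "\<And>x. x \<in> S \<Longrightarrow> T x \<in> S"
      "\<And>x. x \<in> S \<Longrightarrow> cdf g.law (T x) = cdf f.law x"
      "\<And>x. x \<in> S \<Longrightarrow> (T has_real_derivative (p x * f x / mf) / (p (T x) * g (T x) / mg)) (at x)"
    by (rule monotone_transport[OF f.positive_density_axioms g.positive_density_axioms]) (rule that)
  define z where "z x = x + l * \<theta> (T x - x)" for x
  define \<kappa> where "\<kappa> = mf powr (1 - l) * mg powr l / K"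
  have \<kappa>: "0 < \<kappa>" unfolding \<kappa>_def using m K by simp
  \<comment> \<open>the interpolated map \<open>z\<close> pushes mass forward at least \<open>\<kappa>\<close> times as fast as \<open>f\<close>\<close>
  have deriv: "\<exists>d. ((\<lambda>x. cdf law (z x) - \<kappa> * cdf f.law x) has_real_derivative d) (at x) \<and> 0 \<le> d"
    if x: "x \<in> S" for x
  proof -
    let ?y = "T x" let ?d = "T x - x"
    define q where "q = (p x * f x / mf) / (p ?y * g ?y / mg)"
    have y: "?y \<in> S" using T(1) x .
    have q0: "0 < q" unfolding q_def using pos[OF x] pos[OF y] pos_fg m by simp
    have Td: "(T has_real_derivative q) (at x)" unfolding q_def using T(3)[OF x] .
    have "(z has_real_derivative 1 + l * (\<theta>' ?d * (q - 1))) (at x)"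
      unfolding z_def
      by (auto intro!: derivative_eq_intros DERIV_chain2[OF \<theta>] Td)
    moreover have zS: "z x \<in> S" unfolding z_def by (rule stay[OF x y])
    ultimately have d: "((\<lambda>x. cdf law (z x) - \<kappa> * cdf f.law x) has_real_derivative
        p (z x) * (1 + l * (\<theta>' ?d * (q - 1))) - \<kappa> * (p x * f x / mf)) (at x)"
      by (intro DERIV_diff DERIV_cmult DERIV_chain2[OF cdf_deriv] f.cdf_deriv x)
    have pyq: "p ?y * q = p x * (f x * mg / (g ?y * mf))"
      unfolding q_def using pos[OF x] pos[OF y] pos_fg m by (simp add: field_simps)
    have "\<kappa> * (p x * f x / mf) = p x * (f x / mf) powr l * (mg powr l * f x powr (1 - l) / K)"
      unfolding \<kappa>_def by (rule tilt_algebra1) (use m pos_fg in auto)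
    also have "\<dots> \<le> p x * (f x / mf) powr l * (mg powr l * exp (l * c ?d) / g ?y powr l)"
    proof (intro mult_left_mono)
      have "f x powr (1 - l) * g ?y powr l \<le> K * exp (l * c ?d)" by (rule fg)
      then have "f x powr (1 - l) / K \<le> exp (l * c ?d) / g ?y powr l"
        using K pos_fg(2)[of ?y] by (simp add: field_simps)
      from mult_left_mono[OF this, of "mg powr l"]
      show "mg powr l * f x powr (1 - l) / K \<le> mg powr l * exp (l * c ?d) / g ?y powr l" by simp
    qed (use pos[OF x] in auto)
    also have "\<dots> = exp (l * c ?d) * (p x powr (1 - l) * (p ?y * q) powr l)"
      unfolding pyq by (rule tilt_algebra2) (use pos[OF x] pos_fg m in auto)
    also have "\<dots> \<le> p (z x) * (1 - l * \<theta>' ?d + l * \<theta>' ?d * q)"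
      unfolding z_def by (rule key[OF x y q0])
    finally show ?thesis using d by (intro exI conjI) (auto simp: algebra_simps)
  qed
  have le: "\<kappa> * (t - s) \<le> 1" if st: "0 < s" "s < t" "t < 1" for s t
  proof -
    obtain a where a: "a \<in> S" "cdf f.law a = s" using f.cdf_surj[of s] st by auto
    obtain b where b: "b \<in> S" "cdf f.law b = t" using f.cdf_surj[of t] st by auto
    have ab: "a < b"
      using f.cdf_nondecreasing[of b a] a b st by (meson not_le)
    have "cdf law (z a) - \<kappa> * cdf f.law a \<le> cdf law (z b) - \<kappa> * cdf f.law b"
    proof (rule DERIV_nonneg_imp_nondecreasing[where f = "\<lambda>x. cdf law (z x) - \<kappa> * cdf f.law x"])
      fix x assume "a \<le> x" "x \<le> b"
      then have "x \<in> S" using S(2) a b unfolding is_interval_1 by blast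
      then show "\<exists>d. ((\<lambda>x. cdf law (z x) - \<kappa> * cdf f.law x) has_real_derivative d) (at x) \<and> 0 \<le> d"
        by (rule deriv)
    qed (use ab in simp)
    then show ?thesis using a b cdf_nonneg[of "z a"] cdf_bounded_prob[of "z b"]
      by (simp add: algebra_simps)
  qed
  have "\<kappa> \<le> 1"
  proof (rule ccontr)
    assume "\<not> \<kappa> \<le> 1"
    then have "1 < \<kappa>" by simp
    then obtain e where e: "0 < e" "e < 1/2" "1 < \<kappa> * (1 - 2 * e)"
    proof -
      \<comment> \<open>any positive \<open>e\<close> with \<open>2 * e < 1 - 1 / \<kappa>\<close> would do\<close>
      define e where "e = (1 - 1 / \<kappa>) / 4"
      have "0 < e" "e < 1/2" using \<open>1 < \<kappa>\<close> by (auto simp: e_def field_simps)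
      moreover have "1 < \<kappa> * (1 - 2 * e)" using \<open>1 < \<kappa>\<close> by (simp add: e_def field_simps)
      ultimately show ?thesis using that by blast
    qed
    then show False using le[of e "1 - e"] by (simp add: algebra_simps)
  qed
  then show ?thesis unfolding \<kappa>_def mf_def mg_def using K by simp
qed

end

text \<open>
  The transport argument needs continuous functions. Averaging \<open>f\<close> over a short interval to the
  right of \<open>x\<close> gives a continuous function whose value is attained or exceeded by \<open>f\<close> somewhere
  in that interval, so that pointwise upper bounds survive with slightly moved arguments. The
  integral is not lost in the limit: moving the average onto the density, Fatou's lemma applies
  because the density is continuous on \<open>S\<close> and zero elsewhere.
\<close>

lemma (in positive_density) smoothing:
  assumes fm[measurable]: "f \<in> borel_measurable borel" and a: "0 \<le> a"
    and b: "\<And>x. a \<le> f x" "\<And>x. f x \<le> (B::real)" and d: "0 < d" and e: "0 < e"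
  shows "\<exists>F. continuous_on UNIV F \<and> (\<forall>x. a \<le> F x \<and> F x \<le> B) \<and>
    (\<forall>x. \<exists>x'\<in>{x..x + d}. F x \<le> f x') \<and> (\<integral>x. f x \<partial>law) - e < (\<integral>x. F x \<partial>law)"
proof -
  define U where "U = density lborel (\<lambda>s::real. ennreal (indicator {0..1} s))"
  have "emeasure U (space U) = 1"
    unfolding U_def by (simp add: emeasure_density ennreal_indicator)
  then interpret U: prob_space U by (rule prob_spaceI)
  have [simp, measurable_cong]: "sets U = sets borel" by (simp add: U_def)
  interpret Ul: pair_sigma_finite U lborel ..
  interpret Up: pair_prob_space U law ..
  have AEU: "AE s in U. s \<in> {0..1}" unfolding U_def by (subst AE_density) (auto simp: indicator_def)
  define \<delta> where "\<delta> k = d / real (Suc k)" for k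
  have \<delta>: "0 < \<delta> k" "\<delta> k \<le> d" for k using d by (auto simp: \<delta>_def field_simps)
  have \<delta>0: "\<delta> \<longlonglongrightarrow> 0" unfolding \<delta>_def
    using tendsto_mult_right[OF LIMSEQ_inverse_real_of_nat, of d] by (simp add: divide_inverse mult.commute)
  define F where "F k x = (\<integral>s. f (x + \<delta> k * s) \<partial>U)" for k x
  have bd: "norm (f x) \<le> B" for x using b[of x] a by auto
  have iU: "integrable U (\<lambda>s. f (x + \<delta> k * s))" for k x
    by (rule U.integrable_const_bound[where B = B]) (use bd in auto)
  have Fb: "a \<le> F k x" "F k x \<le> B" for k x
  proof -
    have "(\<integral>s. a \<partial>U) \<le> F k x" unfolding F_def by (intro integral_mono iU b) simp
    then show "a \<le> F k x" using U.prob_space by simp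
    have "F k x \<le> (\<integral>s. B \<partial>U)" unfolding F_def by (intro integral_mono iU b) simp
    then show "F k x \<le> B" using U.prob_space by simp
  qed
  have Fex: "\<exists>x'\<in>{x..x + d}. F k x \<le> f x'" for k x
  proof (rule ccontr)
    assume "\<not> ?thesis"
    then have "f x' < F k x" if "x' \<in> {x..x + d}" for x' using that by (meson not_le)
    moreover have "x + \<delta> k * s \<in> {x..x + d}" if "s \<in> {0..1}" for s
      using that \<delta>[of k] mult_mono[of "\<delta> k" d s 1] by auto
    ultimately have "AE s in U. f (x + \<delta> k * s) < F k x"
      using AEU by (auto elim: eventually_mono)
    from U.expectation_less[OF iU this] show False by (simp add: F_def)
  qed
  have Fcont: "continuous_on UNIV (F k)" for k
  proof -
    have ii: "f integrable_on {u..v}" for u v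
    proof -
      have "set_integrable lborel {u..v} f"
        unfolding set_integrable_def
        by (rule integrableI_bounded_set[where A = "{u..v}" and B = B])
          (use bd a b in \<open>auto simp: indicator_def emeasure_lborel_Icc_eq\<close>)
      then show ?thesis by (rule set_borel_integral_eq_integral)
    qed
    have Feq: "F k x = integral {x..x + \<delta> k} f / \<delta> k" for x
    proof -
      have si: "set_integrable lborel {x..x + \<delta> k} f"
        unfolding set_integrable_def
        by (rule integrableI_bounded_set[where A = "{x..x + \<delta> k}" and B = B])
          (use bd a b in \<open>auto simp: indicator_def emeasure_lborel_Icc_eq\<close>)
      have "integral {x..x + \<delta> k} f = (\<integral>y. indicator {x..x + \<delta> k} y *\<^sub>R f y \<partial>lborel)"
        using set_borel_integral_eq_integral(2)[OF si] by (simp add: set_lebesgue_integral_def)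
      also have "\<dots> = \<bar>\<delta> k\<bar> *\<^sub>R (\<integral>s. indicator {x..x + \<delta> k} (x + \<delta> k * s) *\<^sub>R f (x + \<delta> k * s) \<partial>lborel)"
        by (rule lborel_integral_real_affine) (use \<delta>[of k] in simp)
      also have "(\<lambda>s. indicator {x..x + \<delta> k} (x + \<delta> k * s) *\<^sub>R f (x + \<delta> k * s))
          = (\<lambda>s. indicator {0..1} s *\<^sub>R f (x + \<delta> k * s))"
        using \<delta>[of k] by (auto simp: indicator_def fun_eq_iff zero_le_mult_iff)
      also have "(\<integral>s. indicator {0..1} s *\<^sub>R f (x + \<delta> k * s) \<partial>lborel) = F k x"
        unfolding F_def U_def by (subst integral_density) auto
      finally show ?thesis using \<delta>[of k] by simp
    qed
    have "isCont (F k) x0" for x0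
    proof -
      define u where "u = x0 - 1"
      define v where "v = x0 + 1 + \<delta> k"
      have c: "continuous_on {u..v} (\<lambda>x. integral {u..x} f)"
        by (rule indefinite_integral_continuous_1[OF ii])
      have "continuous_on {x0 - 1..x0 + 1} (\<lambda>x. (integral {u..x + \<delta> k} f - integral {u..x} f) / \<delta> k)"
        using \<delta>[of k]
        by (intro continuous_intros continuous_on_compose2[OF c]) (auto simp: u_def v_def)
      moreover have "(integral {u..x + \<delta> k} f - integral {u..x} f) / \<delta> k = F k x"
        if "x \<in> {x0 - 1..x0 + 1}" for x
        unfolding Feq
        using Henstock_Kurzweil_Integration.integral_combine[OF _ _ ii, of u x "x + \<delta> k"] that \<delta>[of k]
        by (auto simp: u_def)
      ultimately have "continuous_on {x0 - 1..x0 + 1} (F k)" by (rule continuous_on_eq)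
      then show ?thesis by (rule continuous_on_interior) (auto simp: interior_atLeastAtMost_real)
    qed
    then show ?thesis by (simp add: continuous_at_imp_continuous_on)
  qed
  have Fm[measurable]: "F k \<in> borel_measurable borel" for k
    using Fcont by (rule borel_measurable_continuous_onI)
  have F0: "0 \<le> F k x" for k x using Fb(1)[of k x] a by linarith
  have f0: "0 \<le> f x" for x using b(1)[of x] a by linarith
  have nn_F: "(\<integral>\<^sup>+ z. ennreal (f (snd z) * p (snd z - \<delta> k * fst z)) \<partial>(U \<Otimes>\<^sub>M lborel))
      = ennreal (\<integral>x. F k x \<partial>law)" for k
  proof -
    have "(\<integral>\<^sup>+ z. ennreal (f (snd z) * p (snd z - \<delta> k * fst z)) \<partial>(U \<Otimes>\<^sub>M lborel))
        = (\<integral>\<^sup>+ s. \<integral>\<^sup>+ y. ennreal (f y * p (y - \<delta> k * s)) \<partial>lborel \<partial>U)"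
      by (subst lborel.nn_integral_fst[symmetric]) auto
    also have "\<dots> = (\<integral>\<^sup>+ s. \<integral>\<^sup>+ x. ennreal (f (x + \<delta> k * s) * p x) \<partial>lborel \<partial>U)"
    proof (rule nn_integral_cong)
      fix s
      show "(\<integral>\<^sup>+ y. ennreal (f y * p (y - \<delta> k * s)) \<partial>lborel)
          = (\<integral>\<^sup>+ x. ennreal (f (x + \<delta> k * s) * p x) \<partial>lborel)"
        by (subst nn_integral_real_affine[where c = 1 and t = "\<delta> k * s"]) (auto simp: add.commute)
    qed
    also have "\<dots> = (\<integral>\<^sup>+ s. \<integral>\<^sup>+ x. ennreal (f (x + \<delta> k * s)) \<partial>law \<partial>U)"
      by (intro nn_integral_cong, subst nn_integral_density)
        (auto simp: ennreal_mult f0 nonneg mult.commute)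
    also have "\<dots> = (\<integral>\<^sup>+ x. \<integral>\<^sup>+ s. ennreal (f (x + \<delta> k * s)) \<partial>U \<partial>law)"
      by (subst Up.Fubini') auto
    also have "\<dots> = (\<integral>\<^sup>+ x. ennreal (F k x) \<partial>law)"
      unfolding F_def using iU f0 by (intro nn_integral_cong nn_integral_eq_integral) auto
    also have "\<dots> = ennreal (\<integral>x. F k x \<partial>law)"
      by (intro nn_integral_eq_integral integral_bounds(1)[OF Fm Fb]) (auto simp: F0)
    finally show ?thesis .
  qed
  have "ennreal (\<integral>x. f x \<partial>law) = (\<integral>\<^sup>+x. ennreal (f x) \<partial>law)"
    by (intro nn_integral_eq_integral[symmetric] integral_bounds(1)[OF fm b]) (auto simp: f0)
  also have "\<dots> = (\<integral>\<^sup>+y. ennreal (f y * p y) \<partial>lborel)"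
    by (subst nn_integral_density) (auto simp: ennreal_mult f0 nonneg mult.commute)
  also have "\<dots> = (\<integral>\<^sup>+s. \<integral>\<^sup>+y. ennreal (f y * p y) \<partial>lborel \<partial>U)" using U.emeasure_space_1 by simp
  also have "\<dots> = (\<integral>\<^sup>+z. ennreal (f (snd z) * p (snd z)) \<partial>(U \<Otimes>\<^sub>M lborel))"
    by (subst lborel.nn_integral_fst[symmetric]) auto
  also have "\<dots> \<le> (\<integral>\<^sup>+z. liminf (\<lambda>k. ennreal (f (snd z) * p (snd z - \<delta> k * fst z))) \<partial>(U \<Otimes>\<^sub>M lborel))"
  proof (intro nn_integral_mono)
    fix z :: "real \<times> real"
    show "ennreal (f (snd z) * p (snd z)) \<le> liminf (\<lambda>k. ennreal (f (snd z) * p (snd z - \<delta> k * fst z)))"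
    proof (cases "snd z \<in> S")
      case True
      have "isCont p (snd z)" using cont S(1) True by (simp add: continuous_on_eq_continuous_at)
      moreover have "(\<lambda>k. snd z - \<delta> k * fst z) \<longlonglongrightarrow> snd z"
        using \<delta>0 by (auto intro!: tendsto_eq_intros)
      ultimately have "(\<lambda>k. p (snd z - \<delta> k * fst z)) \<longlonglongrightarrow> p (snd z)" by (rule isCont_tendsto_compose)
      then have "(\<lambda>k. ennreal (f (snd z) * p (snd z - \<delta> k * fst z))) \<longlonglongrightarrow> ennreal (f (snd z) * p (snd z))"
        by (intro tendsto_ennrealI tendsto_mult_left)
      then show ?thesis by (simp add: lim_imp_Liminf)
    qed (simp add: zero)
  qed
  also have "\<dots> \<le> liminf (\<lambda>k. \<integral>\<^sup>+z. ennreal (f (snd z) * p (snd z - \<delta> k * fst z)) \<partial>(U \<Otimes>\<^sub>M lborel))"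
    by (rule nn_integral_liminf) simp
  also have "\<dots> = liminf (\<lambda>k. ennreal (\<integral>x. F k x \<partial>law))" unfolding nn_F ..
  finally have lim: "ennreal (\<integral>x. f x \<partial>law) \<le> liminf (\<lambda>k. ennreal (\<integral>x. F k x \<partial>law))" .
  have "\<exists>k. (\<integral>x. f x \<partial>law) - e < (\<integral>x. F k x \<partial>law)"
  proof (cases "(\<integral>x. f x \<partial>law) - e < 0")
    case True
    then show ?thesis using integral_bounds(2)[OF Fm Fb, of 0] a by (intro exI[of _ 0]) linarith
  next
    case False
    then have "ennreal ((\<integral>x. f x \<partial>law) - e) < ennreal (\<integral>x. f x \<partial>law)"
      using e by (intro ennreal_lessI) auto
    also note lim
    finally have "eventually (\<lambda>k. ennreal ((\<integral>x. f x \<partial>law) - e) < ennreal (\<integral>x. F k x \<partial>law)) sequentially"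
      by (rule less_LiminfD)
    from eventually_happens[OF this]
    obtain k where "ennreal ((\<integral>x. f x \<partial>law) - e) < ennreal (\<integral>x. F k x \<partial>law)" by auto
    then show ?thesis using False by (intro exI[of _ k]) (simp add: ennreal_less_iff)
  qed
  then show ?thesis using Fcont Fb Fex by blast
qed

text \<open>
  Subadditivity of a concave power: each of the two fractions of the sum, being at most 1, is
  at most its power.
\<close>

lemma powr_add_le:
  fixes x y a :: real
  assumes "0 \<le> x" "0 \<le> y" "0 \<le> a" "a \<le> 1"
  shows "(x + y) powr a \<le> x powr a + y powr a"
proof (cases "x + y = 0")
  case False
  define s where "s = x + y"
  have s: "0 < s" using False assms by (simp add: s_def)
  have ge: "u \<le> u powr a" if "0 \<le> u" "u \<le> 1" for u :: real
    using powr_mono'[of a 1 u] that assms by (cases "u = 0") auto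
  have "s powr a = s powr a * (x / s + y / s)" using s by (simp add: s_def add_divide_distrib[symmetric])
  also have "\<dots> \<le> s powr a * ((x / s) powr a + (y / s) powr a)"
    using s assms by (intro mult_left_mono add_mono ge) (auto simp: s_def)
  also have "\<dots> = x powr a + y powr a" using s assms by (simp add: powr_divide distrib_left)
  finally show ?thesis by (simp add: s_def)
qed (use assms in auto)

context positive_density begin

text \<open>
  Smoothing moves the two arguments by a small amount, so the inequality for measurable functions
  holds with any cost \<open>c\<close> that is dominated by \<open>c'\<close> uniformly under small displacements.
\<close>

lemma two_function_bounded_below:
  fixes l :: real
  assumes l: "0 < l" "l < 1"
    and stay: "\<And>x y. x \<in> S \<Longrightarrow> y \<in> S \<Longrightarrow> x + l * \<theta> (y - x) \<in> S"
    and \<theta>: "\<And>d. (\<theta> has_real_derivative \<theta>' d) (at d)"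
    and key: "\<And>x y q. x \<in> S \<Longrightarrow> y \<in> S \<Longrightarrow> 0 < q \<Longrightarrow>
      exp (l * c' (y - x)) * (p x powr (1 - l) * (p y * q) powr l)
        \<le> p (x + l * \<theta> (y - x)) * (1 - l * \<theta>' (y - x) + l * \<theta>' (y - x) * q)"
    and slack: "\<And>e. 0 < e \<Longrightarrow> \<exists>d>0. \<forall>D h. \<bar>h\<bar> \<le> d \<longrightarrow> c (D + h) \<le> c' D + e"
    and f[measurable]: "f \<in> borel_measurable borel" and g[measurable]: "g \<in> borel_measurable borel"
    and \<eta>: "0 < \<eta>"
    and fb: "\<And>x. \<eta> \<le> f x" "\<And>x. f x \<le> B" and gb: "\<And>x. \<eta> \<le> g x" "\<And>x. g x \<le> B"
    and fg: "\<And>x y. f x powr (1 - l) * g y powr l \<le> K * exp (l * c (y - x))"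
  shows "(\<integral>x. f x \<partial>law) powr (1 - l) * (\<integral>x. g x \<partial>law) powr l \<le> K"
proof -
  define mf where "mf = (\<integral>x. f x \<partial>law)"
  define mg where "mg = (\<integral>x. g x \<partial>law)"
  have m: "\<eta> \<le> mf" "\<eta> \<le> mg"
    unfolding mf_def mg_def using integral_bounds(2)[OF f fb] integral_bounds(2)[OF g gb] by auto
  have K: "0 < K"
  proof -
    have "0 < f 0 powr (1 - l) * g 0 powr l" using fb(1)[of 0] gb(1)[of 0] \<eta> by (simp add: less_le)
    also note fg[of 0 0]
    finally show ?thesis by (simp add: zero_less_mult_iff)
  qed
  have le: "(mf - e) powr (1 - l) * (mg - e) powr l \<le> K * exp (l * e)" if e: "0 < e" "e < \<eta>" for e
  proof -
    obtain d where d: "0 < d" "\<And>D h. \<bar>h\<bar> \<le> d \<Longrightarrow> c (D + h) \<le> c' D + e"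
      using slack[OF e(1)] by blast
    have \<eta>0: "0 \<le> \<eta>" using \<eta> by simp
    obtain F where F: "continuous_on UNIV F" "\<And>x. \<eta> \<le> F x" "\<And>x. F x \<le> B"
        "\<And>x. \<exists>x'\<in>{x..x + d}. F x \<le> f x'" "mf - e < (\<integral>x. F x \<partial>law)"
      using smoothing[OF f \<eta>0 fb d(1) e(1)] unfolding mf_def by blast
    obtain G where G: "continuous_on UNIV G" "\<And>x. \<eta> \<le> G x" "\<And>x. G x \<le> B"
        "\<And>x. \<exists>x'\<in>{x..x + d}. G x \<le> g x'" "mg - e < (\<integral>x. G x \<partial>law)"
      using smoothing[OF g \<eta>0 gb d(1) e(1)] unfolding mg_def by blast
    have "(\<integral>x. F x \<partial>law) powr (1 - l) * (\<integral>x. G x \<partial>law) powr l \<le> K * exp (l * e)"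
    proof (rule two_function_continuous[OF l stay \<theta> key F(1) G(1) \<eta> F(2,3) G(2,3)])
      fix x y
      obtain x' where x': "x' \<in> {x..x + d}" "F x \<le> f x'" using F(4) by blast
      obtain y' where y': "y' \<in> {y..y + d}" "G y \<le> g y'" using G(4) by blast
      have "F x powr (1 - l) * G y powr l \<le> f x' powr (1 - l) * g y' powr l"
        using F(2)[of x] G(2)[of y] \<eta> l x' y' by (intro mult_mono powr_mono2) auto
      also have "\<dots> \<le> K * exp (l * c (y' - x'))" by (rule fg)
      also have "\<dots> \<le> K * exp (l * (c' (y - x) + e))"
        using d(2)[of "(y' - x') - (y - x)" "y - x"] x' y' K l by auto
      also have "\<dots> = K * exp (l * e) * exp (l * c' (y - x))" by (simp add: exp_add algebra_simps)
      finally show "F x powr (1 - l) * G y powr l \<le> K * exp (l * e) * exp (l * c' (y - x))" .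
    qed
    moreover have "(mf - e) powr (1 - l) * (mg - e) powr l
        \<le> (\<integral>x. F x \<partial>law) powr (1 - l) * (\<integral>x. G x \<partial>law) powr l"
      using F(5) G(5) m e l by (intro mult_mono powr_mono2) auto
    ultimately show ?thesis by linarith
  qed
  have "((\<lambda>e. (mf - e) powr (1 - l) * (mg - e) powr l) \<longlongrightarrow> (mf - 0) powr (1 - l) * (mg - 0) powr l) (at_right 0)"
    using m \<eta> by (intro tendsto_intros) auto
  moreover have "((\<lambda>e. K * exp (l * e)) \<longlongrightarrow> K * exp (l * 0)) (at_right 0)"
    by (intro tendsto_intros)
  moreover have "eventually (\<lambda>e. (mf - e) powr (1 - l) * (mg - e) powr l \<le> K * exp (l * e)) (at_right 0)"
    unfolding eventually_at_right_field using le \<eta> by blast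
  ultimately have "(mf - 0) powr (1 - l) * (mg - 0) powr l \<le> K * exp (l * 0)"
    by (intro tendsto_le[OF trivial_limit_at_right_real]) auto
  then show ?thesis by (simp add: mf_def mg_def)
qed

text \<open>
  Adding a small constant \<open>\<eta>\<close> to both functions makes them bounded below. Because the cost is
  nonnegative, this only increases the constant \<open>K\<close> by an amount that vanishes with \<open>\<eta>\<close>.
\<close>

lemma property_tau_law:
  fixes l :: real
  assumes l: "0 < l" "l < 1"
    and stay: "\<And>x y. x \<in> S \<Longrightarrow> y \<in> S \<Longrightarrow> x + l * \<theta> (y - x) \<in> S"
    and \<theta>: "\<And>d. (\<theta> has_real_derivative \<theta>' d) (at d)"
    and key: "\<And>x y q. x \<in> S \<Longrightarrow> y \<in> S \<Longrightarrow> 0 < q \<Longrightarrow>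
      exp (l * c' (y - x)) * (p x powr (1 - l) * (p y * q) powr l)
        \<le> p (x + l * \<theta> (y - x)) * (1 - l * \<theta>' (y - x) + l * \<theta>' (y - x) * q)"
    and slack: "\<And>e. 0 < e \<Longrightarrow> \<exists>d>0. \<forall>D h. \<bar>h\<bar> \<le> d \<longrightarrow> c (D + h) \<le> c' D + e"
    and c0: "\<And>D. 0 \<le> c D"
  shows "property_tau l (\<lambda>x y. c (y - x)) law"
proof (rule property_tauI)
  fix f g :: "real \<Rightarrow> real" and B K :: real
  assume "f \<in> borel_measurable law" "g \<in> borel_measurable law"
    and "\<And>x. x \<in> space law \<Longrightarrow> 0 \<le> f x" "\<And>x. x \<in> space law \<Longrightarrow> f x \<le> B"
    and "\<And>x. x \<in> space law \<Longrightarrow> 0 \<le> g x" "\<And>x. x \<in> space law \<Longrightarrow> g x \<le> B"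
    and "\<And>x y. x \<in> space law \<Longrightarrow> y \<in> space law \<Longrightarrow> f x powr (1 - l) * g y powr l \<le> K * exp (l * c (y - x))"
  then have fm[measurable]: "f \<in> borel_measurable borel" and gm[measurable]: "g \<in> borel_measurable borel"
    and f: "\<And>x. 0 \<le> f x" "\<And>x. f x \<le> B" and g: "\<And>x. 0 \<le> g x" "\<And>x. g x \<le> B"
    and fg: "\<And>x y. f x powr (1 - l) * g y powr l \<le> K * exp (l * c (y - x))"
    by simp_all
  have B: "0 \<le> B" using f[of 0] by linarith
  define R where "R \<eta> = B powr (1 - l) * \<eta> powr l + \<eta> powr (1 - l) * B powr l + \<eta>" for \<eta>
  define mf where "mf = (\<integral>x. f x \<partial>law)"
  define mg where "mg = (\<integral>x. g x \<partial>law)"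
  note intf = integral_bounds[OF fm f] and intg = integral_bounds[OF gm g]
  have le: "mf powr (1 - l) * mg powr l \<le> K + R \<eta>" if \<eta>: "0 < \<eta>" for \<eta>
  proof -
    have R0: "0 \<le> R \<eta>" unfolding R_def using \<eta> by simp
    have "(\<integral>x. f x + \<eta> \<partial>law) powr (1 - l) * (\<integral>x. g x + \<eta> \<partial>law) powr l \<le> K + R \<eta>"
    proof (rule two_function_bounded_below[OF l stay \<theta> key slack _ _ \<eta>, where B = "B + \<eta>"])
      fix x y
      have "(f x + \<eta>) powr (1 - l) * (g y + \<eta>) powr l
          \<le> (f x powr (1 - l) + \<eta> powr (1 - l)) * (g y powr l + \<eta> powr l)"
        using f g \<eta> l by (intro mult_mono powr_add_le) auto
      also have "\<dots> = f x powr (1 - l) * g y powr l + (f x powr (1 - l) * \<eta> powr l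
          + \<eta> powr (1 - l) * g y powr l + \<eta> powr (1 - l) * \<eta> powr l)"
        by (simp add: algebra_simps)
      also have "\<dots> \<le> K * exp (l * c (y - x)) + R \<eta>"
        unfolding R_def using f g l \<eta>
        by (intro add_mono fg mult_mono powr_mono2) (auto simp: powr_split)
      also have "\<dots> \<le> K * exp (l * c (y - x)) + R \<eta> * exp (l * c (y - x))"
        using mult_left_mono[of 1 "exp (l * c (y - x))" "R \<eta>"] R0 l c0[of "y - x"] by simp
      finally show "(f x + \<eta>) powr (1 - l) * (g y + \<eta>) powr l \<le> (K + R \<eta>) * exp (l * c (y - x))"
        by (simp add: algebra_simps)
    qed (use f g in auto)
    moreover have "(\<integral>x. f x + \<eta> \<partial>law) = mf + \<eta>" "(\<integral>x. g x + \<eta> \<partial>law) = mg + \<eta>"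
      unfolding mf_def mg_def using intf(1) intg(1) prob_space by simp_all
    moreover have "mf powr (1 - l) * mg powr l \<le> (mf + \<eta>) powr (1 - l) * (mg + \<eta>) powr l"
      using intf(2) intg(2) \<eta> l by (intro mult_mono powr_mono2) (auto simp: mf_def mg_def)
    ultimately show ?thesis by simp
  qed
  have "((\<lambda>\<eta>. K + R \<eta>) \<longlongrightarrow> K + R 0) (at_right 0)"
    unfolding R_def using l
    by (intro tendsto_intros tendsto_powr') (auto simp: eventually_at_right_field intro!: exI[of _ 1])
  moreover have "eventually (\<lambda>\<eta>. mf powr (1 - l) * mg powr l \<le> K + R \<eta>) (at_right 0)"
    unfolding eventually_at_right_field using le by (auto intro!: exI[of _ 1])
  ultimately have "mf powr (1 - l) * mg powr l \<le> K + R 0"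
    by (rule tendsto_lowerbound) simp
  then show "(\<integral>x. f x \<partial>law) powr (1 - l) * (\<integral>x. g x \<partial>law) powr l \<le> K"
    using l by (simp add: mf_def mg_def R_def)
qed

end

section \<open>Gaussian, exponential and Laplace measures\<close>

lemma exp_powr_bound:
  fixes \<alpha> :: real
  assumes "0 < \<alpha>"
  obtains C where "0 < C" "\<And>x. exp (- (\<bar>x\<bar> powr \<alpha>)) \<le> C * inverse (1 + x\<^sup>2)"
proof -
  obtain k :: nat where k: "2 / \<alpha> \<le> real k" using real_arch_simple by blast
  have "exp (- (\<bar>x\<bar> powr \<alpha>)) \<le> (2 + fact k) * inverse (1 + x\<^sup>2)" for x
  proof -
    have "(1 + x\<^sup>2) \<le> (2 + fact k) * exp (\<bar>x\<bar> powr \<alpha>)"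
    proof (cases "\<bar>x\<bar> \<le> 1")
      case True
      then have "1 + x\<^sup>2 \<le> 2 * 1" by (simp add: abs_square_le_1)
      also have "\<dots> \<le> (2 + fact k) * exp (\<bar>x\<bar> powr \<alpha>)" by (intro mult_mono) auto
      finally show ?thesis .
    next
      case False
      have "2 \<le> \<alpha> * real k" using k assms by (simp add: field_simps)
      then have "\<bar>x\<bar> powr 2 \<le> \<bar>x\<bar> powr (\<alpha> * real k)" using False by (intro powr_mono) auto
      also have "\<dots> = (\<bar>x\<bar> powr \<alpha>) ^ k" using False by (simp add: powr_powr[symmetric] powr_realpow)
      also have "\<dots> \<le> fact k * exp (\<bar>x\<bar> powr \<alpha>)"
      proof -
        have s: "(\<lambda>n. (\<bar>x\<bar> powr \<alpha>) ^ n /\<^sub>R fact n) sums exp (\<bar>x\<bar> powr \<alpha>)" by (rule exp_converges)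
        have "(\<Sum>n\<in>{k}. (\<bar>x\<bar> powr \<alpha>) ^ n /\<^sub>R fact n) \<le> exp (\<bar>x\<bar> powr \<alpha>)"
          unfolding sums_unique[OF s] by (rule sum_le_suminf[OF sums_summable[OF s]]) auto
        then show ?thesis by (simp add: field_simps)
      qed
      finally have "x\<^sup>2 \<le> fact k * exp (\<bar>x\<bar> powr \<alpha>)" using False by (simp add: powr_numeral)
      moreover have "1 \<le> 2 * exp (\<bar>x\<bar> powr \<alpha>)"
        using one_le_exp_iff[of "\<bar>x\<bar> powr \<alpha>"] by (smt (verit) powr_ge_zero)
      ultimately show ?thesis by (simp add: algebra_simps)
    qed
    moreover have "0 < 1 + x\<^sup>2" by (simp add: add_pos_nonneg)
    ultimately show ?thesis by (simp add: exp_minus field_simps)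
  qed
  then show ?thesis by (intro that[of "2 + fact k"]) (simp add: add_pos_pos)
qed

lemma integrable_exp_powr:
  assumes "0 < \<alpha>" shows "integrable lborel (\<lambda>x::real. exp (- (\<bar>x\<bar> powr \<alpha>)))"
proof -
  obtain C where C: "0 < C" "\<And>x. exp (- (\<bar>x\<bar> powr \<alpha>)) \<le> C * inverse (1 + x\<^sup>2)"
    using exp_powr_bound[OF assms] by blast
  have "integrable lborel (\<lambda>x::real. inverse (1 + x\<^sup>2))"
    using integrable_inverse_1_plus_square by (simp add: set_integrable_def einterval_def)
  then have "integrable lborel (\<lambda>x::real. C * inverse (1 + x\<^sup>2))" by (intro integrable_mult_right) simp
  then show ?thesis
    by (rule Bochner_Integration.integrable_bound) (use C in \<open>auto intro!: AE_I2 simp: add_nonneg_nonneg abs_mult\<close>)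
qed

lemma Y_pos: assumes "0 < \<alpha>" shows "0 < Y \<alpha>"
proof -
  have "0 \<le> Y \<alpha>" unfolding Y_def by (intro integral_nonneg_AE AE_I2) simp
  moreover have "Y \<alpha> \<noteq> 0"
  proof
    assume "Y \<alpha> = 0"
    then have "AE x in lborel. exp (- (\<bar>x::real\<bar> powr \<alpha>)) = 0"
      unfolding Y_def by (subst (asm) integral_nonneg_eq_0_iff_AE[OF integrable_exp_powr[OF assms]]) auto
    then have "AE x::real in lborel. False" by simp
    then show False using AE_iff_measurable[of UNIV lborel "\<lambda>x::real. False"] by simp
  qed
  ultimately show ?thesis by simp
qed

abbreviation \<nu>_density :: "real \<Rightarrow> real \<Rightarrow> real" where
  "\<nu>_density \<alpha> x \<equiv> exp (- (\<bar>x\<bar> powr \<alpha>)) / Y \<alpha>"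

lemma prob_space_\<nu>: assumes "0 < \<alpha>" shows "prob_space (\<nu> \<alpha>)"
proof (rule prob_spaceI)
  have "emeasure (\<nu> \<alpha>) (space (\<nu> \<alpha>)) = (\<integral>\<^sup>+x. ennreal (\<nu>_density \<alpha> x) \<partial>lborel)"
    by (simp add: \<nu>_def emeasure_density)
  also have "\<dots> = ennreal (\<integral>x. \<nu>_density \<alpha> x \<partial>lborel)"
    using Y_pos[OF assms] by (intro nn_integral_eq_integral integrable_divide integrable_exp_powr assms) simp
  also have "(\<integral>x. \<nu>_density \<alpha> x \<partial>lborel) = 1" using Y_pos[OF assms] by (simp add: Y_def)
  finally show "emeasure (\<nu> \<alpha>) (space (\<nu> \<alpha>)) = 1" by simp
qed

lemma positive_density_\<nu>: assumes "0 < \<alpha>" shows "positive_density (\<nu>_density \<alpha>) UNIV"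
proof (rule positive_density.intro)
  show "prob_space (density lborel (\<lambda>x. ennreal (\<nu>_density \<alpha> x)))"
    using prob_space_\<nu>[OF assms] by (simp add: \<nu>_def)
  show "continuous_on UNIV (\<nu>_density \<alpha>)"
    using assms Y_pos[OF assms] by (intro continuous_intros continuous_on_powr') auto
qed (use Y_pos[OF assms] in \<open>auto simp: is_interval_univ\<close>)

text \<open>
  For the density proportional to \<open>exp (- x\<^sup>2)\<close> the linear interpolation gains exactly
  \<open>l * (1 - l) * (y - x)\<^sup>2\<close> in the exponent, by completing the square. A second factor
  \<open>1 - l\<close> pays for the smoothing. The cost tends to the sharp \<open>(y - x)\<^sup>2\<close> as \<open>l\<close> tends to 0.
\<close>

lemma property_tau_gaussian:
  assumes l: "0 < l" "l < 1"
  shows "property_tau l (\<lambda>x y. (1 - l)\<^sup>2 * (y - x)\<^sup>2) (\<nu> 2)"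
proof -
  interpret positive_density "\<nu>_density 2" UNIV by (rule positive_density_\<nu>) simp
  have Y: "0 < Y 2" by (rule Y_pos) simp
  have "property_tau l (\<lambda>x y. (\<lambda>d. (1 - l)\<^sup>2 * d\<^sup>2) (y - x)) law"
  proof (rule property_tau_law[OF l, where \<theta> = "\<lambda>d. d" and \<theta>' = "\<lambda>_. 1" and c' = "\<lambda>d. (1 - l) * d\<^sup>2"])
    fix x y q :: real assume q: "0 < q"
    have "exp (l * ((1 - l) * (y - x)\<^sup>2)) * (\<nu>_density 2 x powr (1 - l) * (\<nu>_density 2 y * q) powr l)
      = (exp (l * ((1 - l) * (y - x)\<^sup>2)) * exp (- ((1 - l) * x\<^sup>2)) * exp (- (l * y\<^sup>2)))
        / (Y 2 powr (1 - l) * Y 2 powr l) * q powr l"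
      using Y q by (simp add: powr_divide powr_mult exp_powr_real mult.commute)
    also have "exp (l * ((1 - l) * (y - x)\<^sup>2)) * exp (- ((1 - l) * x\<^sup>2)) * exp (- (l * y\<^sup>2))
      = exp (- ((x + l * (y - x))\<^sup>2))"
      by (simp flip: exp_add) (simp add: algebra_simps power2_eq_square)
    also have "Y 2 powr (1 - l) * Y 2 powr l = Y 2" using Y by (simp add: powr_split)
    also have "exp (- ((x + l * (y - x))\<^sup>2)) / Y 2 * q powr l
        \<le> exp (- ((x + l * (y - x))\<^sup>2)) / Y 2 * (1 - l * 1 + l * 1 * q)"
      using Youngs_inequality_0[of "1 - l" l 1 q] l q Y by (intro mult_left_mono) auto
    finally show "exp (l * ((1 - l) * (y - x)\<^sup>2)) * (\<nu>_density 2 x powr (1 - l) * (\<nu>_density 2 y * q) powr l)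
        \<le> \<nu>_density 2 (x + l * (y - x)) * (1 - l * 1 + l * 1 * q)" by simp
  next
    fix e :: real assume e: "0 < e"
    have "(1 - l)\<^sup>2 * (D + h)\<^sup>2 \<le> (1 - l) * D\<^sup>2 + e" if h: "\<bar>h\<bar> \<le> sqrt (e * l)" for D h
    proof -
      have "(1 - l) * D\<^sup>2 + h\<^sup>2 * (1 - l)\<^sup>2 / l - (1 - l)\<^sup>2 * (D + h)\<^sup>2
          = (1 - l) / l * (l * D - (1 - l) * h)\<^sup>2"
        using l by (simp add: field_simps power2_eq_square) 
      then have "(1 - l)\<^sup>2 * (D + h)\<^sup>2 \<le> (1 - l) * D\<^sup>2 + h\<^sup>2 * (1 - l)\<^sup>2 / l"
        using l by (smt (verit) divide_nonneg_nonneg mult_nonneg_nonneg zero_le_power2)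
      moreover have "h\<^sup>2 * (1 - l)\<^sup>2 / l \<le> e"
      proof -
        have "h\<^sup>2 \<le> e * l" using power_mono[OF h, of 2] e l by simp
        moreover have "(1 - l)\<^sup>2 \<le> 1" using l by (simp add: power_le_one)
        ultimately have "h\<^sup>2 * (1 - l)\<^sup>2 \<le> (e * l) * 1" using e l by (intro mult_mono) auto
        then show ?thesis using l by (simp add: field_simps)
      qed
      ultimately show ?thesis by linarith
    qed
    then show "\<exists>d>0. \<forall>D h. \<bar>h\<bar> \<le> d \<longrightarrow> (1 - l)\<^sup>2 * (D + h)\<^sup>2 \<le> (1 - l) * D\<^sup>2 + e"
      using e l by (intro exI[of _ "sqrt (e * l)"]) auto
  qed auto
  then show "property_tau l (\<lambda>x y. (1 - l)\<^sup>2 * (y - x)\<^sup>2) (\<nu> 2)" by (simp add: \<nu>_def)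
qed

text \<open>
  A cost that is quadratic near 0 and asymptotically \<open>\<bar>d\<bar>\<close>, with transition at scale \<open>b\<close>.
\<close>

definition hyp_cost :: "real \<Rightarrow> real \<Rightarrow> real" where
  "hyp_cost b d = sqrt (b\<^sup>2 + d\<^sup>2) - b"

lemma hyp_cost_nonneg: "0 \<le> hyp_cost b d"
  unfolding hyp_cost_def using real_sqrt_ge_abs1[of b d] by linarith

lemma hyp_cost_le: assumes "0 \<le> b" shows "hyp_cost b d \<le> \<bar>d\<bar>"
  unfolding hyp_cost_def using sqrt_sum_squares_le_sum_abs[of b d] assms by linarith

lemma hyp_cost_ge: assumes "0 \<le> b" shows "\<bar>d\<bar> - b \<le> hyp_cost b d"
  unfolding hyp_cost_def using real_sqrt_ge_abs2[of d b] by linarith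

lemma hyp_cost_add: "hyp_cost b (d + h) \<le> hyp_cost b d + \<bar>h\<bar>"
  unfolding hyp_cost_def using real_sqrt_sum_squares_triangle_ineq[of b 0 d h] by simp

text \<open>
  The triangle inequality in the plane for the vectors \<open>(b, d1)\<close> and \<open>(b, - d2)\<close>.
\<close>

lemma hyp_cost_plus: "hyp_cost (2 * b) (d1 - d2) \<le> hyp_cost b d1 + hyp_cost b d2"
  unfolding hyp_cost_def using real_sqrt_sum_squares_triangle_ineq[of b b d1 "- d2"] by simp

lemma hyp_cost_mono: assumes "\<bar>d\<bar> \<le> \<bar>d'\<bar>" shows "hyp_cost b d \<le> hyp_cost b d'"
  using assms unfolding hyp_cost_def by (simp add: abs_le_square_iff)

lemma hyp_cost_quadratic:
  assumes "0 < b" "\<bar>d\<bar> \<le> L" shows "d\<^sup>2 / (2 * (b + L)) \<le> hyp_cost b d"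
proof -
  define r where "r = sqrt (b\<^sup>2 + d\<^sup>2)"
  have r2: "r\<^sup>2 = b\<^sup>2 + d\<^sup>2" unfolding r_def by simp
  have rb: "b \<le> r" unfolding r_def using real_sqrt_ge_abs1[of b d] by linarith
  have "r \<le> b + L" unfolding r_def using sqrt_sum_squares_le_sum_abs[of b d] assms by linarith
  then have "(r - b) * (r + b) \<le> (r - b) * (2 * (b + L))" using rb assms by (intro mult_left_mono) auto
  moreover have "(r - b) * (r + b) = d\<^sup>2" using r2 by (simp add: algebra_simps power2_eq_square)
  moreover have "0 < 2 * (b + L)" using assms by simp
  ultimately show ?thesis unfolding hyp_cost_def r_def[symmetric] by (simp only: pos_divide_le_eq)
qed

abbreviation exp_density :: "real \<Rightarrow> real" where
  "exp_density x \<equiv> (if 0 < x then exp (- x) else 0)"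

lemma nn_integral_exp_half_line:
  assumes k: "0 < (k::real)"
  shows "(\<integral>\<^sup>+x. ennreal (if a < x then exp (c - k * x) else 0) \<partial>lborel) = ennreal (exp (c - k * a) / k)"
proof -
  have "(\<integral>\<^sup>+x. ennreal (if a < x then exp (c - k * x) else 0) \<partial>lborel)
      = (\<integral>\<^sup>+x. ennreal (exp (c - k * x)) * indicator {a..} x \<partial>lborel)"
    by (rule nn_integral_cong_AE) (auto intro!: eventually_mono[OF AE_lborel_singleton[of a]] simp: indicator_def)
  also have "\<dots> = ennreal (0 - (- exp (c - k * a) / k))"
  proof (rule nn_integral_FTC_atLeast)
    show "((\<lambda>x. - exp (c - k * x) / k) has_real_derivative exp (c - k * x)) (at x)" for x
      using k by (auto intro!: derivative_eq_intros)
    have "LIM x at_top. k * x :> at_top" using k by (intro filterlim_tendsto_pos_mult_at_top[OF tendsto_const]) (auto simp: filterlim_ident)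
    then have "LIM x at_top. k * x - c :> at_top"
      using filterlim_tendsto_add_at_top[OF tendsto_const[of "- c"]] by simp
    then have "((\<lambda>x. exp (- (k * x - c))) \<longlongrightarrow> 0) at_top"
      by (intro filterlim_compose[OF exp_at_bot] filterlim_compose[OF filterlim_uminus_at_bot_at_top])
    from tendsto_divide[OF tendsto_minus[OF this] tendsto_const[of k]]
    show "((\<lambda>x. - exp (c - k * x) / k) \<longlongrightarrow> 0) at_top" using k by simp
  qed auto
  finally show ?thesis by simp
qed

lemma positive_density_exp: "positive_density exp_density {0<..}"
proof (rule positive_density.intro)
  show "prob_space (density lborel (\<lambda>x. ennreal (exp_density x)))"
    using nn_integral_exp_half_line[of 1 0 0] by (intro prob_spaceI) (simp add: emeasure_density cong: if_cong)
  have "continuous_on {0<..} (\<lambda>x::real. exp (- x))" by (intro continuous_intros)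
  then show "continuous_on {0<..} exp_density" by (rule continuous_on_eq) simp
qed (auto simp: is_interval_1)

abbreviation exp_law :: "real measure" where
  "exp_law \<equiv> density lborel (\<lambda>x. ennreal (exp_density x))"

text \<open>
  An inequality of Maurey and Talagrand with asymptotically sharp linear cost. The exponential
  density is not strictly log-concave, so a linear interpolation gains nothing. Pulling the
  interpolated point back by half of \<open>ct d\<close>, where \<open>d = y - x\<close>, multiplies the density by \<open>exp (ct d / 2)\<close>
  and costs a Jacobian factor \<open>sqrt (1 - (\<tau> d)\<^sup>2)\<close>, where \<open>\<tau>\<close> is the derivative of \<open>ct\<close>. With the
  scale \<open>2 / e\<^sup>2\<close> this loss eats at most the fraction \<open>e\<close> of the gain, see the fact
  \<open>gain\<close>.
\<close>

lemma property_tau_exp: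
  assumes e: "0 < e" "e < 1"
  shows "property_tau (1 / 2) (\<lambda>x y. (1 - e)\<^sup>2 * hyp_cost (2 / e\<^sup>2) (y - x)) exp_law"
proof -
  interpret positive_density exp_density "{0<..}" by (rule positive_density_exp)
  \<comment> \<open>the scale at which the Jacobian loss becomes a small fraction of the gain\<close>
  define b where "b = 2 / e\<^sup>2"
  have b: "0 < b" using e by (simp add: b_def)
  define ct where "ct d = (1 - e) * hyp_cost b d" for d
  define \<tau> where "\<tau> d = (1 - e) * d / sqrt (b\<^sup>2 + d\<^sup>2)" for d
  have r0: "0 < sqrt (b\<^sup>2 + d\<^sup>2)" for d using b by (simp add: add_pos_nonneg)
  have ct0: "0 \<le> ct d" for d unfolding ct_def using e hyp_cost_nonneg by simp
  have ct_le: "ct d \<le> \<bar>d\<bar>" for d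
    unfolding ct_def using e hyp_cost_le[of b d] hyp_cost_nonneg[of b d] b
    by (smt (verit) mult_left_le_one_le)
  have deriv: "((\<lambda>d. d - ct d) has_real_derivative 1 - \<tau> d) (at d)" for d
  proof -
    have "b\<^sup>2 + d\<^sup>2 > 0" using b by (simp add: add_pos_nonneg)
    then show ?thesis unfolding ct_def \<tau>_def hyp_cost_def
      by (auto intro!: derivative_eq_intros simp: field_simps) (simp add: diff_divide_distrib)
  qed
  have \<tau>2: "(\<tau> d)\<^sup>2 \<le> e\<^sup>2 * ct d" "(\<tau> d)\<^sup>2 \<le> 1 - e" for d
  proof -
    define r where "r = sqrt (b\<^sup>2 + d\<^sup>2)"
    have r: "0 < r" "b \<le> r" unfolding r_def using r0 real_sqrt_ge_abs1[of b d] by auto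
    have d2: "d\<^sup>2 = (r - b) * (r + b)" unfolding r_def using b by (simp add: algebra_simps power2_eq_square)
    have t: "(\<tau> d)\<^sup>2 = (1 - e)\<^sup>2 * (d\<^sup>2 / r\<^sup>2)" unfolding \<tau>_def r_def[symmetric] by (simp add: power_mult_distrib power_divide)
    have "(r - b) * (r + b) \<le> (r - b) * (2 * r)" using r by (intro mult_left_mono) auto
    then have "d\<^sup>2 / r\<^sup>2 \<le> (r - b) * (2 * r) / r\<^sup>2" unfolding d2 by (intro divide_right_mono) auto
    also have "\<dots> = (r - b) * (2 / r)" using r by (simp add: power2_eq_square)
    also have "\<dots> \<le> (r - b) * e\<^sup>2"
    proof (rule mult_left_mono)
      have "2 / r \<le> 2 / b" using r b by (intro divide_left_mono) auto
      also have "2 / b = e\<^sup>2" by (simp add: b_def)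
      finally show "2 / r \<le> e\<^sup>2" .
    qed (use r in simp)
    finally have 1: "d\<^sup>2 / r\<^sup>2 \<le> (r - b) * e\<^sup>2" .
    have "(1 - e)\<^sup>2 \<le> (1 - e) * 1" unfolding power2_eq_square using e by (intro mult_left_mono) auto
    then have e2: "(1 - e)\<^sup>2 \<le> 1 - e" by simp
    have "(\<tau> d)\<^sup>2 \<le> (1 - e) * ((r - b) * e\<^sup>2)"
      unfolding t using e e2 1 by (intro mult_mono) auto
    then show "(\<tau> d)\<^sup>2 \<le> e\<^sup>2 * ct d" by (simp add: ct_def hyp_cost_def r_def algebra_simps)
    have "d\<^sup>2 \<le> r\<^sup>2" unfolding r_def by simp
    then have "d\<^sup>2 / r\<^sup>2 \<le> 1" using r by simp
    then have "(\<tau> d)\<^sup>2 \<le> (1 - e) * 1" unfolding t using e2 e by (intro mult_mono) auto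
    then show "(\<tau> d)\<^sup>2 \<le> 1 - e" by simp
  qed
  have gain: "exp (- (e * ct d)) \<le> 1 - (\<tau> d)\<^sup>2" for d
  proof -
    have "(\<tau> d)\<^sup>2 \<le> e * ct d * e" using \<tau>2(1) by (simp add: power2_eq_square algebra_simps)
    also have "\<dots> \<le> e * ct d * (1 - (\<tau> d)\<^sup>2)" using \<tau>2(2)[of d] e ct0[of d] by (intro mult_left_mono) auto
    finally have "1 \<le> (1 + e * ct d) * (1 - (\<tau> d)\<^sup>2)" by (simp add: algebra_simps)
    also have "\<dots> \<le> exp (e * ct d) * (1 - (\<tau> d)\<^sup>2)"
      using \<tau>2(2)[of d] e exp_ge_add_one_self[of "e * ct d"] by (intro mult_right_mono) auto
    finally show ?thesis by (simp add: exp_minus field_simps)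
  qed
  have "property_tau (1 / 2) (\<lambda>x y. (\<lambda>d. (1 - e) * ct d) (y - x)) law"
  proof (rule property_tau_law[where \<theta> = "\<lambda>d. d - ct d" and \<theta>' = "\<lambda>d. 1 - \<tau> d" and c' = "\<lambda>d. (1 - e) * ct d"])
    fix x y :: real assume x: "x \<in> {0<..}" and y: "y \<in> {0<..}"
    have "ct (y - x) \<le> y - x \<or> ct (y - x) \<le> x - y" using ct_le[of "y - x"] by (simp add: abs_if split: if_splits)
    then show stay: "x + 1 / 2 * ((y - x) - ct (y - x)) \<in> {0<..}" using x y by (auto simp: field_simps)
    fix q :: real assume q: "0 < q"
    let ?d = "y - x"
    have t1: "0 \<le> (1 + \<tau> ?d) / 2" "0 \<le> (1 - \<tau> ?d) / 2"
    proof -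
      have "\<bar>\<tau> ?d\<bar> \<le> 1" using \<tau>2(2)[of ?d] e by (intro power2_le_imp_le[of "\<bar>\<tau> ?d\<bar>"]) auto
      then show "0 \<le> (1 + \<tau> ?d) / 2" "0 \<le> (1 - \<tau> ?d) / 2" by auto
    qed
    have "exp (1 / 2 * ((1 - e) * ct ?d)) * (exp_density x powr (1 - 1 / 2) * (exp_density y * q) powr (1 / 2))
        = exp (1 / 2 * ((1 - e) * ct ?d)) * (exp (- x / 2) * (exp (- y / 2) * sqrt q))"
      using x y q by (simp add: powr_mult exp_powr_real powr_half_sqrt)
    also have "\<dots> = exp (- (x + y) / 2 + ct ?d / 2) * (exp (- (e * ct ?d) / 2) * sqrt q)"
    proof -
      have "exp (1 / 2 * ((1 - e) * ct ?d)) * exp (- x / 2) * exp (- y / 2)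
          = exp (- (x + y) / 2 + ct ?d / 2) * exp (- (e * ct ?d) / 2)"
        unfolding exp_add[symmetric] by (rule arg_cong[of _ _ exp]) (simp add: field_simps)
      then show ?thesis by (simp only: mult.assoc[symmetric])
    qed
    also have "\<dots> \<le> exp (- (x + y) / 2 + ct ?d / 2) * ((1 + \<tau> ?d) / 2 + (1 - \<tau> ?d) / 2 * q)"
    proof (rule mult_left_mono)
      have "exp (- (e * ct ?d) / 2) * sqrt q = sqrt (exp (- (e * ct ?d)) * q)"
        by (simp add: real_sqrt_mult powr_half_sqrt[symmetric] exp_powr_real)
      also have "\<dots> \<le> sqrt ((1 - (\<tau> ?d)\<^sup>2) * q)"
        using gain[of ?d] q by (intro real_sqrt_le_mono mult_right_mono) auto
      also have "\<dots> \<le> (1 + \<tau> ?d) / 2 + (1 - \<tau> ?d) / 2 * q"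
      proof (rule real_le_lsqrt)
        have "((1 + \<tau> ?d) / 2 + (1 - \<tau> ?d) / 2 * q)\<^sup>2 - (1 - (\<tau> ?d)\<^sup>2) * q
            = ((1 + \<tau> ?d) / 2 - (1 - \<tau> ?d) / 2 * q)\<^sup>2"
          by (simp add: field_simps power2_eq_square)
        then show "(1 - (\<tau> ?d)\<^sup>2) * q \<le> ((1 + \<tau> ?d) / 2 + (1 - \<tau> ?d) / 2 * q)\<^sup>2"
          by (smt (verit) zero_le_power2)
      qed (use t1 q in \<open>intro add_nonneg_nonneg mult_nonneg_nonneg, auto\<close>)
      finally show "exp (- (e * ct ?d) / 2) * sqrt q \<le> (1 + \<tau> ?d) / 2 + (1 - \<tau> ?d) / 2 * q" .
    qed simp
    also have "\<dots> = exp_density (x + 1 / 2 * (?d - ct ?d)) * (1 - 1 / 2 * (1 - \<tau> ?d) + 1 / 2 * (1 - \<tau> ?d) * q)"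
    proof -
      have "- (x + 1 / 2 * (?d - ct ?d)) = - (x + y) / 2 + ct ?d / 2" by (simp add: field_simps)
      then have "exp_density (x + 1 / 2 * (?d - ct ?d)) = exp (- (x + y) / 2 + ct ?d / 2)"
        using stay by (simp only: greaterThan_iff if_True)
      moreover have "(1 + \<tau> ?d) / 2 + (1 - \<tau> ?d) / 2 * q = 1 - 1 / 2 * (1 - \<tau> ?d) + 1 / 2 * (1 - \<tau> ?d) * q"
        by (simp add: field_simps)
      ultimately show ?thesis by (simp only:)
    qed
    finally show "exp (1 / 2 * ((1 - e) * ct ?d)) * (exp_density x powr (1 - 1 / 2) * (exp_density y * q) powr (1 / 2))
      \<le> exp_density (x + 1 / 2 * (?d - ct ?d)) * (1 - 1 / 2 * (1 - \<tau> ?d) + 1 / 2 * (1 - \<tau> ?d) * q)" .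
  next
    fix s :: real assume s: "0 < s"
    have "(1 - e) * ct (D + h) \<le> (1 - e) * ct D + s" if "\<bar>h\<bar> \<le> s" for D h
    proof -
      have "(1 - e)\<^sup>2 * hyp_cost b (D + h) \<le> (1 - e)\<^sup>2 * (hyp_cost b D + \<bar>h\<bar>)"
        by (intro mult_left_mono hyp_cost_add) simp
      moreover have "(1 - e)\<^sup>2 * \<bar>h\<bar> \<le> 1 * \<bar>h\<bar>" using e by (intro mult_right_mono) (auto simp: power_le_one)
      ultimately show ?thesis using that by (simp add: ct_def power2_eq_square algebra_simps)
    qed
    then show "\<exists>d>0. \<forall>D h. \<bar>h\<bar> \<le> d \<longrightarrow> (1 - e) * ct (D + h) \<le> (1 - e) * ct D + s"
      using s by blast
  qed (use deriv ct0 e in auto)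
  then show ?thesis by (simp add: ct_def b_def power2_eq_square mult.assoc)
qed

text \<open>
  The symmetric exponential law is the law of the difference of two independent exponential
  variables. This is how the inequality passes from the half line, where the interpolation can be
  pulled in one fixed direction, to the whole line.
\<close>

lemma laplace_difference:
  "Y 1 = 2" "distr (exp_law \<Otimes>\<^sub>M exp_law) borel (\<lambda>z. fst z - snd z) = \<nu> 1"
proof -
  interpret p: positive_density exp_density "{0<..}" by (rule positive_density_exp)
  interpret pp: pair_prob_space p.law p.law ..
  have em: "emeasure (distr (p.law \<Otimes>\<^sub>M p.law) borel (\<lambda>z. fst z - snd z)) A
      = (\<integral>\<^sup>+z. ennreal (exp (- \<bar>z\<bar>) / 2) * indicator A z \<partial>lborel)" if A[measurable]: "A \<in> sets borel" for A
  proof -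
    have dif: "(\<lambda>z. fst z - snd z :: real) \<in> measurable (p.law \<Otimes>\<^sub>M p.law) borel" by simp
    have "emeasure (distr (p.law \<Otimes>\<^sub>M p.law) borel (\<lambda>z. fst z - snd z)) A
        = (\<integral>\<^sup>+z. indicator A (fst z - snd z) \<partial>(p.law \<Otimes>\<^sub>M p.law))"
      using nn_integral_distr[OF dif, of "indicator A"] by simp
    also have "\<dots> = (\<integral>\<^sup>+y. \<integral>\<^sup>+x. indicator A (x - y) \<partial>p.law \<partial>p.law)"
      by (subst pp.nn_integral_snd[symmetric]) auto
    also have "\<dots> = (\<integral>\<^sup>+y. ennreal (exp_density y) * (\<integral>\<^sup>+x. ennreal (exp_density x) * indicator A (x - y) \<partial>lborel) \<partial>lborel)"
      by (simp add: nn_integral_density)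
    also have "\<dots> = (\<integral>\<^sup>+y. ennreal (exp_density y) * (\<integral>\<^sup>+z. ennreal (exp_density (z + y)) * indicator A z \<partial>lborel) \<partial>lborel)"
    proof (rule nn_integral_cong)
      fix y :: real
      have "(\<integral>\<^sup>+x. ennreal (exp_density x) * indicator A (x - y) \<partial>lborel)
          = (\<integral>\<^sup>+z. ennreal (exp_density (z + y)) * indicator A z \<partial>lborel)"
        by (subst nn_integral_real_affine[where c = 1 and t = y]) (auto intro!: nn_integral_cong simp: add.commute)
      then show "ennreal (exp_density y) * (\<integral>\<^sup>+x. ennreal (exp_density x) * indicator A (x - y) \<partial>lborel)
          = ennreal (exp_density y) * (\<integral>\<^sup>+z. ennreal (exp_density (z + y)) * indicator A z \<partial>lborel)"
        by (simp only:)
    qed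
    also have "\<dots> = (\<integral>\<^sup>+y. \<integral>\<^sup>+z. ennreal (exp_density y * exp_density (z + y)) * indicator A z \<partial>lborel \<partial>lborel)"
      by (subst nn_integral_cmult[symmetric]) (auto simp: ennreal_mult' mult.assoc intro!: nn_integral_cong)
    also have "\<dots> = (\<integral>\<^sup>+z. \<integral>\<^sup>+y. ennreal (exp_density y * exp_density (z + y)) * indicator A z \<partial>lborel \<partial>lborel)"
      by (subst lborel_pair.Fubini') auto
    also have "\<dots> = (\<integral>\<^sup>+z. ennreal (exp (- \<bar>z\<bar>) / 2) * indicator A z \<partial>lborel)"
    proof (rule nn_integral_cong)
      fix z :: real
      have "(\<integral>\<^sup>+y. ennreal (exp_density y * exp_density (z + y)) \<partial>lborel)
          = (\<integral>\<^sup>+y. ennreal (if max 0 (- z) < y then exp (- z - 2 * y) else 0) \<partial>lborel)"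
        by (intro nn_integral_cong arg_cong[where f = ennreal]) (auto simp: mult_exp_exp)
      also have "\<dots> = ennreal (exp (- z - 2 * max 0 (- z)) / 2)" by (rule nn_integral_exp_half_line) simp
      also have "- z - 2 * max 0 (- z) = - \<bar>z\<bar>" by auto
      finally show "(\<integral>\<^sup>+y. ennreal (exp_density y * exp_density (z + y)) * indicator A z \<partial>lborel)
          = ennreal (exp (- \<bar>z\<bar>) / 2) * indicator A z"
        by (subst nn_integral_multc) auto
    qed
    finally show ?thesis .
  qed
  have ab: "\<bar>x\<bar> powr 1 = \<bar>x\<bar>" for x :: real by simp
  have int1: "integrable lborel (\<lambda>x::real. exp (- \<bar>x\<bar>))" using integrable_exp_powr[of 1] by simp
  have "prob_space (distr (p.law \<Otimes>\<^sub>M p.law) borel (\<lambda>z. fst z - snd z))"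
    by (intro pp.P.prob_space_distr) simp
  from prob_space.emeasure_space_1[OF this]
  have "1 = emeasure (distr (p.law \<Otimes>\<^sub>M p.law) borel (\<lambda>z. fst z - snd z)) UNIV" by simp
  also have "\<dots> = (\<integral>\<^sup>+z. ennreal (exp (- \<bar>z::real\<bar>) / 2) \<partial>lborel)"
    using em[of UNIV] by simp
  also have "\<dots> = ennreal (\<integral>z. exp (- \<bar>z::real\<bar>) / 2 \<partial>lborel)"
    using int1 by (intro nn_integral_eq_integral) auto
  also have "(\<integral>z. exp (- \<bar>z::real\<bar>) / 2 \<partial>lborel) = Y 1 / 2" by (simp add: Y_def)
  finally have "ennreal (Y 1 / 2) = 1" by (rule sym)
  then have "Y 1 / 2 = 1" by (simp only: ennreal_eq_1)
  then show Y1: "Y 1 = 2" by simp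
  show "distr (exp_law \<Otimes>\<^sub>M exp_law) borel (\<lambda>z. fst z - snd z) = \<nu> 1"
  proof (rule measure_eqI)
    fix A assume "A \<in> sets (distr (exp_law \<Otimes>\<^sub>M exp_law) borel (\<lambda>z. fst z - snd z))"
    then have A: "A \<in> sets borel" by simp
    show "emeasure (distr (exp_law \<Otimes>\<^sub>M exp_law) borel (\<lambda>z. fst z - snd z)) A = emeasure (\<nu> 1) A"
      unfolding em[OF A] \<nu>_def Y1 using A by (subst emeasure_density) auto
  qed (simp add: \<nu>_def)
qed

lemma property_tau_laplace:
  assumes e: "0 < e" "e < 1"
  obtains b where "0 < b" "property_tau (1 / 2) (\<lambda>x y. (1 - e) * hyp_cost b (y - x)) (\<nu> 1)"
proof -
  \<comment> \<open>a square of \<open>1 - e / 2\<close> is still at least \<open>1 - e\<close>\<close>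
  define s where "s = e / 2"
  have s: "0 < s" "s < 1" using e by (auto simp: s_def)
  define b where "b = 2 / s\<^sup>2"
  have b: "0 < b" using s by (simp add: b_def)
  interpret p: positive_density exp_density "{0<..}" by (rule positive_density_exp)
  have P: "prob_space exp_law" by (rule p.prob_space_axioms)
  note tau = property_tau_exp[OF s, folded b_def]
  have "property_tau (1 / 2) (\<lambda>x y. (1 - e) * hyp_cost (2 * b) (y - x))
      (distr (exp_law \<Otimes>\<^sub>M exp_law) borel (\<lambda>z. fst z - snd z))"
  proof (rule property_tau_distr[OF property_tau_pair[OF P P tau tau]])
    fix x y :: "real \<times> real"
    have "1 - e \<le> (1 - s)\<^sup>2" by (simp add: s_def power2_eq_square algebra_simps)
    then have "(1 - e) * hyp_cost (2 * b) ((fst y - snd y) - (fst x - snd x))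
        \<le> (1 - s)\<^sup>2 * (hyp_cost b (fst y - fst x) + hyp_cost b (snd y - snd x))"
      using e hyp_cost_plus[of b "fst y - fst x" "snd y - snd x"] hyp_cost_nonneg[of "2 * b"]
      by (intro mult_mono) (auto simp: algebra_simps)
    then show "(1 - e) * hyp_cost (2 * b) ((fst y - snd y) - (fst x - snd x))
        \<le> (1 - s)\<^sup>2 * hyp_cost b (fst y - fst x) + (1 - s)\<^sup>2 * hyp_cost b (snd y - snd x)"
      by (simp add: algebra_simps)
  qed auto
  then show ?thesis unfolding laplace_difference(2) using b by (intro that[of "2 * b"]) auto
qed

section \<open>Laplace coordinates\<close>

text \<open>
  Rescaling by \<open>x\<close> turns the tail beyond \<open>x\<close> into a tail beyond 1, and
  \<open>(x powr \<alpha> - 1) * (\<tau> powr \<alpha> - 1) \<ge> 0\<close> decouples the two variables.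
\<close>

lemma \<nu>_tail_le:
  assumes \<alpha>: "0 < \<alpha>" and x: "1 \<le> x"
  shows "measure (\<nu> \<alpha>) {x<..} \<le> exp 1 * x * exp (- (x powr \<alpha>))"
proof -
  note Y = Y_pos[OF \<alpha>]
  interpret prob_space "\<nu> \<alpha>" by (rule prob_space_\<nu>[OF \<alpha>])
  have "emeasure (\<nu> \<alpha>) {x<..} = (\<integral>\<^sup>+t. ennreal (\<nu>_density \<alpha> t) * indicator {x<..} t \<partial>lborel)"
    unfolding \<nu>_def by (rule emeasure_density) auto
  also have "\<dots> = ennreal x * (\<integral>\<^sup>+\<tau>. ennreal (\<nu>_density \<alpha> (x * \<tau>)) * indicator {x<..} (x * \<tau>) \<partial>lborel)"
    using x by (subst nn_integral_real_affine[where c = x and t = 0]) auto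
  also have "\<dots> \<le> ennreal x * (\<integral>\<^sup>+\<tau>. ennreal (exp (1 - x powr \<alpha>)) * ennreal (\<nu>_density \<alpha> \<tau>) \<partial>lborel)"
  proof (intro mult_left_mono nn_integral_mono)
    fix \<tau> :: real
    show "ennreal (\<nu>_density \<alpha> (x * \<tau>)) * indicator {x<..} (x * \<tau>)
        \<le> ennreal (exp (1 - x powr \<alpha>)) * ennreal (\<nu>_density \<alpha> \<tau>)"
    proof (cases "1 < \<tau>")
      case True
      have "1 \<le> x powr \<alpha>" "1 \<le> \<tau> powr \<alpha>" using x True \<alpha> by (auto intro: ge_one_powr_ge_zero)
      then have "0 \<le> (x powr \<alpha> - 1) * (\<tau> powr \<alpha> - 1)" by simp
      then have "- ((x * \<tau>) powr \<alpha>) \<le> 1 - x powr \<alpha> + - (\<tau> powr \<alpha>)"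
        using x True by (simp add: powr_mult algebra_simps)
      then have "exp (- (\<bar>x * \<tau>\<bar> powr \<alpha>)) \<le> exp (1 - x powr \<alpha>) * exp (- (\<bar>\<tau>\<bar> powr \<alpha>))"
        using x True by (simp add: abs_mult mult_exp_exp)
      then have "\<nu>_density \<alpha> (x * \<tau>) \<le> exp (1 - x powr \<alpha>) * \<nu>_density \<alpha> \<tau>"
        using Y by (simp add: divide_right_mono)
      then show ?thesis by (auto simp: indicator_def ennreal_mult'[symmetric] intro!: ennreal_leI)
    next
      case False
      then have "x * \<tau> \<le> x" using x by (cases "0 \<le> \<tau>") (auto simp: mult_le_cancel_left1 mult_le_cancel_left2)
      then show ?thesis by (simp add: indicator_def)
    qed
  qed simp
  also have "\<dots> = ennreal x * (ennreal (exp (1 - x powr \<alpha>)) * emeasure (\<nu> \<alpha>) (space (\<nu> \<alpha>)))"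
    by (subst nn_integral_cmult) (auto simp: \<nu>_def emeasure_density)
  also have "\<dots> = ennreal (exp 1 * x * exp (- (x powr \<alpha>)))"
    using x by (simp add: emeasure_space_1 ennreal_mult'[symmetric] exp_diff exp_minus divide_inverse mult.commute mult.left_commute)
  finally show ?thesis using x by (simp add: emeasure_eq_measure)
qed

lemma \<nu>_tail_ge:
  assumes \<alpha>: "0 < \<alpha>" and x: "0 \<le> x"
  shows "exp (- ((x + 1) powr \<alpha>)) / Y \<alpha> \<le> measure (\<nu> \<alpha>) {x<..}"
proof -
  note Y = Y_pos[OF \<alpha>]
  interpret prob_space "\<nu> \<alpha>" by (rule prob_space_\<nu>[OF \<alpha>])
  have "ennreal (exp (- ((x + 1) powr \<alpha>)) / Y \<alpha>)
      = (\<integral>\<^sup>+t. ennreal (exp (- ((x + 1) powr \<alpha>)) / Y \<alpha>) * indicator {x<..x + 1} t \<partial>lborel)"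
    by (subst nn_integral_cmult_indicator) auto
  also have "\<dots> \<le> (\<integral>\<^sup>+t. ennreal (\<nu>_density \<alpha> t) * indicator {x<..} t \<partial>lborel)"
    using x \<alpha> Y by (intro nn_integral_mono) (auto simp: indicator_def intro!: divide_right_mono powr_mono2)
  also have "\<dots> = emeasure (\<nu> \<alpha>) {x<..}" unfolding \<nu>_def by (rule emeasure_density[symmetric]) auto
  finally show ?thesis by (simp add: emeasure_eq_measure)
qed

lemma \<nu>_symmetric: "distr (\<nu> \<alpha>) borel uminus = \<nu> \<alpha>"
proof (rule measure_eqI)
  fix A assume "A \<in> sets (distr (\<nu> \<alpha>) borel uminus)"
  then have A[measurable]: "A \<in> sets borel" by simp
  have m: "uminus \<in> measurable (\<nu> \<alpha>) borel" by (simp add: \<nu>_def)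
  have "emeasure (distr (\<nu> \<alpha>) borel uminus) A = (\<integral>\<^sup>+x. indicator A (- x) \<partial>\<nu> \<alpha>)"
    using nn_integral_distr[OF m, of "indicator A"] by simp
  also have "\<dots> = (\<integral>\<^sup>+x. ennreal (\<nu>_density \<alpha> x) * indicator A (- x) \<partial>lborel)"
    unfolding \<nu>_def by (subst nn_integral_density) auto
  also have "\<dots> = (\<integral>\<^sup>+x. ennreal (\<nu>_density \<alpha> x) * indicator A x \<partial>lborel)"
    by (subst nn_integral_real_affine[where c = "-1" and t = 0]) auto
  also have "\<dots> = emeasure (\<nu> \<alpha>) A" unfolding \<nu>_def by (rule emeasure_density[symmetric]) auto
  finally show "emeasure (distr (\<nu> \<alpha>) borel uminus) A = emeasure (\<nu> \<alpha>) A" .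
qed (simp add: \<nu>_def)

lemma laplace_tail:
  assumes "0 \<le> z" shows "measure (\<nu> 1) {z<..} = exp (- z) / 2"
proof -
  have e: "exp (- ln 2 - t) = exp (- t) / 2" for t :: real
    using exp_add[of "- ln 2" "- t"] by (simp add: exp_minus)
  have "emeasure (\<nu> 1) {z<..} = (\<integral>\<^sup>+t. ennreal (\<nu>_density 1 t) * indicator {z<..} t \<partial>lborel)"
    unfolding \<nu>_def by (rule emeasure_density) auto
  also have "\<dots> = (\<integral>\<^sup>+t. ennreal (if z < t then exp (- ln 2 - 1 * t) else 0) \<partial>lborel)"
    using assms by (intro nn_integral_cong) (auto simp: indicator_def laplace_difference(1) e)
  also have "\<dots> = ennreal (exp (- z) / 2)"
    using e[of z] by (subst nn_integral_exp_half_line) auto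
  finally show ?thesis by (simp add: measure_def)
qed

text \<open>
  The coordinate \<open>H\<close> is the monotone rearrangement of \<open>\<nu> \<alpha>\<close> into the Laplace measure \<open>\<nu> 1\<close>; for
  positive \<open>x\<close> it is minus the logarithm of twice the tail of \<open>\<nu> \<alpha>\<close>.
\<close>

locale laplace_coordinate =
  fixes \<alpha> :: real and H :: "real \<Rightarrow> real"
  assumes \<alpha>: "0 < \<alpha>"
    and cdf_H: "cdf (\<nu> 1) (H x) = cdf (\<nu> \<alpha>) x"
    and deriv_H: "(H has_real_derivative \<nu>_density \<alpha> x / \<nu>_density 1 (H x)) (at x)"
begin

sublocale A: positive_density "\<nu>_density \<alpha>" UNIV rewrites "density lborel (\<lambda>x. ennreal (\<nu>_density \<alpha> x)) \<equiv> \<nu> \<alpha>"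
  using positive_density_\<nu>[OF \<alpha>] by (simp_all add: \<nu>_def)
sublocale L: positive_density "\<nu>_density 1" UNIV rewrites "density lborel (\<lambda>x. ennreal (\<nu>_density 1 x)) \<equiv> \<nu> 1"
  using positive_density_\<nu>[of 1] by (simp_all add: \<nu>_def)

lemma cdf_le_iff:
  "cdf (\<nu> \<alpha>) x \<le> cdf (\<nu> \<alpha>) y \<longleftrightarrow> x \<le> y" "cdf (\<nu> 1) x \<le> cdf (\<nu> 1) y \<longleftrightarrow> x \<le> y"
  using A.cdf_strict[of x y] A.cdf_strict[of y x] A.cdf_nondecreasing[of x y]
    L.cdf_strict[of x y] L.cdf_strict[of y x] L.cdf_nondecreasing[of x y]
  by (auto simp: not_le[symmetric])

lemma H_le_iff: "H x \<le> H y \<longleftrightarrow> x \<le> y"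
  by (metis cdf_H cdf_le_iff)

lemma cdf_uminus: assumes a: "0 < a" shows "cdf (\<nu> a) (- x) = measure (\<nu> a) {x<..}"
proof -
  interpret A': positive_density "\<nu>_density a" UNIV rewrites "density lborel (\<lambda>x. ennreal (\<nu>_density a x)) \<equiv> \<nu> a"
    using positive_density_\<nu>[OF a] by (simp_all add: \<nu>_def)
  have m: "uminus \<in> measurable (\<nu> a) borel" by (simp add: \<nu>_def)
  have "cdf (\<nu> a) (- x) = measure (distr (\<nu> a) borel uminus) {..- x}" by (simp add: \<nu>_symmetric cdf_def)
  also have "\<dots> = measure (\<nu> a) {x..}"
  proof -
    have "uminus -` {..- x} \<inter> space (\<nu> a) = {x..}" by (auto simp: \<nu>_def)
    then show ?thesis by (subst measure_distr[OF m]) auto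
  qed
  also have "{x..} = {x} \<union> {x<..}" by auto
  also have "measure (\<nu> a) ({x} \<union> {x<..}) = measure (\<nu> a) {x} + measure (\<nu> a) {x<..}"
    by (intro A'.finite_measure_Union) auto
  also have "measure (\<nu> a) {x} = 0" using A'.cdf_isCont[of x] by (simp add: A'.isCont_cdf)
  finally show ?thesis by simp
qed

lemma measure_greaterThan: assumes a: "0 < a" shows "measure (\<nu> a) {x<..} = 1 - cdf (\<nu> a) x"
proof -
  interpret A': prob_space "\<nu> a" using a by (rule prob_space_\<nu>)
  have "space (\<nu> a) - {..x} = {x<..}" by (auto simp: \<nu>_def)
  moreover have "{..x} \<in> sets (\<nu> a)" by (simp add: \<nu>_def)
  ultimately show ?thesis using A'.prob_compl[of "{..x}"] by (simp add: cdf_def)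
qed

lemma H_odd: "H (- x) = - H x"
proof -
  have "cdf (\<nu> 1) (H (- x)) = 1 - cdf (\<nu> \<alpha>) x"
    using cdf_uminus[OF \<alpha>, of x] measure_greaterThan[OF \<alpha>] by (simp add: cdf_H)
  also have "\<dots> = cdf (\<nu> 1) (- H x)"
    using cdf_uminus[of 1 "H x"] measure_greaterThan[of 1] by (simp add: cdf_H)
  finally show ?thesis using cdf_le_iff(2) by (metis order.antisym order.refl)
qed

lemma H_nonneg: "0 \<le> x \<Longrightarrow> 0 \<le> H x"
  using H_le_iff[of 0 x] H_odd[of 0] by simp

lemma tail_H: "0 \<le> x \<Longrightarrow> measure (\<nu> \<alpha>) {x<..} = exp (- H x) / 2"
  using laplace_tail[OF H_nonneg] measure_greaterThan[OF \<alpha>] measure_greaterThan[of 1] by (simp add: cdf_H)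

lemma H_lower: assumes x: "1 \<le> x" shows "x powr \<alpha> - ln x - 2 \<le> H x"
proof -
  have "exp (- H x) \<le> 2 * (exp 1 * x * exp (- (x powr \<alpha>)))"
    using \<nu>_tail_le[OF \<alpha> x] tail_H[of x] x by simp
  also have "\<dots> = exp (ln 2 + 1 + ln x - x powr \<alpha>)" using x by (simp add: exp_add exp_diff exp_minus field_simps)
  finally have "- H x \<le> ln 2 + 1 + ln x - x powr \<alpha>" by simp
  then show ?thesis using ln_2_less_1 by linarith
qed

lemma H_upper: assumes x: "0 \<le> x" shows "H x \<le> (x + 1) powr \<alpha> + \<bar>ln (Y \<alpha>)\<bar>"
proof -
  note Y = Y_pos[OF \<alpha>]
  have "exp (- ((x + 1) powr \<alpha>) - ln (Y \<alpha>)) = exp (- ((x + 1) powr \<alpha>)) / Y \<alpha>" using Y by (simp add: exp_diff)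
  also have "\<dots> \<le> exp (- H x) / 2" using \<nu>_tail_ge[OF \<alpha> x] tail_H[OF x] by simp
  also have "\<dots> \<le> exp (- H x)" by simp
  finally show ?thesis by simp
qed

text \<open>
  The derivative of \<open>H\<close> is the hazard rate of \<open>\<nu> \<alpha>\<close>, the density divided by the tail; the tail
  estimate bounds it below by a multiple of \<open>1 / R\<close> up to distance \<open>R\<close>.
\<close>

lemma H_expanding:
  assumes R: "1 \<le> R" and xy: "\<bar>x\<bar> \<le> R" "\<bar>y\<bar> \<le> R"
  shows "\<bar>y - x\<bar> / (exp 1 * Y \<alpha> * R) \<le> \<bar>H y - H x\<bar>"
proof -
  note Y = Y_pos[OF \<alpha>]
  define m where "m = 1 / (exp 1 * Y \<alpha> * R)"
  have d0: "m \<le> \<nu>_density \<alpha> z / \<nu>_density 1 (H z)" if z: "0 \<le> z" "z \<le> R" for z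
  proof -
    have q: "\<nu>_density 1 (H z) = measure (\<nu> \<alpha>) {z<..}"
      using tail_H[OF z(1)] H_nonneg[OF z(1)] by (simp add: laplace_difference(1))
    have "measure (\<nu> \<alpha>) {z<..} \<le> exp 1 * R * exp (- (z powr \<alpha>))"
    proof (cases "1 \<le> z")
      case True
      have "exp 1 * z * exp (- (z powr \<alpha>)) \<le> exp 1 * R * exp (- (z powr \<alpha>))"
        using z True by (intro mult_right_mono mult_left_mono) auto
      with \<nu>_tail_le[OF \<alpha> True] show ?thesis by linarith
    next
      case False
      have "1 * 1 \<le> R * exp (1 - z powr \<alpha>)"
        using R False z \<alpha> by (intro mult_mono) (auto simp: powr_le1)
      then have "1 \<le> exp 1 * R * exp (- (z powr \<alpha>))" by (simp add: exp_diff exp_minus field_simps)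
      then show ?thesis using A.prob_le_1[of "{z<..}"] by linarith
    qed
    then have "\<nu>_density 1 (H z) \<le> exp 1 * R * exp (- (z powr \<alpha>))" unfolding q .
    moreover have "0 < \<nu>_density 1 (H z)" by (simp add: laplace_difference(1))
    ultimately have "\<nu>_density \<alpha> z / (exp 1 * R * exp (- (z powr \<alpha>))) \<le> \<nu>_density \<alpha> z / \<nu>_density 1 (H z)"
      using Y R by (intro divide_left_mono) (simp_all add: laplace_difference(1))
    moreover have "\<nu>_density \<alpha> z / (exp 1 * R * exp (- (z powr \<alpha>))) = m"
      unfolding m_def using Y R z by simp
    ultimately show ?thesis by simp
  qed
  have d: "m \<le> \<nu>_density \<alpha> z / \<nu>_density 1 (H z)" if z: "\<bar>z\<bar> \<le> R" for z
    using d0[of z] d0[of "- z"] z by (cases "0 \<le> z") (auto simp: H_odd)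
  have mono: "m * (y - x) \<le> H y - H x" if "x \<le> y" "\<bar>x\<bar> \<le> R" "\<bar>y\<bar> \<le> R" for x y
  proof -
    have "H x - m * x \<le> H y - m * y"
    proof (rule DERIV_nonneg_imp_nondecreasing[where f = "\<lambda>z. H z - m * z"])
      fix z assume "x \<le> z" "z \<le> y"
      then have "\<bar>z\<bar> \<le> R" using that by auto
      have "((\<lambda>z. H z - m * z) has_real_derivative \<nu>_density \<alpha> z / \<nu>_density 1 (H z) - m) (at z)"
        using DERIV_diff[OF deriv_H[of z] DERIV_cmult[OF DERIV_ident, of m]] by simp
      then show "\<exists>d. ((\<lambda>z. H z - m * z) has_real_derivative d) (at z) \<and> 0 \<le> d"
        using d[OF \<open>\<bar>z\<bar> \<le> R\<close>] by (intro exI conjI) auto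
    qed fact
    then show ?thesis by (simp add: algebra_simps)
  qed
  have "m * \<bar>y - x\<bar> \<le> \<bar>H y - H x\<bar>"
    using mono[of x y] mono[of y x] xy by (cases "x \<le> y") (auto simp: abs_if algebra_simps)
  then show ?thesis by (simp add: m_def)
qed

lemma H_cont: "isCont H x" using deriv_H by (rule DERIV_isCont)

text \<open>
  The Laplace cost, read through \<open>H\<close>, controls displacements that start within distance \<open>R\<close> of
  the origin. A displacement of size \<open>s \<ge> R\<^sup>2\<close> starts within \<open>sqrt s\<close> of the origin, which is
  negligible against \<open>s\<close>, so it costs asymptotically \<open>s powr \<alpha>\<close> because \<open>H s\<close> is asymptotic to
  \<open>s powr \<alpha>\<close>. Shorter displacements have a quadratic cost whose constant deteriorates only
  polynomially in \<open>R\<close>.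
\<close>

lemma truncated_cost:
  assumes e: "0 < e" "e < 1" and b: "0 < b"
  shows "\<exists>R0 K. 1 \<le> R0 \<and> 0 < K \<and> (\<forall>R\<ge>R0. \<forall>x y. \<bar>x\<bar> \<le> R \<longrightarrow>
    (R\<^sup>2 \<le> \<bar>y - x\<bar> \<longrightarrow> (1 - e) * \<bar>y - x\<bar> powr \<alpha> \<le> (1 - e / 2) * hyp_cost b (H y - H x)) \<and>
    (\<bar>y - x\<bar> < R\<^sup>2 \<longrightarrow> (y - x)\<^sup>2 / (K * R ^ 4) \<le> (1 - e / 2) * hyp_cost b (H y - H x)))"
proof -
  note Y = Y_pos[OF \<alpha>]
  have "eventually (\<lambda>s. (1 - e) * s powr \<alpha> \<le> (1 - e / 2) *
      ((s - sqrt s) powr \<alpha> - ln (s - sqrt s) - 2 - (sqrt s + 1) powr \<alpha> - \<bar>ln (Y \<alpha>)\<bar> - b)) at_top"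
    using \<alpha> e by real_asymp
  then obtain s0 where s0: "\<And>s. s0 \<le> s \<Longrightarrow> (1 - e) * s powr \<alpha> \<le> (1 - e / 2) *
      ((s - sqrt s) powr \<alpha> - ln (s - sqrt s) - 2 - (sqrt s + 1) powr \<alpha> - \<bar>ln (Y \<alpha>)\<bar> - b)"
    by (auto simp: eventually_at_top_linorder)
  \<comment> \<open>beyond this value \<open>R\<^sup>2\<close> is at least \<open>2 * R\<close> and at least \<open>s0\<close>\<close>
  define R0 where "R0 = max 2 s0"
  define a where "a = 2 * exp 1 * Y \<alpha>"
  have a: "0 < a" using Y by (simp add: a_def)
  \<comment> \<open>the factors come from the local expansion \<open>1 / (a * R\<^sup>2)\<close> of \<open>H\<close> and from the quadratic part of the cost\<close>
  define K where "K = a\<^sup>2 * (2 * (b + 1 / a)) / (1 - e / 2)"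
  have K: "0 < K" using a b e unfolding K_def by (intro divide_pos_pos mult_pos_pos) (auto intro: add_pos_pos)
  have large: "(1 - e) * \<bar>y - x\<bar> powr \<alpha> \<le> (1 - e / 2) * hyp_cost b (H y - H x)"
    if R: "R0 \<le> R" and x: "\<bar>x\<bar> \<le> R" and xy: "R\<^sup>2 \<le> \<bar>y - x\<bar>" for R x y
  proof -
    define s where "s = \<bar>y - x\<bar>"
    have R2: "2 \<le> R" using R by (simp add: R0_def)
    have "2 * R \<le> R\<^sup>2" unfolding power2_eq_square using R2 by (intro mult_right_mono) auto
    then have s: "4 \<le> s" "s0 \<le> s" "R \<le> sqrt s"
      using R R2 xy by (auto simp: R0_def s_def intro: real_le_rsqrt)
    have ss: "sqrt s * 2 \<le> s"
    proof -
      have "2 \<le> sqrt s" using s(1) by (intro real_le_rsqrt) auto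
      then have "sqrt s * 2 \<le> sqrt s * sqrt s" using s(1) by (intro mult_left_mono) auto
      moreover have "sqrt s * sqrt s = s" using s(1) by (intro real_sqrt_mult_self[THEN trans]) auto
      ultimately show ?thesis by linarith
    qed
    have s1: "1 \<le> s - sqrt s" using ss s(1) by linarith
    have "H (s - sqrt s) - H (sqrt s) \<le> \<bar>H y - H x\<bar>"
    proof (cases "x \<le> y")
      case True
      then have "s - sqrt s \<le> y" "x \<le> sqrt s" using x s(3) by (auto simp: s_def)
      then have "H (s - sqrt s) \<le> H y" "H x \<le> H (sqrt s)" by (simp_all add: H_le_iff)
      then show ?thesis by linarith
    next
      case False
      then have "s - sqrt s \<le> - y" "- x \<le> sqrt s" using x s(3) by (auto simp: s_def)
      then have "H (s - sqrt s) \<le> H (- y)" "H (- x) \<le> H (sqrt s)" by (simp_all only: H_le_iff)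
      then show ?thesis unfolding H_odd by linarith
    qed
    moreover have "(s - sqrt s) powr \<alpha> - ln (s - sqrt s) - 2 \<le> H (s - sqrt s)" by (rule H_lower[OF s1])
    moreover have "H (sqrt s) \<le> (sqrt s + 1) powr \<alpha> + \<bar>ln (Y \<alpha>)\<bar>" using s(1) by (intro H_upper) simp
    moreover have "\<bar>H y - H x\<bar> - b \<le> hyp_cost b (H y - H x)" using b by (intro hyp_cost_ge) simp
    ultimately have "(s - sqrt s) powr \<alpha> - ln (s - sqrt s) - 2 - (sqrt s + 1) powr \<alpha> - \<bar>ln (Y \<alpha>)\<bar> - b
        \<le> hyp_cost b (H y - H x)" by linarith
    then have "(1 - e / 2) * ((s - sqrt s) powr \<alpha> - ln (s - sqrt s) - 2 - (sqrt s + 1) powr \<alpha> - \<bar>ln (Y \<alpha>)\<bar> - b)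
        \<le> (1 - e / 2) * hyp_cost b (H y - H x)" using e by (intro mult_left_mono) auto
    with s0[OF s(2)] show ?thesis unfolding s_def by linarith
  qed
  have small: "(y - x)\<^sup>2 / (K * R ^ 4) \<le> (1 - e / 2) * hyp_cost b (H y - H x)"
    if R: "R0 \<le> R" and x: "\<bar>x\<bar> \<le> R" and xy: "\<bar>y - x\<bar> < R\<^sup>2" for R x y
  proof -
    have R2: "2 \<le> R" using R by (simp add: R0_def)
    have RR: "2 * R \<le> R\<^sup>2" unfolding power2_eq_square using R2 by (intro mult_right_mono) auto
    define d where "d = \<bar>y - x\<bar> / (a * R\<^sup>2)"
    have d1: "\<bar>d\<bar> \<le> 1 / a"
    proof -
      have "d \<le> R\<^sup>2 / (a * R\<^sup>2)" unfolding d_def using xy a by (intro divide_right_mono) auto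
      also have "\<dots> = 1 / a" using R2 by simp
      finally show ?thesis using a by (simp add: d_def)
    qed
    have "\<bar>y - x\<bar> / (exp 1 * Y \<alpha> * (2 * R\<^sup>2)) \<le> \<bar>H y - H x\<bar>"
      using R2 RR x xy by (intro H_expanding) auto
    then have dH: "\<bar>d\<bar> \<le> \<bar>H y - H x\<bar>" using Y by (simp add: d_def a_def mult_ac abs_mult)
    have "(y - x)\<^sup>2 / (K * R ^ 4) = (1 - e / 2) * (d\<^sup>2 / (2 * (b + 1 / a)))"
    proof -
      have "b + 1 / a \<noteq> 0" "1 - e / 2 \<noteq> 0" using a b e by (auto simp: add_pos_pos less_imp_neq[symmetric])
      moreover have "d\<^sup>2 = (y - x)\<^sup>2 / (a\<^sup>2 * R ^ 4)"
        by (simp add: d_def power_divide power_mult_distrib power_mult[symmetric])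
      ultimately show ?thesis unfolding K_def by (simp add: mult.commute mult.left_commute)
    qed
    also have "\<dots> \<le> (1 - e / 2) * hyp_cost b d"
      using e by (intro mult_left_mono hyp_cost_quadratic[OF b d1]) auto
    also have "\<dots> \<le> (1 - e / 2) * hyp_cost b (H y - H x)"
      using e by (intro mult_left_mono hyp_cost_mono[OF dH]) auto
    finally show ?thesis .
  qed
  show ?thesis
    using large small K by (intro exI[of _ R0] exI[of _ K]) (auto simp: R0_def)
qed

end

text \<open>
  The two monotone transports between \<open>\<nu> \<alpha>\<close> and \<open>\<nu> 1\<close> are inverse to each other.
\<close>

lemma laplace_coordinate_exists:
  assumes \<alpha>: "0 < \<alpha>"
  obtains H \<psi> where "laplace_coordinate \<alpha> H" "\<And>z. H (\<psi> z) = z" "\<psi> \<in> borel_measurable borel"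
    "distr (\<nu> 1) borel \<psi> = \<nu> \<alpha>"
proof -
  note pa = positive_density_\<nu>[OF \<alpha>]
  have p1: "positive_density (\<nu>_density 1) UNIV" by (rule positive_density_\<nu>) simp
  obtain H where H: "\<And>x. cdf (\<nu> 1) (H x) = cdf (\<nu> \<alpha>) x"
      "\<And>x. (H has_real_derivative \<nu>_density \<alpha> x / \<nu>_density 1 (H x)) (at x)"
    by (rule monotone_transport[OF pa p1]) (auto simp: \<nu>_def intro: that)
  obtain \<psi> where \<psi>: "\<And>x. cdf (\<nu> \<alpha>) (\<psi> x) = cdf (\<nu> 1) x"
      "\<And>x. (\<psi> has_real_derivative \<nu>_density 1 x / \<nu>_density \<alpha> (\<psi> x)) (at x)"
    by (rule monotone_transport[OF p1 pa]) (auto simp: \<nu>_def intro: that)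
  interpret laplace_coordinate \<alpha> H by standard (rule \<alpha> H)+
  have "continuous_on UNIV \<psi>" using \<psi>(2) by (meson DERIV_isCont continuous_at_imp_continuous_on)
  then have m: "\<psi> \<in> borel_measurable borel" by (rule borel_measurable_continuous_onI)
  have inv: "H (\<psi> z) = z" for z
    using cdf_le_iff(2)[of "H (\<psi> z)" z] cdf_le_iff(2)[of z "H (\<psi> z)"] by (simp add: cdf_H \<psi>(1))
  have "distr (\<nu> 1) borel \<psi> = \<nu> \<alpha>"
  proof (rule cdf_unique)
    show "real_distribution (distr (\<nu> 1) borel \<psi>)"
      using m by (intro L.real_distribution_distr) (simp add: \<nu>_def)
    show "real_distribution (\<nu> \<alpha>)" by (rule A.real_distribution_axioms)
    show "cdf (distr (\<nu> 1) borel \<psi>) = cdf (\<nu> \<alpha>)"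
    proof
      fix x
      have "\<psi> -` {..x} \<inter> space (\<nu> 1) = {..H x}"
        using inv H_le_iff by (auto simp: \<nu>_def) (metis H_le_iff inv)+
      then have "cdf (distr (\<nu> 1) borel \<psi>) x = cdf (\<nu> 1) (H x)"
        unfolding cdf_def using m by (subst measure_distr) (auto simp: \<nu>_def)
      then show "cdf (distr (\<nu> 1) borel \<psi>) x = cdf (\<nu> \<alpha>) x" by (simp add: cdf_H)
    qed
  qed
  with laplace_coordinate_axioms inv m show ?thesis by (rule that)
qed

section \<open>Concentration of product measures\<close>

lemma space_Rn: "x \<in> Rn n \<longleftrightarrow> x \<in> extensional {..<n}"
  by (simp add: space_PiM PiE_def)

lemma sets_\<nu>_prod [simp, measurable_cong]: "sets (\<nu>_prod \<alpha> n) = sets (borel_Rn n)"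
  unfolding \<nu>_prod_def by (intro sets_PiM_cong) (auto simp: \<nu>_def)

lemma space_\<nu>_prod [simp]: "space (\<nu>_prod \<alpha> n) = Rn n"
  by (rule sets_eq_imp_space_eq) simp

lemma prob_space_\<nu>_prod: "0 < \<alpha> \<Longrightarrow> prob_space (\<nu>_prod \<alpha> n)"
  unfolding \<nu>_prod_def by (intro prob_space_PiM prob_space_\<nu>)

text \<open>
  A measurable substitute for the closure of \<open>A\<close>: the intersection over \<open>k\<close> of the unions of
  those cells of the grid of mesh \<open>1 / (k + 1)\<close> that meet \<open>A\<close>. The grid is countable, hence each
  union is measurable.
\<close>

lemma sequential_hull:
  assumes A: "A \<subseteq> Rn n"
  obtains A' where "A' \<in> sets (borel_Rn n)" "A \<subseteq> A'"
    "\<And>x. x \<in> A' \<Longrightarrow> \<exists>a. (\<forall>k::nat. a k \<in> A) \<and> (\<forall>i<n. (\<lambda>k. a k i) \<longlonglongrightarrow> x i)"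
proof -
  define cell where "cell k x = (\<lambda>i\<in>{..<n}. \<lfloor>real (Suc k) * x i\<rfloor>)" for k and x :: "nat \<Rightarrow> real"
  define D where "D k m = PiE {..<n} (\<lambda>i. {u. \<lfloor>real (Suc k) * u\<rfloor> = m i})" for k and m :: "nat \<Rightarrow> int"
  define A' where "A' = (\<Inter>k. \<Union>m\<in>cell k ` A. D k m)"
  have D: "D k m \<in> sets (borel_Rn n)" for k m
    unfolding D_def by (intro sets_PiM_I_finite) auto
  have "countable (cell k ` A)" for k
  proof (rule countable_subset)
    show "cell k ` A \<subseteq> PiE {..<n} (\<lambda>_. UNIV)" unfolding cell_def by (auto split: if_splits)
    show "countable (PiE {..<n} (\<lambda>_. UNIV :: int set))" by (intro countable_PiE) auto
  qed
  then have "(\<Union>m\<in>cell k ` A. D k m) \<in> sets (borel_Rn n)" for k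
    using D by (intro sets.countable_UN') auto
  then have "A' \<in> sets (borel_Rn n)" unfolding A'_def by (intro sets.countable_INT) auto
  moreover have "A \<subseteq> A'" 
  proof
    fix x assume x: "x \<in> A"
    then have "x \<in> Rn n" using A by blast
    then have "x \<in> D k (cell k x)" for k by (auto simp: D_def cell_def space_PiM PiE_iff)
    then show "x \<in> A'" unfolding A'_def using x by blast
  qed
  moreover have "\<exists>a. (\<forall>k::nat. a k \<in> A) \<and> (\<forall>i<n. (\<lambda>k. a k i) \<longlonglongrightarrow> x i)" if x: "x \<in> A'" for x
  proof -
    have "\<exists>a. a \<in> A \<and> (\<forall>i<n. \<lfloor>real (Suc k) * x i\<rfloor> = \<lfloor>real (Suc k) * a i\<rfloor>)" for k
    proof -
      obtain m where m: "m \<in> cell k ` A" "x \<in> D k m" using x unfolding A'_def by blast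
      then obtain a where "a \<in> A" "m = cell k a" by blast
      with m(2) show ?thesis unfolding D_def cell_def by (intro exI[of _ a]) (auto simp: PiE_iff)
    qed
    then obtain a where a: "\<And>k. a k \<in> A" "\<And>k i. i < n \<Longrightarrow> \<lfloor>real (Suc k) * x i\<rfloor> = \<lfloor>real (Suc k) * a k i\<rfloor>"
      by metis
    have "(\<lambda>k. a k i) \<longlonglongrightarrow> x i" if i: "i < n" for i
    proof (rule LIMSEQ_I)
      fix r :: real assume r: "0 < r"
      obtain k0 :: nat where k0: "0 < k0" "inverse (real k0) < r" using ex_inverse_of_nat_less[OF r] by blast
      have "norm (a k i - x i) < r" if k: "k0 \<le> k" for k
      proof -
        have "\<bar>real (Suc k) * a k i - real (Suc k) * x i\<bar> < 1"
          using a(2)[OF i, of k] floor_correct[of "real (Suc k) * x i"] floor_correct[of "real (Suc k) * a k i"]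
          unfolding abs_less_iff by linarith
        then have "real (Suc k) * \<bar>a k i - x i\<bar> < 1"
          by (simp only: right_diff_distrib[symmetric] abs_mult abs_of_nat)
        then have "\<bar>a k i - x i\<bar> < inverse (real (Suc k))"
          by (simp add: field_simps)
        also have "\<dots> \<le> inverse (real k0)" using k k0 by (intro le_imp_inverse_le) auto
        finally show ?thesis using k0 by simp
      qed
      then show "\<exists>no. \<forall>k\<ge>no. norm (a k i - x i) < r" by blast
    qed
    with a(1) show ?thesis by blast
  qed
  ultimately show ?thesis by (rule that)
qed

lemma \<nu>_prod_cube:
  assumes \<alpha>: "0 < \<alpha>" and T[measurable]: "T \<in> sets borel"
  shows "{x \<in> Rn n. \<forall>i<n. x i \<in> T} \<in> sets (borel_Rn n)"
    and "measure (\<nu>_prod \<alpha> n) (Rn n - {x \<in> Rn n. \<forall>i<n. x i \<in> T}) \<le> real n * measure (\<nu> \<alpha>) (- T)"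
proof -
  interpret prob_space "\<nu>_prod \<alpha> n" by (rule prob_space_\<nu>_prod[OF \<alpha>])
  have [measurable]: "(\<lambda>x. x i) \<in> borel_measurable (borel_Rn n)" if "i < n" for i
    using that by (intro measurable_component_singleton) simp
  have "{x \<in> Rn n. \<forall>i<n. x i \<in> T} = PiE {..<n} (\<lambda>_. T)" by (auto simp: space_PiM PiE_def)
  then show "{x \<in> Rn n. \<forall>i<n. x i \<in> T} \<in> sets (borel_Rn n)"
    using T by (simp only:) (intro sets_PiM_I_finite, auto)
  have m: "{x \<in> Rn n. x i \<in> - T} \<in> sets (borel_Rn n)" if "i < n" for i
    using that by measurable
  have one: "measure (\<nu>_prod \<alpha> n) {x \<in> Rn n. x i \<in> - T} = measure (\<nu> \<alpha>) (- T)" if i: "i < n" for i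
  proof -
    have "distr (\<nu>_prod \<alpha> n) (\<nu> \<alpha>) (\<lambda>x. x i) = \<nu> \<alpha>"
      unfolding \<nu>_prod_def using i by (intro distr_PiM_component prob_space_\<nu> \<alpha>) auto
    then have "measure (\<nu> \<alpha>) (- T) = measure (distr (\<nu>_prod \<alpha> n) (\<nu> \<alpha>) (\<lambda>x. x i)) (- T)" by simp
    also have "\<dots> = measure (\<nu>_prod \<alpha> n) ((\<lambda>x. x i) -` (- T) \<inter> Rn n)"
      using i by (subst measure_distr) (auto simp: \<nu>_def cong: measurable_cong_sets)
    also have "(\<lambda>x. x i) -` (- T) \<inter> Rn n = {x \<in> Rn n. x i \<in> - T}" by auto
    finally show ?thesis by simp
  qed
  have "Rn n - {x \<in> Rn n. \<forall>i<n. x i \<in> T} = (\<Union>i\<in>{..<n}. {x \<in> Rn n. x i \<in> - T})" by auto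
  also have "measure (\<nu>_prod \<alpha> n) \<dots> \<le> (\<Sum>i\<in>{..<n}. measure (\<nu>_prod \<alpha> n) {x \<in> Rn n. x i \<in> - T})"
    using m by (intro finite_measure_subadditive_finite) auto
  also have "\<dots> = real n * measure (\<nu> \<alpha>) (- T)" using one by simp
  finally show "measure (\<nu>_prod \<alpha> n) (Rn n - {x \<in> Rn n. \<forall>i<n. x i \<in> T}) \<le> real n * measure (\<nu> \<alpha>) (- T)" .
qed

text \<open>
  The outer measure of \<open>A\<close> is at least \<open>3 / 4\<close>. Good events are measurable on the underlying sample
  space only, and their images in \<open>\<real>\<^sup>n\<close> need not be.
\<close>

definition thick :: "real \<Rightarrow> nat \<Rightarrow> (nat \<Rightarrow> real) set \<Rightarrow> bool" where
  "thick \<alpha> n A \<longleftrightarrow> A \<subseteq> Rn n \<and> (\<forall>A'\<in>sets (borel_Rn n). A \<subseteq> A' \<longrightarrow> 3 / 4 \<le> measure (\<nu>_prod \<alpha> n) A')"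

definition unreachable :: "real \<Rightarrow> nat \<Rightarrow> real \<Rightarrow> real \<Rightarrow> (nat \<Rightarrow> real) set \<Rightarrow> (nat \<Rightarrow> real) set \<Rightarrow> bool" where
  "unreachable \<alpha> n \<rho> s A B \<longleftrightarrow> (\<forall>a\<in>A. \<forall>z\<in>Rn n. \<forall>w\<in>Rn n.
    (\<Sum>i<n. \<bar>z i\<bar> powr \<alpha>) \<le> \<rho> \<longrightarrow> (\<Sum>i<n. (w i)\<^sup>2) \<le> s\<^sup>2 \<longrightarrow> vadd n (vadd n a z) w \<notin> B)"

text \<open>
  A displacement that is not the sum of a vector of \<open>\<alpha>\<close>-energy at most \<open>\<rho>\<close> and one of Euclidean
  norm at most \<open>s\<close> has cost at least \<open>(1 - e) * \<rho>\<close>: put its coordinates of size at least \<open>L\<close> into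
  the first vector and the others into the second, then one of the two is too long. The estimates
  on the cost need starting points with coordinates in \<open>T\<close>, which excludes a set of measure at
  most \<open>1 / 4\<close>. Continuity of the cost extends the bound to a measurable hull.
\<close>

lemma concentration:
  fixes n :: nat
  assumes \<alpha>: "0 < \<alpha>" and tau: "property_tau l c (\<nu> \<alpha>)" and l: "0 < l" "l < 1"
    and c0: "\<And>x y. 0 \<le> c x y" and cont: "\<And>x y. isCont (\<lambda>x. c x y) x"
    and T: "T \<in> sets borel" "real n * measure (\<nu> \<alpha>) (- T) \<le> 1 / 4"
    and large: "\<And>x y. x \<in> T \<Longrightarrow> L \<le> \<bar>y - x\<bar> \<Longrightarrow> (1 - e) * \<bar>y - x\<bar> powr \<alpha> \<le> c x y"
    and small: "\<And>x y. x \<in> T \<Longrightarrow> \<bar>y - x\<bar> < L \<Longrightarrow> (y - x)\<^sup>2 / K \<le> c x y"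
    and K: "0 < K" and e: "0 \<le> e" "e \<le> 1" and \<rho>: "0 \<le> \<rho>" and t: "0 < L \<Longrightarrow> K * \<rho> \<le> s\<^sup>2"
    and thick: "thick \<alpha> n A" and B: "B \<in> sets (borel_Rn n)" and unreachable: "unreachable \<alpha> n \<rho> s A B"
  shows "measure (\<nu>_prod \<alpha> n) B \<le> 2 powr ((1 - l) / l) * exp (- ((1 - e) * \<rho>))"
proof -
  interpret prob_space "\<nu>_prod \<alpha> n" by (rule prob_space_\<nu>_prod[OF \<alpha>])
  have A: "A \<subseteq> Rn n" "\<And>A'. A' \<in> sets (borel_Rn n) \<Longrightarrow> A \<subseteq> A' \<Longrightarrow> 3 / 4 \<le> prob A'"
    using thick by (auto simp only: thick_def)
  define Q where "Q = {x \<in> Rn n. \<forall>i<n. x i \<in> T}"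
  have Q: "Q \<in> sets (borel_Rn n)" "prob (Rn n - Q) \<le> 1 / 4"
    unfolding Q_def using \<nu>_prod_cube[OF \<alpha> T(1), of n] T(2) by linarith+
  have "A \<inter> Q \<subseteq> Rn n" using A by blast
  then obtain A' where A': "A' \<in> sets (borel_Rn n)" "A \<inter> Q \<subseteq> A'"
    "\<And>x. x \<in> A' \<Longrightarrow> \<exists>a. (\<forall>k::nat. a k \<in> A \<inter> Q) \<and> (\<forall>i<n. (\<lambda>k. a k i) \<longlonglongrightarrow> x i)"
    by (rule sequential_hull) (rule that)
  have "3 / 4 \<le> prob (A' \<union> (Rn n - Q))"
    using A' Q A(1) by (intro A(2)) auto
  also have "\<dots> \<le> prob A' + prob (Rn n - Q)"
    using A' Q by (intro measure_Un_le) auto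
  finally have half: "1 / 2 \<le> prob A'" using Q(2) by linarith
  have core: "(1 - e) * \<rho> \<le> (\<Sum>i<n. c (a i) (y i))" if a: "a \<in> A \<inter> Q" and y: "y \<in> B" for a y
  proof -
    define z where "z = (\<lambda>i\<in>{..<n}. if L \<le> \<bar>y i - a i\<bar> then y i - a i else 0)"
    define w where "w = (\<lambda>i\<in>{..<n}. if L \<le> \<bar>y i - a i\<bar> then 0 else y i - a i)"
    have zw: "z \<in> Rn n" "w \<in> Rn n" by (auto simp: z_def w_def space_Rn)
    have aT: "a i \<in> T" if "i < n" for i using a that by (auto simp: Q_def)
    have "y \<in> Rn n" using sets.sets_into_space[OF B] y by auto
    then have "vadd n (vadd n a z) w = y"
      by (auto simp: vadd_def z_def w_def fun_eq_iff space_Rn extensional_def)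
    then have "\<not> ((\<Sum>i<n. \<bar>z i\<bar> powr \<alpha>) \<le> \<rho> \<and> (\<Sum>i<n. (w i)\<^sup>2) \<le> s\<^sup>2)"
      using unreachable[unfolded unreachable_def, rule_format, of a z w] zw a y by auto
    then consider "\<rho> < (\<Sum>i<n. \<bar>z i\<bar> powr \<alpha>)" | "s\<^sup>2 < (\<Sum>i<n. (w i)\<^sup>2)" by linarith
    then show ?thesis
    proof cases
      case 1
      have "(1 - e) * \<rho> \<le> (1 - e) * (\<Sum>i<n. \<bar>z i\<bar> powr \<alpha>)" using 1 e by (intro mult_left_mono) auto
      also have "\<dots> = (\<Sum>i<n. (1 - e) * \<bar>z i\<bar> powr \<alpha>)" by (rule sum_distrib_left)
      also have "\<dots> \<le> (\<Sum>i<n. c (a i) (y i))"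
        using large aT c0 by (intro sum_mono) (auto simp: z_def)
      finally show ?thesis .
    next
      case 2
      have "0 < L"
      proof (rule ccontr)
        assume "\<not> 0 < L"
        then have "L \<le> \<bar>y i - a i\<bar>" for i using abs_ge_zero[of "y i - a i"] by linarith
        then have "(\<Sum>i<n. (w i)\<^sup>2) = 0" by (simp add: w_def)
        then show False using 2 zero_le_power2[of s] by linarith
      qed
      have "(1 - e) * \<rho> \<le> 1 * \<rho>" using e \<rho> by (intro mult_right_mono) auto
      also have "\<dots> \<le> (\<Sum>i<n. (w i)\<^sup>2) / K" using t[OF \<open>0 < L\<close>] 2 K by (simp add: field_simps)
      also have "\<dots> = (\<Sum>i<n. (w i)\<^sup>2 / K)" by (rule sum_divide_distrib)
      also have "\<dots> \<le> (\<Sum>i<n. c (a i) (y i))"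
        using small aT c0 by (intro sum_mono) (auto simp: w_def)
      finally show ?thesis .
    qed
  qed
  have "(1 - e) * \<rho> \<le> (\<Sum>i<n. c (x i) (y i))" if x: "x \<in> A'" and y: "y \<in> B" for x y
  proof -
    obtain a where a: "\<And>k::nat. a k \<in> A \<inter> Q" "\<And>i. i < n \<Longrightarrow> (\<lambda>k. a k i) \<longlonglongrightarrow> x i"
      using A'(3)[OF x] by blast
    have "(\<lambda>k. \<Sum>i<n. c (a k i) (y i)) \<longlonglongrightarrow> (\<Sum>i<n. c (x i) (y i))"
      using a(2) by (intro tendsto_sum isCont_tendsto_compose[OF cont]) auto
    then show ?thesis by (rule LIMSEQ_le_const) (use core[OF a(1) y] in auto)
  qed
  then show ?thesis
    using property_tau_half[OF prob_space_axioms _ l, of "\<lambda>x y. \<Sum>i<n. c (x i) (y i)" A' B "(1 - e) * \<rho>"]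
      property_tau_PiM[OF prob_space_\<nu>[OF \<alpha>] tau l, of n] A'(1) B half
    by (simp add: \<nu>_prod_def[symmetric])
qed

lemma eventually_along:
  "eventually P (along N) \<longleftrightarrow> eventually (\<lambda>n. n \<in> N \<longrightarrow> P n) sequentially"
  unfolding along_def by (rule eventually_inf_principal)

lemma eventually_along_mem: "eventually (\<lambda>n. n \<in> N) (along N)"
  by (simp add: eventually_along)

lemma eventually_along_sequentially: "eventually P sequentially \<Longrightarrow> eventually P (along N)"
  unfolding eventually_along by (erule eventually_mono) simp

lemma isCont_hyp_cost: "isCont (hyp_cost b) d"
  unfolding hyp_cost_def by (intro continuous_intros)

text \<open>
  Three sources for the cost. For \<open>\<alpha> = 2\<close> the Gaussian cost is sharp for all displacements and no
  Euclidean ball is needed. For \<open>\<alpha> = 1\<close> the Laplace cost is sharp beyond a fixed distance, and the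
  constant quadratic loss below it is paid by \<open>v = o(t\<^sup>2)\<close>. Otherwise the Laplace cost is read
  through the coordinate \<open>H\<close>, with coordinates truncated at \<open>(2 * ln n) powr (1 / \<alpha>)\<close>: none of \<open>n\<close>
  independent coordinates exceeds this with probability close to 1. The quadratic loss is then a
  power of \<open>ln n\<close>, which is negligible against \<open>t\<^sup>2 / v\<close>.
\<close>

lemma asymptotic_concentration:
  fixes v t :: "nat \<Rightarrow> real"
  assumes \<alpha>: "0 < \<alpha>" "\<alpha> \<le> 2" and v: "filterlim v at_top (along N)"
    and e: "0 < e" "e < 1" and r: "0 < r"
    and t: "\<alpha> < 2 \<Longrightarrow> t_growth \<alpha> N v t"
  shows "\<exists>C. \<forall>\<^sub>F n in along N. \<forall>A B. thick \<alpha> n A \<longrightarrow> B \<in> sets (borel_Rn n) \<longrightarrow>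
    unreachable \<alpha> n (r * v n) (if \<alpha> < 2 then t n else 0) A B \<longrightarrow>
    measure (\<nu>_prod \<alpha> n) B \<le> C * exp (- ((1 - e) * (r * v n)))"
proof -
  have vpos: "\<forall>\<^sub>F n in along N. 0 < v n" using v unfolding filterlim_at_top_dense by blast
  consider "\<alpha> = 2" | "\<alpha> = 1" | "\<alpha> < 2" "\<alpha> \<noteq> 1" using \<alpha>(2) by linarith
  then show ?thesis
  proof cases
    case 1
    define l where "l = e / 2"
    have l: "0 < l" "l < 1" using e by (auto simp: l_def)
    have el: "1 - e \<le> (1 - l)\<^sup>2" by (simp add: l_def power2_eq_square algebra_simps)
    have "\<forall>\<^sub>F n in along N. \<forall>A B. thick \<alpha> n A \<longrightarrow> B \<in> sets (borel_Rn n) \<longrightarrow>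
      unreachable \<alpha> n (r * v n) 0 A B \<longrightarrow>
      measure (\<nu>_prod \<alpha> n) B \<le> 2 powr ((1 - l) / l) * exp (- ((1 - e) * (r * v n)))"
      using vpos
    proof eventually_elim
      case (elim n)
      show ?case
      proof (intro allI impI, rule concentration[where T = UNIV and L = 0 and K = 1 and c = "\<lambda>x y. (1 - l)\<^sup>2 * (y - x)\<^sup>2"])
        show "property_tau l (\<lambda>x y. (1 - l)\<^sup>2 * (y - x)\<^sup>2) (\<nu> \<alpha>)" unfolding 1 by (rule property_tau_gaussian[OF l])
        fix x y :: real
        show "isCont (\<lambda>x. (1 - l)\<^sup>2 * (y - x)\<^sup>2) x" by (intro continuous_intros)
        show "(1 - e) * \<bar>y - x\<bar> powr \<alpha> \<le> (1 - l)\<^sup>2 * (y - x)\<^sup>2"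
          using mult_right_mono[OF el, of "(y - x)\<^sup>2"] by (cases "y = x") (auto simp: 1 powr_numeral)
      qed (use \<alpha> l e r elim in auto)
    qed
    then show ?thesis using 1 by (intro exI[of _ "2 powr ((1 - l) / l)"]) simp
  next
    case 2
    have e2: "0 < e / 2" "e / 2 < 1" using e by auto
    obtain b where b: "0 < b" "property_tau (1 / 2) (\<lambda>x y. (1 - e / 2) * hyp_cost b (y - x)) (\<nu> 1)"
      by (rule property_tau_laplace[OF e2]) (rule that)
    \<comment> \<open>beyond \<open>L\<close> the offset \<open>b\<close> in the cost is at most the fraction \<open>e / 2\<close> of the displacement\<close>
    define L where "L = 2 * b / e"
    define K where "K = 2 * (b + L) / (1 - e / 2)"
    have L: "0 < L" using b e by (simp add: L_def)
    have K: "0 < K" using b L e by (simp add: K_def)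
    have "v \<in> o[along N](\<lambda>n. (t n)\<^sup>2)" using t 2 by (simp add: t_growth_def)
    then have "\<forall>\<^sub>F n in along N. norm (v n) \<le> 1 / (K * r) * norm ((t n)\<^sup>2)"
      using K r by (intro landau_o.smallD) auto
    then have "\<forall>\<^sub>F n in along N. \<forall>A B. thick \<alpha> n A \<longrightarrow> B \<in> sets (borel_Rn n) \<longrightarrow>
      unreachable \<alpha> n (r * v n) (t n) A B \<longrightarrow>
      measure (\<nu>_prod \<alpha> n) B \<le> 2 powr ((1 - 1 / 2) / (1 / 2)) * exp (- ((1 - e) * (r * v n)))"
      using vpos
    proof eventually_elim
      case (elim n)
      show ?case
      proof (intro allI impI, rule concentration[where T = UNIV and L = L and K = K and c = "\<lambda>x y. (1 - e / 2) * hyp_cost b (y - x)"])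
        show "property_tau (1 / 2) (\<lambda>x y. (1 - e / 2) * hyp_cost b (y - x)) (\<nu> \<alpha>)" unfolding 2 by (rule b(2))
        fix x y :: real
        show "0 \<le> (1 - e / 2) * hyp_cost b (y - x)" using e hyp_cost_nonneg[of b] by simp
        show "isCont (\<lambda>x. (1 - e / 2) * hyp_cost b (y - x)) x"
          by (intro continuous_intros isCont_o2[OF _ isCont_hyp_cost])
        show "(1 - e) * \<bar>y - x\<bar> powr \<alpha> \<le> (1 - e / 2) * hyp_cost b (y - x)" if "L \<le> \<bar>y - x\<bar>"
        proof -
          have "2 * b \<le> e * \<bar>y - x\<bar>" using that e by (simp add: L_def field_simps)
          then have "(1 - e) * \<bar>y - x\<bar> \<le> (1 - e / 2) * \<bar>y - x\<bar> - b" by (simp add: algebra_simps)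
          also have "\<dots> \<le> (1 - e / 2) * (\<bar>y - x\<bar> - b)" using b e by (simp add: algebra_simps)
          also have "\<dots> \<le> (1 - e / 2) * hyp_cost b (y - x)"
            using b e by (intro mult_left_mono hyp_cost_ge) auto
          finally show ?thesis using 2 by simp
        qed
        show "(y - x)\<^sup>2 / K \<le> (1 - e / 2) * hyp_cost b (y - x)" if "\<bar>y - x\<bar> < L"
        proof -
          have "(y - x)\<^sup>2 / K = (1 - e / 2) * ((y - x)\<^sup>2 / (2 * (b + L)))" by (simp add: K_def)
          also have "\<dots> \<le> (1 - e / 2) * hyp_cost b (y - x)"
            using b e that by (intro mult_left_mono hyp_cost_quadratic) auto
          finally show ?thesis .
        qed
        show "K * (r * v n) \<le> (t n)\<^sup>2" using elim K r by (simp add: field_simps)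
      qed (use \<alpha> K e r elim in auto)
    qed
    then show ?thesis using 2 by (intro exI[of _ "2 powr ((1 - 1 / 2) / (1 / 2))"]) simp
  next
    case 3
    have e2: "0 < e / 2" "e / 2 < 1" using e by auto
    obtain b where b: "0 < b" "property_tau (1 / 2) (\<lambda>x y. (1 - e / 2) * hyp_cost b (y - x)) (\<nu> 1)"
      by (rule property_tau_laplace[OF e2]) (rule that)
    obtain H \<psi> where H: "laplace_coordinate \<alpha> H" "\<And>z. H (\<psi> z) = z" "\<psi> \<in> borel_measurable borel"
        "distr (\<nu> 1) borel \<psi> = \<nu> \<alpha>"
      by (rule laplace_coordinate_exists[OF \<alpha>(1)]) (rule that)
    interpret laplace_coordinate \<alpha> H by (rule H)
    have tau: "property_tau (1 / 2) (\<lambda>x y. (1 - e / 2) * hyp_cost b (H y - H x)) (\<nu> \<alpha>)"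
      unfolding H(4)[symmetric]
      by (rule property_tau_distr[OF b(2)]) (use H in \<open>auto simp: \<nu>_def\<close>)
    obtain R0 K where R0: "1 \<le> R0" and K: "0 < K" and cost: "\<And>R x y. R0 \<le> R \<Longrightarrow> \<bar>x\<bar> \<le> R \<Longrightarrow>
      (R\<^sup>2 \<le> \<bar>y - x\<bar> \<longrightarrow> (1 - e) * \<bar>y - x\<bar> powr \<alpha> \<le> (1 - e / 2) * hyp_cost b (H y - H x)) \<and>
      (\<bar>y - x\<bar> < R\<^sup>2 \<longrightarrow> (y - x)\<^sup>2 / (K * R ^ 4) \<le> (1 - e / 2) * hyp_cost b (H y - H x))"
      using truncated_cost[OF e b(1)] by blast
    define R where "R n = (2 * ln (real n)) powr (1 / \<alpha>)" for n :: nat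
    have evR: "\<forall>\<^sub>F n in sequentially. R0 \<le> R n" unfolding R_def using \<alpha>(1) by real_asymp
    have evT: "\<forall>\<^sub>F n in sequentially. real n * exp (- (2 * ln n - ln (R n) - 2)) \<le> 1 / 4"
      unfolding R_def using \<alpha>(1) by real_asymp
    have "\<forall>\<^sub>F n in sequentially. ln (r * K * ((2 * ln (real n)) powr (1 / \<alpha>)) ^ 4) \<le> ln (real n) powr (\<alpha> / 2)"
      using \<alpha>(1) r K by real_asymp
    then have evK: "\<forall>\<^sub>F n in sequentially. ln (r * K * R n ^ 4) \<le> ln (real n) powr (\<alpha> / 2)" by (simp add: R_def)
    have evn: "\<forall>\<^sub>F n in sequentially. 2 \<le> (n::nat)" by (rule eventually_ge_at_top)
    have tg: "(\<lambda>n. ln (real n) powr (\<alpha> / 2)) \<in> o[along N](\<lambda>n. ln ((t n)\<^sup>2 / v n))"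
        "\<forall>\<^sub>F n in along N. 0 < ln ((t n)\<^sup>2 / v n)"
      using t 3 by (simp_all add: t_growth_def)
    have "\<forall>\<^sub>F n in along N. norm (ln (real n) powr (\<alpha> / 2)) \<le> 1 * norm (ln ((t n)\<^sup>2 / v n))"
      by (rule landau_o.smallD[OF tg(1)]) simp
    then have "\<forall>\<^sub>F n in along N. \<forall>A B. thick \<alpha> n A \<longrightarrow> B \<in> sets (borel_Rn n) \<longrightarrow>
      unreachable \<alpha> n (r * v n) (t n) A B \<longrightarrow>
      measure (\<nu>_prod \<alpha> n) B \<le> 2 powr ((1 - 1 / 2) / (1 / 2)) * exp (- ((1 - e) * (r * v n)))"
      using vpos tg(2) evR[THEN eventually_along_sequentially] evT[THEN eventually_along_sequentially]
        evK[THEN eventually_along_sequentially] evn[THEN eventually_along_sequentially]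
    proof eventually_elim
      case (elim n)
      have R1: "1 \<le> R n" using elim R0 by linarith
      show ?case
      proof (intro allI impI, rule concentration[where T = "{- R n..R n}" and L = "(R n)\<^sup>2" and K = "K * R n ^ 4"
            and c = "\<lambda>x y. (1 - e / 2) * hyp_cost b (H y - H x)"])
        show "property_tau (1 / 2) (\<lambda>x y. (1 - e / 2) * hyp_cost b (H y - H x)) (\<nu> \<alpha>)" by (rule tau)
        fix x y :: real
        show "0 \<le> (1 - e / 2) * hyp_cost b (H y - H x)" using e hyp_cost_nonneg[of b] by simp
        show "isCont (\<lambda>x. (1 - e / 2) * hyp_cost b (H y - H x)) x"
          by (intro continuous_intros isCont_o2[OF _ isCont_hyp_cost] H_cont)
        show "(1 - e) * \<bar>y - x\<bar> powr \<alpha> \<le> (1 - e / 2) * hyp_cost b (H y - H x)"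
          if "x \<in> {- R n..R n}" "(R n)\<^sup>2 \<le> \<bar>y - x\<bar>"
          using cost[of "R n" x y] that elim by auto
        show "(y - x)\<^sup>2 / (K * R n ^ 4) \<le> (1 - e / 2) * hyp_cost b (H y - H x)"
          if "x \<in> {- R n..R n}" "\<bar>y - x\<bar> < (R n)\<^sup>2"
          using cost[of "R n" x y] that elim by auto
        show "0 < K * R n ^ 4" using K R1 by simp
        show "K * R n ^ 4 * (r * v n) \<le> (t n)\<^sup>2"
        proof -
          have pos: "0 < r * K * R n ^ 4" using r K R1 by simp
          have "ln (r * K * R n ^ 4) \<le> ln ((t n)\<^sup>2 / v n)" using elim by simp
          moreover have "0 < (t n)\<^sup>2 / v n"
          proof -
            have "t n \<noteq> 0" using elim by (auto intro: ccontr)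
            then show ?thesis using elim by simp
          qed
          ultimately have "r * K * R n ^ 4 \<le> (t n)\<^sup>2 / v n" using pos by simp
          then show ?thesis using elim by (simp add: field_simps)
        qed
        show "real n * measure (\<nu> \<alpha>) (- {- R n..R n}) \<le> 1 / 4"
        proof -
          have "- {- R n..R n} \<subseteq> {..- R n} \<union> {R n<..}" by auto
          then have "measure (\<nu> \<alpha>) (- {- R n..R n}) \<le> measure (\<nu> \<alpha>) ({..- R n} \<union> {R n<..})"
            by (intro A.finite_measure_mono) auto
          also have "\<dots> \<le> measure (\<nu> \<alpha>) {..- R n} + measure (\<nu> \<alpha>) {R n<..}"
            by (intro measure_Un_le) auto
          also have "measure (\<nu> \<alpha>) {..- R n} = measure (\<nu> \<alpha>) {R n<..}"
            using cdf_uminus[OF \<alpha>(1), of "R n"] by (simp add: cdf_def)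
          also have "measure (\<nu> \<alpha>) {R n<..} = exp (- H (R n)) / 2" using R1 by (intro tail_H) simp
          also have "exp (- H (R n)) / 2 + exp (- H (R n)) / 2 = exp (- H (R n))" by simp
          also have "\<dots> \<le> exp (- (2 * ln n - ln (R n) - 2))"
          proof -
            have "0 < 2 * ln (real n)" using elim by simp
            then have "R n powr \<alpha> = 2 * ln n" unfolding R_def using \<alpha>(1) by (simp add: powr_powr)
            then show ?thesis using H_lower[OF R1] by simp
          qed
          finally have "real n * measure (\<nu> \<alpha>) (- {- R n..R n}) \<le> real n * exp (- (2 * ln n - ln (R n) - 2))"
            by (intro mult_left_mono) auto
          with elim show ?thesis by linarith
        qed
      qed (use \<alpha> e r elim in auto)
    qed
    then show ?thesis using 3 by (intro exI[of _ "2 powr ((1 - 1 / 2) / (1 / 2))"]) simp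
  qed
qed

section \<open>Translations of product measures\<close>

text \<open>
  Only the signs \<open>s = 1\<close> and \<open>s = - 1\<close> occur: a translation, and a reflection followed by it.
\<close>

definition reflect_shift :: "nat \<Rightarrow> real \<Rightarrow> (nat \<Rightarrow> real) \<Rightarrow> (nat \<Rightarrow> real) \<Rightarrow> nat \<Rightarrow> real" where
  "reflect_shift n s g x = (\<lambda>i\<in>{..<n}. g i + s * x i)"

lemma reflect_shift_measurable [measurable]: "reflect_shift n s g \<in> measurable (borel_Rn n) (borel_Rn n)"
  unfolding reflect_shift_def by measurable

lemma \<nu>_change_of_variables:
  assumes \<alpha>: "0 < \<alpha>" and s: "s = 1 \<or> s = - 1" and A[measurable]: "A \<in> sets borel"
  shows "(\<integral>\<^sup>+x. ennreal (exp (\<bar>x\<bar> powr \<alpha> - \<bar>g + s * x\<bar> powr \<alpha>)) * indicator A (g + s * x) \<partial>\<nu> \<alpha>)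
    = emeasure (\<nu> \<alpha>) A"
proof -
  note Y = Y_pos[OF \<alpha>]
  have "emeasure (\<nu> \<alpha>) A = (\<integral>\<^sup>+x. ennreal (\<nu>_density \<alpha> x) * indicator A x \<partial>lborel)"
    unfolding \<nu>_def by (rule emeasure_density) auto
  also have "\<dots> = (\<integral>\<^sup>+x. ennreal (\<nu>_density \<alpha> (g + s * x)) * indicator A (g + s * x) \<partial>lborel)"
    using s by (subst nn_integral_real_affine[where c = s and t = g]) auto
  also have "\<dots> = (\<integral>\<^sup>+x. ennreal (\<nu>_density \<alpha> x) *
      (ennreal (exp (\<bar>x\<bar> powr \<alpha> - \<bar>g + s * x\<bar> powr \<alpha>)) * indicator A (g + s * x)) \<partial>lborel)"
  proof (rule nn_integral_cong)
    fix x
    have "\<nu>_density \<alpha> (g + s * x) = \<nu>_density \<alpha> x * exp (\<bar>x\<bar> powr \<alpha> - \<bar>g + s * x\<bar> powr \<alpha>)"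
      by (simp add: mult_exp_exp)
    then have "ennreal (\<nu>_density \<alpha> (g + s * x))
        = ennreal (\<nu>_density \<alpha> x) * ennreal (exp (\<bar>x\<bar> powr \<alpha> - \<bar>g + s * x\<bar> powr \<alpha>))"
      by (simp only:) (rule ennreal_mult, use Y in auto)
    then show "ennreal (\<nu>_density \<alpha> (g + s * x)) * indicator A (g + s * x) = ennreal (\<nu>_density \<alpha> x) *
      (ennreal (exp (\<bar>x\<bar> powr \<alpha> - \<bar>g + s * x\<bar> powr \<alpha>)) * indicator A (g + s * x))"
      by (simp only: mult.assoc)
  qed
  also have "\<dots> = (\<integral>\<^sup>+x. ennreal (exp (\<bar>x\<bar> powr \<alpha> - \<bar>g + s * x\<bar> powr \<alpha>)) * indicator A (g + s * x) \<partial>\<nu> \<alpha>)"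
    unfolding \<nu>_def by (subst nn_integral_density) auto
  finally show ?thesis by simp
qed

text \<open>
  Both measures agree on boxes, where the integral factorises.
\<close>

lemma \<nu>_prod_change_of_variables:
  assumes \<alpha>: "0 < \<alpha>" and s: "s = 1 \<or> s = - 1" and E: "E \<in> sets (borel_Rn n)"
  shows "emeasure (\<nu>_prod \<alpha> n) E = (\<integral>\<^sup>+x. ennreal (exp (\<Sum>i<n. \<bar>x i\<bar> powr \<alpha> - \<bar>g i + s * x i\<bar> powr \<alpha>))
    * indicator E (reflect_shift n s g x) \<partial>\<nu>_prod \<alpha> n)"
proof -
  interpret P: product_sigma_finite "\<lambda>_::nat. \<nu> \<alpha>"
    by (intro product_sigma_finite.intro prob_space_imp_sigma_finite prob_space_\<nu> \<alpha>)
  define \<Phi> where "\<Phi> x = ennreal (exp (\<Sum>i<n. \<bar>x i\<bar> powr \<alpha> - \<bar>g i + s * x i\<bar> powr \<alpha>))" for x :: "nat \<Rightarrow> real"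
  have \<Phi>[measurable]: "\<Phi> \<in> borel_measurable (\<nu>_prod \<alpha> n)" unfolding \<Phi>_def by measurable
  define D where "D = distr (density (\<nu>_prod \<alpha> n) \<Phi>) (borel_Rn n) (reflect_shift n s g)"
  have emD: "emeasure D E = (\<integral>\<^sup>+x. \<Phi> x * indicator E (reflect_shift n s g x) \<partial>\<nu>_prod \<alpha> n)"
    if E[measurable]: "E \<in> sets (borel_Rn n)" for E
    unfolding D_def by (subst emeasure_distr)
      (auto simp: emeasure_density indicator_def intro!: nn_integral_cong
        measurable_space[OF reflect_shift_measurable])
  have "D = \<nu>_prod \<alpha> n"
    unfolding \<nu>_prod_def
  proof (rule P.PiM_eqI)
    show "sets D = sets (Pi\<^sub>M {..<n} (\<lambda>_. \<nu> \<alpha>))" using sets_\<nu>_prod[of \<alpha> n] by (simp add: D_def \<nu>_prod_def)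
    fix A :: "nat \<Rightarrow> real set" assume "\<And>i. i \<in> {..<n} \<Longrightarrow> A i \<in> sets (\<nu> \<alpha>)"
    then have A: "A i \<in> sets borel" if "i < n" for i using that by (auto simp: \<nu>_def)
    have "emeasure D (Pi\<^sub>E {..<n} A) = (\<integral>\<^sup>+x. \<Phi> x * indicator (Pi\<^sub>E {..<n} A) (reflect_shift n s g x) \<partial>\<nu>_prod \<alpha> n)"
      by (rule emD, rule sets_PiM_I_finite) (auto simp: A)
    also have "\<dots> = (\<integral>\<^sup>+x. (\<Prod>i<n. ennreal (exp (\<bar>x i\<bar> powr \<alpha> - \<bar>g i + s * x i\<bar> powr \<alpha>)) * indicator (A i) (g i + s * x i))
        \<partial>\<nu>_prod \<alpha> n)"
    proof (rule nn_integral_cong)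
      fix x
      have "\<Phi> x = (\<Prod>i<n. ennreal (exp (\<bar>x i\<bar> powr \<alpha> - \<bar>g i + s * x i\<bar> powr \<alpha>)))"
        unfolding \<Phi>_def by (simp add: exp_sum prod_ennreal)
      moreover have "(indicator (Pi\<^sub>E {..<n} A) (reflect_shift n s g x) :: ennreal) = (\<Prod>i<n. indicator (A i) (g i + s * x i))"
      proof (cases "\<forall>i<n. g i + s * x i \<in> A i")
        case True
        then show ?thesis by (auto simp: reflect_shift_def indicator_def PiE_iff)
      next
        case False
        then obtain i where "i < n" "g i + s * x i \<notin> A i" by blast
        then have "(\<Prod>i<n. indicator (A i) (g i + s * x i) :: ennreal) = 0" by (intro prod_zero bexI[of _ i]) auto
        moreover have "reflect_shift n s g x \<notin> Pi\<^sub>E {..<n} A"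
          using \<open>i < n\<close> \<open>g i + s * x i \<notin> A i\<close> by (auto simp: reflect_shift_def PiE_iff)
        ultimately show ?thesis by simp
      qed
      ultimately show "\<Phi> x * indicator (Pi\<^sub>E {..<n} A) (reflect_shift n s g x)
        = (\<Prod>i<n. ennreal (exp (\<bar>x i\<bar> powr \<alpha> - \<bar>g i + s * x i\<bar> powr \<alpha>)) * indicator (A i) (g i + s * x i))"
        by (simp only: prod.distrib)
    qed
    also have "\<dots> = (\<Prod>i<n. \<integral>\<^sup>+x. ennreal (exp (\<bar>x\<bar> powr \<alpha> - \<bar>g i + s * x\<bar> powr \<alpha>)) * indicator (A i) (g i + s * x) \<partial>\<nu> \<alpha>)"
      unfolding \<nu>_prod_def
    proof (rule P.product_nn_integral_prod)
      fix i assume "i \<in> {..<n}"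
      then have [measurable]: "A i \<in> sets borel" using A by simp
      show "(\<lambda>x. ennreal (exp (\<bar>x\<bar> powr \<alpha> - \<bar>g i + s * x\<bar> powr \<alpha>)) * indicator (A i) (g i + s * x)) \<in> borel_measurable (\<nu> \<alpha>)"
        unfolding \<nu>_def by measurable
    qed simp
    also have "\<dots> = (\<Prod>i<n. emeasure (\<nu> \<alpha>) (A i))"
      using A by (intro prod.cong refl \<nu>_change_of_variables[OF \<alpha> s]) auto
    finally show "emeasure D (Pi\<^sub>E {..<n} A) = (\<Prod>i\<in>{..<n}. emeasure (\<nu> \<alpha>) (A i))" .
  qed simp
  then show ?thesis using emD[OF E] by (simp add: \<Phi>_def)
qed

text \<open>
  Write the powers as concave powers of squares and use the parallelogram identity.
\<close>

lemma powr_two_point: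
  fixes x h :: real
  assumes \<alpha>: "0 < \<alpha>" "\<alpha> \<le> 2"
  shows "\<bar>h + x\<bar> powr \<alpha> + \<bar>h - x\<bar> powr \<alpha> \<le> 2 * \<bar>x\<bar> powr \<alpha> + 2 * \<bar>h\<bar> powr \<alpha>"
proof -
  define a where "a = \<alpha> / 2"
  have a: "0 \<le> a" "a \<le> 1" using \<alpha> by (auto simp: a_def)
  have sq: "\<bar>z\<bar> powr \<alpha> = (z\<^sup>2) powr a" for z :: real
  proof -
    have "\<bar>z\<bar> powr \<alpha> = (\<bar>z\<bar> powr 2) powr a" unfolding powr_powr by (simp add: a_def)
    also have "\<bar>z\<bar> powr 2 = z\<^sup>2" by (cases "z = 0") (auto simp: powr_numeral)
    finally show ?thesis .
  qed
  have conc: "(u powr a + w powr a) / 2 \<le> ((u + w) / 2) powr a" if "0 \<le> u" "0 \<le> w" for u w :: real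
  proof (cases "u + w = 0")
    case False
    define m where "m = (u + w) / 2"
    have m: "0 < m" using False that by (simp add: m_def)
    have y: "z powr a \<le> 1 - a + a * z" if "0 \<le> z" for z
      using Youngs_inequality_0[of "1 - a" a 1 z] a that by (cases "z = 0") auto
    have "(u / m) powr a + (w / m) powr a \<le> (1 - a + a * (u / m)) + (1 - a + a * (w / m))"
      using that m by (intro add_mono y) auto
    also have "\<dots> = 2 - 2 * a + a * ((u + w) / m)" by (simp add: algebra_simps add_divide_distrib)
    also have "(u + w) / m = 2" using m by (simp add: m_def field_simps)
    finally have "(u powr a + w powr a) / m powr a \<le> 2"
      using that m by (simp add: powr_divide add_divide_distrib)
    then show ?thesis using m by (simp add: field_simps m_def[symmetric])
  next
    case True
    then have "u = 0" "w = 0" using that by auto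
    then show ?thesis by simp
  qed
  have "(((h + x)\<^sup>2) powr a + ((h - x)\<^sup>2) powr a) / 2 \<le> (((h + x)\<^sup>2 + (h - x)\<^sup>2) / 2) powr a"
    by (rule conc) auto
  also have "((h + x)\<^sup>2 + (h - x)\<^sup>2) / 2 = x\<^sup>2 + h\<^sup>2" by (simp add: power2_eq_square algebra_simps)
  also have "(x\<^sup>2 + h\<^sup>2) powr a \<le> (x\<^sup>2) powr a + (h\<^sup>2) powr a" using a by (intro powr_add_le) auto
  finally show ?thesis unfolding sq by (simp add: field_simps)
qed

text \<open>
  The density ratio of a single translation is not bounded by the energy of \<open>g\<close> when \<open>\<alpha> > 1\<close>, so
  it is combined with its reflection. Replace \<open>x\<close> by \<open>g + x\<close> and by \<open>g - x\<close> in the integral that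
  defines the measure of \<open>E\<close>. Both points lie in \<open>E\<close> for \<open>x\<close> in a set of measure at least \<open>1 / 2\<close>, and
  the geometric mean of the two weights is at least \<open>exp (- G)\<close> with \<open>G\<close> the \<open>\<alpha>\<close>-energy of \<open>g\<close>.
\<close>

lemma translation_lower_bound:
  assumes \<alpha>: "0 < \<alpha>" "\<alpha> \<le> 2" and E: "E \<in> sets (borel_Rn n)"
    and E': "3 / 4 \<le> measure (\<nu>_prod \<alpha> n) {x \<in> Rn n. vadd n x g \<in> E}"
  shows "exp (- (\<Sum>i<n. \<bar>g i\<bar> powr \<alpha>)) / 2 \<le> measure (\<nu>_prod \<alpha> n) E"
proof -
  interpret prob_space "\<nu>_prod \<alpha> n" by (rule prob_space_\<nu>_prod[OF \<alpha>(1)])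
  define G where "G = (\<Sum>i<n. \<bar>g i\<bar> powr \<alpha>)"
  define P where "P s = {x \<in> Rn n. reflect_shift n s g x \<in> E}" for s
  define \<phi> where "\<phi> s x = (\<Sum>i<n. \<bar>x i\<bar> powr \<alpha> - \<bar>g i + s * x i\<bar> powr \<alpha>)" for s and x :: "nat \<Rightarrow> real"
  have Pm[measurable]: "P s \<in> sets (borel_Rn n)" for s
    unfolding P_def using E reflect_shift_measurable by measurable
  have \<phi>m[measurable]: "\<phi> s \<in> borel_measurable (borel_Rn n)" for s unfolding \<phi>_def by measurable
  have em: "emeasure (\<nu>_prod \<alpha> n) E = (\<integral>\<^sup>+x. ennreal (exp (\<phi> s x)) * indicator (P s) x \<partial>\<nu>_prod \<alpha> n)"
    if "s = 1 \<or> s = - 1" for s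
    unfolding \<nu>_prod_change_of_variables[OF \<alpha>(1) that E, of g] \<phi>_def
    by (rule nn_integral_cong) (auto simp: P_def indicator_def)
  have P1: "3 / 4 \<le> prob (P 1)"
  proof -
    have "P 1 = {x \<in> Rn n. vadd n x g \<in> E}" by (simp add: P_def reflect_shift_def vadd_def add.commute)
    then show ?thesis using E' by simp
  qed
  have P2: "3 / 4 \<le> prob (P (- 1))"
  proof -
    have "emeasure (\<nu>_prod \<alpha> n) (P 1) = (\<integral>\<^sup>+x. indicator (P (- 1)) x \<partial>\<nu>_prod \<alpha> n)"
      unfolding \<nu>_prod_change_of_variables[OF \<alpha>(1) _ Pm, of "- 1" 1 "\<lambda>_. 0", simplified]
      by (rule nn_integral_cong)
        (auto simp: P_def indicator_def reflect_shift_def space_Rn cong: restrict_cong)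
    then have "emeasure (\<nu>_prod \<alpha> n) (P 1) = emeasure (\<nu>_prod \<alpha> n) (P (- 1))" using Pm by simp
    then show ?thesis using P1 by (simp add: measure_def)
  qed
  have "prob (P 1 \<union> P (- 1)) = prob (P 1)
      + prob (P (- 1)) - prob (P 1 \<inter> P (- 1))"
    by (rule measure_Un3) (auto simp: fmeasurable_eq_sets)
  then have half: "1 / 2 \<le> prob (P 1 \<inter> P (- 1))"
    using P1 P2 prob_le_1[of "P 1 \<union> P (- 1)"] by linarith
  have gain: "2 * exp (- G) \<le> exp (\<phi> 1 x) + exp (\<phi> (- 1) x)" for x
  proof -
    have "- (2 * G) \<le> \<phi> 1 x + \<phi> (- 1) x"
    proof -
      have "\<phi> 1 x + \<phi> (- 1) x = (\<Sum>i<n. 2 * \<bar>x i\<bar> powr \<alpha> - (\<bar>g i + x i\<bar> powr \<alpha> + \<bar>g i - x i\<bar> powr \<alpha>))"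
        unfolding \<phi>_def by (simp add: sum.distrib[symmetric] algebra_simps)
      also have "\<dots> \<ge> (\<Sum>i<n. - (2 * \<bar>g i\<bar> powr \<alpha>))"
        by (intro sum_mono) (use powr_two_point[OF \<alpha>] in \<open>auto simp: algebra_simps\<close>)
      finally show ?thesis by (simp add: G_def sum_negf sum_distrib_left)
    qed
    then have "exp (- G) \<le> exp ((\<phi> 1 x + \<phi> (- 1) x) / 2)" by simp
    also have "\<dots> = exp (\<phi> 1 x / 2) * exp (\<phi> (- 1) x / 2)" by (simp add: mult_exp_exp add_divide_distrib)
    also have "2 * \<dots> \<le> (exp (\<phi> 1 x / 2))\<^sup>2 + (exp (\<phi> (- 1) x / 2))\<^sup>2"
      using sum_squares_bound[of "exp (\<phi> 1 x / 2)" "exp (\<phi> (- 1) x / 2)"] by simp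
    also have "\<dots> = exp (\<phi> 1 x) + exp (\<phi> (- 1) x)" by (simp add: exp_double[symmetric])
    finally show ?thesis by simp
  qed
  have "ennreal (2 * exp (- G) * prob (P 1 \<inter> P (- 1)))
      = (\<integral>\<^sup>+x. ennreal (2 * exp (- G)) * indicator (P 1 \<inter> P (- 1)) x \<partial>\<nu>_prod \<alpha> n)"
    by (subst nn_integral_cmult_indicator) (auto simp: emeasure_eq_measure ennreal_mult')
  also have "\<dots> \<le> (\<integral>\<^sup>+x. ennreal (exp (\<phi> 1 x)) * indicator (P 1) x + ennreal (exp (\<phi> (- 1) x)) * indicator (P (- 1)) x \<partial>\<nu>_prod \<alpha> n)"
    using gain by (intro nn_integral_mono) (auto simp: indicator_def simp flip: ennreal_plus intro!: ennreal_leI)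
  also have "\<dots> = emeasure (\<nu>_prod \<alpha> n) E + emeasure (\<nu>_prod \<alpha> n) E"
    using em[of 1] em[of "- 1"] by (subst nn_integral_add) auto
  also have "\<dots> = ennreal (2 * prob E)"
    by (simp add: emeasure_eq_measure flip: ennreal_plus)
  finally have "exp (- G) * prob (P 1 \<inter> P (- 1)) \<le> prob E" by simp
  moreover have "exp (- G) * (1 / 2) \<le> exp (- G) * prob (P 1 \<inter> P (- 1))"
    using half by (intro mult_left_mono) auto
  ultimately show ?thesis unfolding G_def[symmetric] by linarith
qed

section \<open>Probability away from images of low energy\<close>

lemma lp_norm_powr:
  assumes "0 < p" shows "lp_norm p n h powr p = (\<Sum>i<n. \<bar>h i\<bar> powr p)"
  unfolding lp_norm_def using assms by (simp add: powr_powr sum_nonneg)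

lemma lp_norm_le_iff:
  assumes "0 < p" "0 \<le> \<rho>" shows "lp_norm p n h \<le> \<rho> \<longleftrightarrow> (\<Sum>i<n. \<bar>h i\<bar> powr p) \<le> \<rho> powr p"
proof -
  have "0 \<le> lp_norm p n h" by (simp add: lp_norm_def)
  then show ?thesis
    unfolding lp_norm_powr[OF assms(1), symmetric] using assms
    by (metis less_eq_real_def not_le powr_less_mono2 powr_mono2)
qed

text \<open>
  The balls are only used through the energy, the sum of the \<open>p\<close>-th powers.
\<close>

lemma mem_scaled_ball:
  assumes p: "0 < p" and \<rho>: "0 < \<rho>"
  shows "z \<in> scaled_ball p n \<rho> \<longleftrightarrow> z \<in> Rn n \<and> (\<Sum>i<n. \<bar>z i\<bar> powr p) \<le> \<rho> powr p"
proof -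
  have scale: "(\<Sum>i<n. \<bar>vscale n c h i\<bar> powr p) = c powr p * (\<Sum>i<n. \<bar>h i\<bar> powr p)" if "0 < c" for c h
    unfolding sum_distrib_left using that by (intro sum.cong) (auto simp: vscale_def abs_mult powr_mult)
  have ball: "h \<in> lp_unit_ball p n \<longleftrightarrow> h \<in> Rn n \<and> (\<Sum>i<n. \<bar>h i\<bar> powr p) \<le> 1" for h
    unfolding lp_unit_ball_def using lp_norm_le_iff[OF p, of 1] by simp
  show ?thesis
  proof
    assume "z \<in> scaled_ball p n \<rho>"
    then obtain h where h: "h \<in> lp_unit_ball p n" "z = vscale n \<rho> h" unfolding scaled_ball_def by blast
    have "\<rho> powr p * (\<Sum>i<n. \<bar>h i\<bar> powr p) \<le> \<rho> powr p * 1"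
      using h(1) by (intro mult_left_mono) (auto simp: ball)
    then show "z \<in> Rn n \<and> (\<Sum>i<n. \<bar>z i\<bar> powr p) \<le> \<rho> powr p"
      unfolding h(2) scale[OF \<rho>] by (simp add: vscale_def space_Rn)
  next
    assume z: "z \<in> Rn n \<and> (\<Sum>i<n. \<bar>z i\<bar> powr p) \<le> \<rho> powr p"
    have "(1 / \<rho>) powr p * (\<Sum>i<n. \<bar>z i\<bar> powr p) \<le> (1 / \<rho>) powr p * \<rho> powr p"
      using z by (intro mult_left_mono) auto
    also have "\<dots> = 1" using \<rho> by (simp add: powr_divide)
    finally have "vscale n (1 / \<rho>) z \<in> lp_unit_ball p n"
      unfolding ball using scale[of "1 / \<rho>" z] \<rho> by (simp add: vscale_def space_Rn)
    moreover have "z = vscale n \<rho> (vscale n (1 / \<rho>) z)"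
      using z \<rho> by (auto simp: vscale_def fun_eq_iff space_Rn extensional_def)
    ultimately show "z \<in> scaled_ball p n \<rho>" unfolding scaled_ball_def by blast
  qed
qed

lemma outer_measure_of_lessD:
  assumes "outer_measure_of M A < e"
  obtains U where "U \<in> sets M" "A \<subseteq> U" "emeasure M U < e"
  using assms unfolding outer_measure_of_def INF_less_iff by blast

lemma (in prob_space) event_from_outer_measure:
  assumes "outer_measure_of M A < ennreal e" "0 < e"
  obtains W where "W \<in> sets M" "W \<inter> A = {}" "1 - e \<le> prob W"
proof -
  obtain U where U: "U \<in> sets M" "A \<subseteq> U" "emeasure M U < ennreal e"
    by (rule outer_measure_of_lessD[OF assms(1)]) (rule that)
  have "prob U < e" using U(3) assms(2) by (simp add: emeasure_eq_measure ennreal_less_iff)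
  moreover have "prob (space M - U) = 1 - prob U" using U(1) by (rule prob_compl)
  ultimately show ?thesis using U by (intro that[of "space M - U"]) auto
qed

text \<open>
  Markov's inequality for a measurable majorant of \<open>S\<close>.
\<close>

lemma (in prob_space) event_from_upper_expectation:
  assumes S: "upper_expectation M S \<le> ennreal (d / 16)" and d: "0 < d"
  obtains W where "W \<in> sets M" "7 / 8 \<le> prob W" "\<And>\<omega>. \<omega> \<in> W \<Longrightarrow> S \<omega> \<le> ennreal d"
proof -
  have "upper_expectation M S < ennreal (d / 8)"
    using d by (intro order.strict_trans1[OF S] ennreal_lessI) auto
  then obtain g where g[measurable]: "g \<in> borel_measurable M"
      and Sg: "\<And>\<omega>. \<omega> \<in> space M \<Longrightarrow> S \<omega> \<le> g \<omega>" and int: "(\<integral>\<^sup>+\<omega>. g \<omega> \<partial>M) < ennreal (d / 8)"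
    unfolding upper_expectation_def INF_less_iff by blast
  define U where "U = {\<omega> \<in> space M. 1 \<le> ennreal (1 / d) * g \<omega>}"
  have U[measurable]: "U \<in> sets M" unfolding U_def by measurable
  have "emeasure M U \<le> ennreal (1 / d) * (\<integral>\<^sup>+\<omega>. g \<omega> * indicator (space M) \<omega> \<partial>M)"
    unfolding U_def by (rule nn_integral_Markov_inequality) auto
  also have "(\<integral>\<^sup>+\<omega>. g \<omega> * indicator (space M) \<omega> \<partial>M) = (\<integral>\<^sup>+\<omega>. g \<omega> \<partial>M)"
    by (rule nn_integral_cong) simp
  also have "ennreal (1 / d) * \<dots> \<le> ennreal (1 / d) * ennreal (d / 8)"
    using int by (intro mult_left_mono) auto
  also have "\<dots> = ennreal (1 / 8)" using d by (simp add: ennreal_mult'[symmetric])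
  finally have "prob U \<le> 1 / 8" by (simp add: emeasure_eq_measure)
  moreover have "prob (space M - U) = 1 - prob U" by (rule prob_compl[OF U])
  moreover have "S \<omega> \<le> ennreal d" if "\<omega> \<in> space M - U" for \<omega>
  proof (rule ccontr)
    assume "\<not> S \<omega> \<le> ennreal d"
    then have "ennreal d \<le> g \<omega>" using Sg[of \<omega>] that by auto
    then have "ennreal (1 / d) * ennreal d \<le> ennreal (1 / d) * g \<omega>" by (intro mult_left_mono) auto
    moreover have "ennreal (1 / d) * ennreal d = 1" using d by (simp add: ennreal_mult'[symmetric])
    ultimately show False using that by (simp add: U_def)
  qed
  ultimately show ?thesis using U by (intro that[of "space M - U"]) auto
qed

locale ldp_setting =
  fixes \<alpha> :: real and N :: "nat set" and M :: "nat \<Rightarrow> 'w measure"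
    and X :: "nat \<Rightarrow> 'w \<Rightarrow> nat \<Rightarrow> real"
    and f F :: "nat \<Rightarrow> (nat \<Rightarrow> real) \<Rightarrow> 'x::metric_space"
    and v :: "nat \<Rightarrow> real"
  assumes alpha: "0 < \<alpha>" "\<alpha> \<le> 2"
    and N: "infinite N"
    and M: "\<And>n. n \<in> N \<Longrightarrow> prob_space (M n)"
    and X: "\<And>n. n \<in> N \<Longrightarrow> X n \<in> measurable (M n) (borel_Rn n)"
    and law: "\<And>n. n \<in> N \<Longrightarrow> distr (M n) (borel_Rn n) (X n) = \<nu>_prod \<alpha> n"
    and f: "\<And>n. n \<in> N \<Longrightarrow> f n \<in> borel_measurable (borel_Rn n)"
    and v: "filterlim v at_top (along N)"
    and shift_close: "\<And>r. 0 < r \<Longrightarrow>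
      tendsto_0_in_prob N M (\<lambda>n \<omega>. SUP h \<in> scaled_ball \<alpha> n r.
        edist (f n (vadd n (X n \<omega>) (vscale n (v n powr (1 / \<alpha>)) h))) (F n h))"
    and osc_small: "\<alpha> < 2 \<Longrightarrow> (\<forall>\<delta>>0. \<forall>r>0. \<exists>t :: nat \<Rightarrow> real.
      (\<forall>n\<in>N. 0 < t n \<and>
        upper_expectation (M n) (\<lambda>\<omega>. SUP h \<in> {h \<in> Rn n. lp_norm 2 n h \<le> t n}.
          osc \<alpha> n (f n) (X n \<omega>) (v n) r h) \<le> ennreal \<delta>) \<and>
      t_growth \<alpha> N v t)"
    and precompact: "\<And>r. 0 < r \<Longrightarrow> compact (closure (\<Union>n\<in>N. F n ` scaled_ball \<alpha> n r))"
    and limsup_rate: "\<And>x. I_rate \<alpha> N F x =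
      (SUP \<delta>\<in>{0<..}. Limsup (along N) (\<lambda>n. I_delta \<alpha> F n \<delta> x))"
begin

lemma v_pos: "\<forall>\<^sub>F n in along N. 0 < v n" using v unfolding filterlim_at_top_dense by blast

lemma measure_law:
  assumes n: "n \<in> N" and A: "A \<in> sets (borel_Rn n)"
  shows "measure (\<nu>_prod \<alpha> n) A = measure (M n) {\<omega> \<in> space (M n). X n \<omega> \<in> A}"
  unfolding law[OF n, symmetric] measure_distr[OF X[OF n] A]
  by (rule arg_cong[where f = "measure (M n)"]) auto

lemma preimage_measurable: "n \<in> N \<Longrightarrow> B \<in> sets borel \<Longrightarrow> {x \<in> Rn n. f n x \<in> B} \<in> sets (borel_Rn n)"
  using measurable_sets[OF f, of n B] by (simp add: vimage_def Int_def conj_commute)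

lemma measure_f:
  assumes n: "n \<in> N" and B: "B \<in> sets borel"
  shows "measure (M n) {\<omega> \<in> space (M n). f n (X n \<omega>) \<in> B} = measure (\<nu>_prod \<alpha> n) {x \<in> Rn n. f n x \<in> B}"
  unfolding measure_law[OF n preimage_measurable[OF n B]]
  using measurable_space[OF X[OF n]] by (intro arg_cong[where f = "measure (M n)"]) auto

lemma thick_image:
  assumes n: "n \<in> N" and W: "W \<in> sets (M n)" "3 / 4 \<le> measure (M n) W"
  shows "thick \<alpha> n (X n ` W)"
  unfolding thick_def
proof (intro conjI ballI impI)
  interpret prob_space "M n" by (rule M[OF n])
  have W': "W \<subseteq> space (M n)" using W(1) by (rule sets.sets_into_space)
  then show "X n ` W \<subseteq> Rn n" using measurable_space[OF X[OF n]] by auto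
  fix A assume A: "A \<in> sets (borel_Rn n)" "X n ` W \<subseteq> A"
  have "measure (M n) W \<le> measure (M n) {\<omega> \<in> space (M n). X n \<omega> \<in> A}"
    using A W' measurable_sets[OF X[OF n] A(1)]
    by (intro finite_measure_mono) (auto simp: vimage_def Int_def conj_commute)
  then show "3 / 4 \<le> measure (\<nu>_prod \<alpha> n) A" unfolding measure_law[OF n A(1)] using W(2) by linarith
qed

text \<open>
  The event on which shifted samples are mapped close to the deterministic images. It is
  measurable on the sample space; the set of points of \<open>\<real>\<^sup>n\<close> with this property need not be.
\<close>

lemma shift_close_event:
  assumes r: "0 < r" and e: "0 < e" and p: "0 < p"
  shows "\<forall>\<^sub>F n in along N. \<exists>W\<in>sets (M n). 1 - p \<le> measure (M n) W \<and>
    (\<forall>\<omega>\<in>W. \<forall>h\<in>scaled_ball \<alpha> n r.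
      dist (f n (vadd n (X n \<omega>) (vscale n (v n powr (1 / \<alpha>)) h))) (F n h) \<le> e)"
proof -
  let ?S = "\<lambda>n \<omega>. SUP h \<in> scaled_ball \<alpha> n r.
        edist (f n (vadd n (X n \<omega>) (vscale n (v n powr (1 / \<alpha>)) h))) (F n h)"
  have "((\<lambda>n. outer_measure_of (M n) {\<omega> \<in> space (M n). ?S n \<omega> > ennreal e}) \<longlongrightarrow> 0) (along N)"
    using shift_close[OF r] e unfolding tendsto_0_in_prob_def by blast
  then have "\<forall>\<^sub>F n in along N. outer_measure_of (M n) {\<omega> \<in> space (M n). ?S n \<omega> > ennreal e} < ennreal p"
    by (rule order_tendstoD) (use p in simp)
  then show ?thesis using eventually_along_mem
  proof eventually_elim
    case (elim n)
    interpret prob_space "M n" by (rule M) (use elim in blast)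
    obtain W where W: "W \<in> sets (M n)" "W \<inter> {\<omega> \<in> space (M n). ?S n \<omega> > ennreal e} = {}" "1 - p \<le> prob W"
      by (rule event_from_outer_measure[OF elim(1) p]) (rule that)
    show ?case
    proof (intro bexI[OF _ W(1)] conjI ballI)
      fix \<omega> h assume \<omega>: "\<omega> \<in> W" and h: "h \<in> scaled_ball \<alpha> n r"
      have "\<omega> \<in> space (M n)" using sets.sets_into_space[OF W(1)] \<omega> by auto
      then have "?S n \<omega> \<le> ennreal e" using W(2) \<omega> by (auto simp: not_less[symmetric])
      then have "edist (f n (vadd n (X n \<omega>) (vscale n (v n powr (1 / \<alpha>)) h))) (F n h) \<le> ennreal e"
        using h unfolding SUP_le_iff by blast
      then show "dist (f n (vadd n (X n \<omega>) (vscale n (v n powr (1 / \<alpha>)) h))) (F n h) \<le> e"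
        using e by (simp add: ennreal_le_iff)
    qed (rule W(3))
  qed
qed

lemma osc_small_event:
  assumes \<alpha>2: "\<alpha> < 2" and r: "0 < r" and e: "0 < e"
  obtains t where "t_growth \<alpha> N v t" "\<And>n. n \<in> N \<Longrightarrow> 0 < t n"
    "\<And>n. n \<in> N \<Longrightarrow> \<exists>W\<in>sets (M n). 7 / 8 \<le> measure (M n) W \<and>
      (\<forall>\<omega>\<in>W. \<forall>w\<in>Rn n. lp_norm 2 n w \<le> t n \<longrightarrow>
        (\<forall>x\<in>vadd n (X n \<omega>) ` scaled_ball \<alpha> n (r * v n powr (1 / \<alpha>)). dist (f n (vadd n x w)) (f n x) \<le> e))"
proof -
  have "0 < e / 16" using e by simp
  from osc_small[OF \<alpha>2, rule_format, OF this r]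
  obtain t where *: "(\<forall>n\<in>N. 0 < t n \<and> upper_expectation (M n)
      (\<lambda>\<omega>. SUP h \<in> {h \<in> Rn n. lp_norm 2 n h \<le> t n}. osc \<alpha> n (f n) (X n \<omega>) (v n) r h)
        \<le> ennreal (e / 16)) \<and> t_growth \<alpha> N v t" ..
  note t = conjunct2[OF *] conjunct1[OF bspec[OF conjunct1[OF *]]] conjunct2[OF bspec[OF conjunct1[OF *]]]
  have "\<exists>W\<in>sets (M n). 7 / 8 \<le> measure (M n) W \<and>
      (\<forall>\<omega>\<in>W. \<forall>w\<in>Rn n. lp_norm 2 n w \<le> t n \<longrightarrow>
        (\<forall>x\<in>vadd n (X n \<omega>) ` scaled_ball \<alpha> n (r * v n powr (1 / \<alpha>)). dist (f n (vadd n x w)) (f n x) \<le> e))"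
    if n: "n \<in> N" for n
  proof -
    interpret prob_space "M n" by (rule M[OF n])
    obtain W where W: "W \<in> sets (M n)" "7 / 8 \<le> prob W"
      "\<And>\<omega>. \<omega> \<in> W \<Longrightarrow> (SUP h \<in> {h \<in> Rn n. lp_norm 2 n h \<le> t n}.
          osc \<alpha> n (f n) (X n \<omega>) (v n) r h) \<le> ennreal e"
      by (rule event_from_upper_expectation[OF t(3)[OF n] e]) (rule that)
    show ?thesis
    proof (intro bexI[OF _ W(1)] conjI ballI impI)
      fix \<omega> w x assume \<omega>: "\<omega> \<in> W" and w: "w \<in> Rn n" "lp_norm 2 n w \<le> t n"
        and x: "x \<in> vadd n (X n \<omega>) ` scaled_ball \<alpha> n (r * v n powr (1 / \<alpha>))"
      have "osc \<alpha> n (f n) (X n \<omega>) (v n) r w \<le> ennreal e"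
        using W(3)[OF \<omega>] w unfolding SUP_le_iff by blast
      then have "edist (f n (vadd n x w)) (f n x) \<le> ennreal e"
        using x unfolding osc_def SUP_le_iff by blast
      then show "dist (f n (vadd n x w)) (f n x) \<le> e" using e by (simp add: ennreal_le_iff)
    qed (rule W(2))
  qed
  with t(1,2) show ?thesis by (rule that)
qed

lemma sum_powr_vscale:
  assumes "0 < w" shows "(\<Sum>i<n. \<bar>vscale n (w powr (1 / \<alpha>)) h i\<bar> powr \<alpha>) = w * (\<Sum>i<n. \<bar>h i\<bar> powr \<alpha>)"
  unfolding sum_distrib_left using assms alpha
  by (intro sum.cong) (auto simp: vscale_def abs_mult powr_mult powr_powr)

text \<open>
  Along \<open>a\<close>, \<open>a + z\<close>, \<open>a + z + w\<close> the value of \<open>f n\<close> moves from within \<open>d / 3\<close> of \<open>F n h\<close>, where \<open>z\<close> is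
  the rescaled \<open>h\<close>, by another \<open>d / 3\<close> at most; this does not suffice to reach \<open>B\<close>.
\<close>

lemma unreachable_if_far:
  assumes r: "0 < r" and w: "0 < v n" and d: "0 < d" and s: "0 \<le> s" "\<alpha> = 2 \<Longrightarrow> s = 0"
    and far: "\<And>h y. h \<in> scaled_ball \<alpha> n (r powr (1 / \<alpha>)) \<Longrightarrow> y \<in> B \<Longrightarrow> d \<le> dist (F n h) y"
    and A: "A \<subseteq> Rn n"
    and close: "\<And>a h. a \<in> A \<Longrightarrow> h \<in> scaled_ball \<alpha> n (r powr (1 / \<alpha>)) \<Longrightarrow>
      dist (f n (vadd n a (vscale n (v n powr (1 / \<alpha>)) h))) (F n h) \<le> d / 3"
    and osc: "\<And>a z w. \<alpha> < 2 \<Longrightarrow> a \<in> A \<Longrightarrow> z \<in> scaled_ball \<alpha> n (r powr (1 / \<alpha>) * v n powr (1 / \<alpha>)) \<Longrightarrow>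
      w \<in> Rn n \<Longrightarrow> lp_norm 2 n w \<le> s \<Longrightarrow> dist (f n (vadd n (vadd n a z) w)) (f n (vadd n a z)) \<le> d / 3"
  shows "unreachable \<alpha> n (r * v n) s A {x \<in> Rn n. f n x \<in> B}"
  unfolding unreachable_def
proof (intro ballI impI)
  fix a z w assume a: "a \<in> A" and z: "z \<in> Rn n" and wR: "w \<in> Rn n"
    and zs: "(\<Sum>i<n. \<bar>z i\<bar> powr \<alpha>) \<le> r * v n" and ws: "(\<Sum>i<n. (w i)\<^sup>2) \<le> s\<^sup>2"
  define h where "h = vscale n ((1 / v n) powr (1 / \<alpha>)) z"
  have r': "0 < r powr (1 / \<alpha>)" and v': "0 < v n powr (1 / \<alpha>)" using r w by auto
  have inv: "v n powr (1 / \<alpha>) * (1 / v n) powr (1 / \<alpha>) = 1" using w by (simp add: powr_divide)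
  have zh: "z = vscale n (v n powr (1 / \<alpha>)) h"
    using z inv by (auto simp: h_def vscale_def fun_eq_iff space_Rn extensional_def mult.assoc[symmetric])
  have "(\<Sum>i<n. \<bar>h i\<bar> powr \<alpha>) = 1 / v n * (\<Sum>i<n. \<bar>z i\<bar> powr \<alpha>)"
    unfolding h_def using w by (intro sum_powr_vscale) simp
  also have "\<dots> \<le> r" using zs w by (simp add: field_simps)
  finally have h: "h \<in> scaled_ball \<alpha> n (r powr (1 / \<alpha>))"
    unfolding mem_scaled_ball[OF alpha(1) r'] using alpha r by (simp add: h_def vscale_def space_Rn powr_powr)
  have zb: "z \<in> scaled_ball \<alpha> n (r powr (1 / \<alpha>) * v n powr (1 / \<alpha>))"
    unfolding mem_scaled_ball[OF alpha(1) mult_pos_pos[OF r' v']]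
    using z zs alpha r w by (simp add: powr_mult powr_powr)
  have 1: "dist (f n (vadd n a z)) (F n h) \<le> d / 3" using close[OF a h] by (simp add: zh[symmetric])
  have 2: "dist (f n (vadd n (vadd n a z) w)) (f n (vadd n a z)) \<le> d / 3"
  proof (cases "\<alpha> < 2")
    case True
    have "(\<Sum>i<n. \<bar>w i\<bar> powr 2) = (\<Sum>i<n. (w i)\<^sup>2)"
    proof (intro sum.cong refl)
      fix i show "\<bar>w i\<bar> powr 2 = (w i)\<^sup>2" by (cases "w i = 0") (auto simp: powr_numeral)
    qed
    moreover have "s powr 2 = s\<^sup>2" using s(1) by (cases "s = 0") (simp_all add: powr_numeral)
    ultimately have "lp_norm 2 n w \<le> s"
      unfolding lp_norm_le_iff[OF zero_less_numeral s(1)] using ws by (simp only:)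
    then show ?thesis by (rule osc[OF True a zb wR])
  next
    case False
    then have "s = 0" using s(2) alpha by simp
    then have "(\<Sum>i<n. (w i)\<^sup>2) \<le> 0" using ws by simp
    then have "(\<Sum>i<n. (w i)\<^sup>2) = 0" by (intro antisym sum_nonneg) auto
    then have "w i = 0" if "i < n" for i using that by (simp add: sum_nonneg_eq_0_iff)
    then have "vadd n (vadd n a z) w = vadd n a z" by (auto simp: vadd_def fun_eq_iff)
    then show ?thesis using d by simp
  qed
  have "dist (F n h) (f n (vadd n (vadd n a z) w)) < d"
    using 1 2 d dist_triangle2[of "F n h" "f n (vadd n (vadd n a z) w)" "f n (vadd n a z)"]
      dist_commute[of "F n h" "f n (vadd n a z)"] by linarith
  then show "vadd n (vadd n a z) w \<notin> {x \<in> Rn n. f n x \<in> B}"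
    using far[OF h, of "f n (vadd n (vadd n a z) w)"] by auto
qed

text \<open>
  The good events of both kinds have probability at least \<open>7 / 8\<close>, so their intersection has
  a thick image and the concentration inequality applies to it.
\<close>

lemma upper_tail:
  assumes r: "0 < r" and e: "0 < e" "e < 1" and d: "0 < d" and B: "B \<in> sets borel"
    and far: "\<And>n h y. n \<in> N \<Longrightarrow> h \<in> scaled_ball \<alpha> n (r powr (1 / \<alpha>)) \<Longrightarrow> y \<in> B \<Longrightarrow> d \<le> dist (F n h) y"
  shows "\<exists>C. \<forall>\<^sub>F n in along N.
    measure (M n) {\<omega> \<in> space (M n). f n (X n \<omega>) \<in> B} \<le> C * exp (- ((1 - e) * (r * v n)))"
proof -
  have r': "0 < r powr (1 / \<alpha>)" using r by simp
  have d3: "0 < d / 3" using d by simp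
  have "\<exists>t. (\<alpha> < 2 \<longrightarrow> t_growth \<alpha> N v t \<and> (\<forall>n\<in>N. 0 < t n \<and> (\<exists>W\<in>sets (M n). 7 / 8 \<le> measure (M n) W \<and>
      (\<forall>\<omega>\<in>W. \<forall>w\<in>Rn n. lp_norm 2 n w \<le> t n \<longrightarrow>
        (\<forall>x\<in>vadd n (X n \<omega>) ` scaled_ball \<alpha> n (r powr (1 / \<alpha>) * v n powr (1 / \<alpha>)).
          dist (f n (vadd n x w)) (f n x) \<le> d / 3)))))"
  proof (cases "\<alpha> < 2")
    case True
    show ?thesis by (rule osc_small_event[OF True r' d3]) blast
  qed simp
  then obtain t where t: "\<alpha> < 2 \<Longrightarrow> t_growth \<alpha> N v t" "\<And>n. \<alpha> < 2 \<Longrightarrow> n \<in> N \<Longrightarrow> 0 < t n"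
    "\<And>n. \<alpha> < 2 \<Longrightarrow> n \<in> N \<Longrightarrow> \<exists>W\<in>sets (M n). 7 / 8 \<le> measure (M n) W \<and>
      (\<forall>\<omega>\<in>W. \<forall>w\<in>Rn n. lp_norm 2 n w \<le> t n \<longrightarrow>
        (\<forall>x\<in>vadd n (X n \<omega>) ` scaled_ball \<alpha> n (r powr (1 / \<alpha>) * v n powr (1 / \<alpha>)).
          dist (f n (vadd n x w)) (f n x) \<le> d / 3))"
    by blast
  obtain C where C: "\<forall>\<^sub>F n in along N. \<forall>A B. thick \<alpha> n A \<longrightarrow> B \<in> sets (borel_Rn n) \<longrightarrow>
    unreachable \<alpha> n (r * v n) (if \<alpha> < 2 then t n else 0) A B \<longrightarrow>
    measure (\<nu>_prod \<alpha> n) B \<le> C * exp (- ((1 - e) * (r * v n)))"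
    using asymptotic_concentration[OF alpha v e r t(1)] by blast
  have p: "0 < (1 / 8 :: real)" by simp
  have "\<forall>\<^sub>F n in along N.
    measure (M n) {\<omega> \<in> space (M n). f n (X n \<omega>) \<in> B} \<le> C * exp (- ((1 - e) * (r * v n)))"
    using C shift_close_event[OF r' d3 p] v_pos eventually_along_mem
  proof eventually_elim
    case (elim n)
    note n = elim(4)
    interpret prob_space "M n" by (rule M[OF n])
    obtain W where W: "W \<in> sets (M n)" "7 / 8 \<le> measure (M n) W"
      "\<And>\<omega> h. \<omega> \<in> W \<Longrightarrow> h \<in> scaled_ball \<alpha> n (r powr (1 / \<alpha>)) \<Longrightarrow>
        dist (f n (vadd n (X n \<omega>) (vscale n (v n powr (1 / \<alpha>)) h))) (F n h) \<le> d / 3"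
      using elim(2) by auto
    have "\<exists>W2\<in>sets (M n). 7 / 8 \<le> measure (M n) W2 \<and> (\<alpha> < 2 \<longrightarrow> (\<forall>\<omega>\<in>W2. \<forall>w\<in>Rn n. lp_norm 2 n w \<le> t n \<longrightarrow>
        (\<forall>x\<in>vadd n (X n \<omega>) ` scaled_ball \<alpha> n (r powr (1 / \<alpha>) * v n powr (1 / \<alpha>)).
          dist (f n (vadd n x w)) (f n x) \<le> d / 3)))"
    proof (cases "\<alpha> < 2")
      case True
      show ?thesis using t(3)[OF True n] by (simp only: True simp_thms)
    next
      case False
      then show ?thesis using prob_space by (intro bexI[of _ "space (M n)"]) auto
    qed
    then obtain W2 where W2: "W2 \<in> sets (M n)" "7 / 8 \<le> measure (M n) W2"
      "\<And>\<omega> w x. \<alpha> < 2 \<Longrightarrow> \<omega> \<in> W2 \<Longrightarrow> w \<in> Rn n \<Longrightarrow> lp_norm 2 n w \<le> t n \<Longrightarrow>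
        x \<in> vadd n (X n \<omega>) ` scaled_ball \<alpha> n (r powr (1 / \<alpha>) * v n powr (1 / \<alpha>)) \<Longrightarrow>
          dist (f n (vadd n x w)) (f n x) \<le> d / 3" by blast
    have "measure (M n) (W \<union> W2) = measure (M n) W + measure (M n) W2 - measure (M n) (W \<inter> W2)"
      using W(1) W2(1) by (intro measure_Un3) (auto simp: fmeasurable_eq_sets)
    then have WW: "3 / 4 \<le> measure (M n) (W \<inter> W2)"
      using W(2) W2(2) prob_le_1[of "W \<union> W2"] by linarith
    have thick: "thick \<alpha> n (X n ` (W \<inter> W2))"
      using W(1) W2(1) WW by (intro thick_image[OF n]) auto
    have "unreachable \<alpha> n (r * v n) (if \<alpha> < 2 then t n else 0) (X n ` (W \<inter> W2)) {x \<in> Rn n. f n x \<in> B}"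
    proof (rule unreachable_if_far[OF r elim(3) d _ _ far[OF n]])
      show "X n ` (W \<inter> W2) \<subseteq> Rn n" using thick by (simp add: thick_def)
      show "dist (f n (vadd n (vadd n a z) w)) (f n (vadd n a z)) \<le> d / 3"
        if "\<alpha> < 2" "a \<in> X n ` (W \<inter> W2)" "z \<in> scaled_ball \<alpha> n (r powr (1 / \<alpha>) * v n powr (1 / \<alpha>))"
          "w \<in> Rn n" "lp_norm 2 n w \<le> (if \<alpha> < 2 then t n else 0)" for a z w
      proof -
        obtain \<omega> where "\<omega> \<in> W2" "a = X n \<omega>" using \<open>a \<in> X n ` (W \<inter> W2)\<close> by blast
        then show ?thesis using W2(3)[OF \<open>\<alpha> < 2\<close>, of \<omega> w "vadd n a z"] that by simp
      qed
    qed (use W(3) t(2)[OF _ n] in \<open>auto simp: less_imp_le\<close>)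
    then show ?case unfolding measure_f[OF n B]
      using elim(1) thick preimage_measurable[OF n B] by blast
  qed
  then show ?thesis by blast
qed

end

section \<open>The rate function and the large deviations principle\<close>

lemma I_delta_less_iff:
  "I_delta \<alpha> F n \<delta> x < c \<longleftrightarrow> (\<exists>h\<in>Rn n. dist (F n h) x < \<delta> \<and> ennreal (lp_norm \<alpha> n h powr \<alpha>) < c)"
  unfolding I_delta_def INF_less_iff by blast

lemma I_delta_nearby:
  assumes "dist x y + \<delta> \<le> \<delta>'" shows "I_delta \<alpha> F n \<delta>' x \<le> I_delta \<alpha> F n \<delta> y"
  unfolding I_delta_def
proof (rule INF_superset_mono)
  have "dist (F n h) x < \<delta>'" if "dist (F n h) y < \<delta>" for h
    using that assms dist_triangle2[of "F n h" x y] by linarith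
  then show "{h \<in> Rn n. dist (F n h) y < \<delta>} \<subseteq> {h \<in> Rn n. dist (F n h) x < \<delta>'}" by blast
qed simp

text \<open>
  A ball around \<open>x\<close> contains a smaller ball around each nearby \<open>y\<close>, so the infimum of the
  energies for \<open>y\<close> is at least the one for \<open>x\<close>.
\<close>

lemma I_rate_lsc:
  assumes "t < I_rate \<alpha> N F x"
  obtains d where "0 < d" "\<And>y. dist x y < d \<Longrightarrow> t < I_rate \<alpha> N F y"
proof -
  obtain \<delta> where \<delta>: "0 < \<delta>" "t < (INF n\<in>N. I_delta \<alpha> F n \<delta> x)"
    using assms unfolding I_rate_def less_SUP_iff by auto
  have "t < I_rate \<alpha> N F y" if "dist x y < \<delta> / 2" for y
  proof -
    have "(INF n\<in>N. I_delta \<alpha> F n \<delta> x) \<le> (INF n\<in>N. I_delta \<alpha> F n (\<delta> / 2) y)"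
      using that by (intro INF_mono' I_delta_nearby) auto
    also have "\<dots> \<le> I_rate \<alpha> N F y" unfolding I_rate_def using \<delta>(1) by (intro SUP_upper) auto
    finally show ?thesis using \<delta>(2) by (rule order.strict_trans2[rotated])
  qed
  then show ?thesis using \<delta>(1) by (intro that[of "\<delta> / 2"]) auto
qed

lemma lower_semicontinuous_I_rate: "lower_semicontinuous (I_rate \<alpha> N F)"
  unfolding lower_semicontinuous_def
proof
  fix x
  show "I_rate \<alpha> N F x \<le> Liminf (at x) (I_rate \<alpha> N F)"
    unfolding le_Liminf_iff
  proof (intro allI impI)
    fix t assume "t < I_rate \<alpha> N F x"
    then obtain d where "0 < d" "\<And>y. dist x y < d \<Longrightarrow> t < I_rate \<alpha> N F y" by (rule I_rate_lsc) (rule that)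
    then show "\<forall>\<^sub>F y in at x. t < I_rate \<alpha> N F y"
      unfolding eventually_at by (intro exI[of _ d]) (auto simp: dist_commute)
  qed
qed

lemma log_prob_div_less:
  assumes v: "0 < v" and p: "p \<le> exp (- (v * q))" "0 \<le> p" and q: "- q < y"
  shows "ereal (1 / v) * log_prob p < ereal y"
proof (cases "p = 0")
  case True
  then show ?thesis using v by (simp add: log_prob_def)
next
  case False
  then have "0 < p" using p by simp
  then have "ln p \<le> - (v * q)" using p(1) by (metis ln_exp ln_le_cancel_iff exp_gt_zero)
  then have "ln p / v \<le> - q" using v by (simp add: field_simps)
  then show ?thesis using False q by (simp add: log_prob_def)
qed

lemma log_prob_div_greater:
  assumes v: "0 < v" and p: "exp (- (v * q)) \<le> p" and q: "y < - q"
  shows "ereal y < ereal (1 / v) * log_prob p"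
proof -
  have p0: "0 < p" using p by (rule less_le_trans[rotated]) simp
  then have "- (v * q) \<le> ln p" using p by (metis ln_exp ln_le_cancel_iff exp_gt_zero)
  then have "- q \<le> ln p / v" using v by (simp add: field_simps)
  then show ?thesis using p0 q by (simp add: log_prob_def)
qed

context ldp_setting begin

abbreviation "I \<equiv> I_rate \<alpha> N F"

lemma along_not_bot: "along N \<noteq> bot"
proof
  assume "along N = bot"
  then have "eventually (\<lambda>_. False) (along N)" by simp
  then have "eventually (\<lambda>n. n \<notin> N) sequentially" by (simp add: eventually_along)
  then obtain k where "\<And>n. k \<le> n \<Longrightarrow> n \<notin> N" by (auto simp: eventually_sequentially)
  then have "N \<subseteq> {..<k}" by (meson lessThan_iff not_le subsetI)
  then show False using N finite_subset by blast
qed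

lemma radius_of_energy:
  assumes q: "0 < q" and h: "h \<in> Rn n"
  shows "h \<in> scaled_ball \<alpha> n (q powr (1 / \<alpha>)) \<longleftrightarrow> ennreal (lp_norm \<alpha> n h powr \<alpha>) \<le> ennreal q"
proof -
  have "0 < q powr (1 / \<alpha>)" using q by simp
  from mem_scaled_ball[OF alpha(1) this] show ?thesis
    unfolding lp_norm_powr[OF alpha(1)] using h q alpha by (simp add: powr_powr sum_nonneg ennreal_le_iff)
qed

text \<open>
  A point of a level set is a limit of images of points of bounded energy.
\<close>

lemma good_rate_function_I: "good_rate_function I"
  unfolding good_rate_function_def
proof (intro allI impI)
  fix t :: real assume t: "0 \<le> t"
  let ?K = "closure (\<Union>n\<in>N. F n ` scaled_ball \<alpha> n ((t + 1) powr (1 / \<alpha>)))"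
  have K: "compact ?K" using t by (intro precompact) simp
  have "closed {x. I x \<le> ennreal t}"
    unfolding closed_def open_dist
  proof (intro ballI)
    fix x assume "x \<in> - {x. I x \<le> ennreal t}"
    then have "ennreal t < I x" by simp
    then obtain d where "0 < d" "\<And>y. dist x y < d \<Longrightarrow> ennreal t < I y" by (rule I_rate_lsc) (rule that)
    then show "\<exists>e>0. \<forall>y. dist y x < e \<longrightarrow> y \<in> - {x. I x \<le> ennreal t}"
      by (intro exI[of _ d]) (auto simp: dist_commute not_le)
  qed
  moreover have "{x. I x \<le> ennreal t} \<subseteq> ?K"
  proof
    fix x assume "x \<in> {x. I x \<le> ennreal t}"
    then have x: "I x < ennreal (t + 1)" using t by (auto intro: le_less_trans ennreal_lessI)
    show "x \<in> ?K" unfolding closure_approachable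
    proof (intro allI impI)
      fix \<delta> :: real assume \<delta>: "0 < \<delta>"
      have "(INF n\<in>N. I_delta \<alpha> F n \<delta> x) \<le> I x" unfolding I_rate_def using \<delta> by (intro SUP_upper) auto
      with x have "(INF n\<in>N. I_delta \<alpha> F n \<delta> x) < ennreal (t + 1)" by (rule order.strict_trans1[rotated])
      then obtain n h where n: "n \<in> N" and h: "h \<in> Rn n" "dist (F n h) x < \<delta>"
          "ennreal (lp_norm \<alpha> n h powr \<alpha>) < ennreal (t + 1)"
        unfolding INF_less_iff I_delta_less_iff by blast
      then have "h \<in> scaled_ball \<alpha> n ((t + 1) powr (1 / \<alpha>))"
        using radius_of_energy[of "t + 1" h n] t by auto
      with n h(2) show "\<exists>y\<in>(\<Union>n\<in>N. F n ` scaled_ball \<alpha> n ((t + 1) powr (1 / \<alpha>))). dist y x < \<delta>" by blast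
    qed
  qed
  ultimately show "compact {x. I x \<le> ennreal t}" using K compact_Int_closed[OF K, of "{x. I x \<le> ennreal t}"]
    by (simp add: Int_absorb1)
qed

text \<open>
  Otherwise points of \<open>C\<close> and images of low-energy points come arbitrarily close, and by relative
  compactness some subsequence of both converges to a point of \<open>C\<close>, whose rate would then be at
  most \<open>r\<close>.
\<close>

lemma far_from_low_energy:
  assumes r: "0 < r" and C: "closed C" and inf: "\<And>x. x \<in> C \<Longrightarrow> ennreal r < I x"
  shows "\<exists>d>0. \<forall>n\<in>N. \<forall>h\<in>scaled_ball \<alpha> n (r powr (1 / \<alpha>)). \<forall>y\<in>C. d \<le> dist (F n h) y"
proof (rule ccontr)
  assume "\<not> ?thesis"
  then have "\<exists>n h y. n \<in> N \<and> h \<in> scaled_ball \<alpha> n (r powr (1 / \<alpha>)) \<and> y \<in> C \<and> dist (F n h) y < d" if "0 < d" for d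
    using that by (meson not_le)
  then have "\<exists>n h y. n \<in> N \<and> h \<in> scaled_ball \<alpha> n (r powr (1 / \<alpha>)) \<and> y \<in> C \<and> dist (F n h) y < inverse (real (Suc k))" for k
    by simp
  then obtain n h y where k: "\<And>k. n k \<in> N" "\<And>k. h k \<in> scaled_ball \<alpha> (n k) (r powr (1 / \<alpha>))" "\<And>k. y k \<in> C"
      "\<And>k. dist (F (n k) (h k)) (y k) < inverse (real (Suc k))" by metis
  define z where "z k = F (n k) (h k)" for k
  let ?K = "closure (\<Union>n\<in>N. F n ` scaled_ball \<alpha> n (r powr (1 / \<alpha>)))"
  have "compact ?K" using r by (intro precompact) simp
  then have "seq_compact ?K" by (simp add: compact_eq_seq_compact_metric)
  moreover have "\<forall>k. z k \<in> ?K" using k(1,2) closure_subset unfolding z_def by fast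
  ultimately obtain x \<sigma> where x: "strict_mono \<sigma>" "(z \<circ> \<sigma>) \<longlonglongrightarrow> x" by (meson seq_compactE)
  have "(\<lambda>k. inverse (real (Suc (\<sigma> k)))) \<longlonglongrightarrow> 0"
    using LIMSEQ_subseq_LIMSEQ[OF LIMSEQ_inverse_real_of_nat x(1)] by (simp add: o_def)
  then have "(\<lambda>k. dist (y (\<sigma> k)) (z (\<sigma> k))) \<longlonglongrightarrow> 0"
    by (rule tendsto_sandwich[OF _ _ tendsto_const, rotated 2])
      (use k(4) in \<open>auto simp: z_def dist_commute less_imp_le intro!: always_eventually\<close>)
  moreover have "(\<lambda>k. dist (z (\<sigma> k)) x) \<longlonglongrightarrow> 0"
    using x(2) by (subst (asm) tendsto_dist_iff) (simp add: o_def)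
  ultimately have "(\<lambda>k. dist (y (\<sigma> k)) (z (\<sigma> k)) + dist (z (\<sigma> k)) x) \<longlonglongrightarrow> 0"
    using tendsto_add by fastforce
  then have "(\<lambda>k. dist (y (\<sigma> k)) x) \<longlonglongrightarrow> 0"
    by (rule tendsto_sandwich[OF _ _ tendsto_const, rotated 2])
      (auto intro!: always_eventually dist_triangle)
  then have "(y \<circ> \<sigma>) \<longlonglongrightarrow> x" by (subst tendsto_dist_iff) (simp add: o_def)
  then have "x \<in> C" using closed_sequentially[OF C] k(3) by (metis comp_apply)
  then have "ennreal r < I x" by (rule inf)
  then obtain \<delta> where \<delta>: "0 < \<delta>" "ennreal r < (INF n\<in>N. I_delta \<alpha> F n \<delta> x)"
    unfolding I_rate_def less_SUP_iff by auto
  obtain j where j: "dist (z (\<sigma> j)) x < \<delta>"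
    using tendstoD[OF x(2) \<delta>(1)] by (auto simp: eventually_sequentially)
  have hR: "h (\<sigma> j) \<in> Rn (n (\<sigma> j))"
    using k(2)[of "\<sigma> j"] mem_scaled_ball[OF alpha(1)] r by auto
  have "(INF n\<in>N. I_delta \<alpha> F n \<delta> x) \<le> I_delta \<alpha> F (n (\<sigma> j)) \<delta> x" using k(1) by (rule INF_lower)
  also have "\<dots> \<le> ennreal (lp_norm \<alpha> (n (\<sigma> j)) (h (\<sigma> j)) powr \<alpha>)"
    unfolding I_delta_def using hR j by (intro INF_lower) (auto simp: z_def)
  also have "\<dots> \<le> ennreal r" using radius_of_energy[OF r hR] k(2) by blast
  finally show False using \<delta>(2) by (simp add: not_le[symmetric])
qed

lemma upper_bound:
  assumes B: "B \<in> sets borel"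
  shows "Limsup (along N) (\<lambda>n. ereal (1 / v n) *
      log_prob (measure (M n) {\<omega> \<in> space (M n). f n (X n \<omega>) \<in> B})) \<le> - enn2ereal (INF x\<in>closure B. I x)"
  unfolding Limsup_le_iff
proof (intro allI impI)
  let ?P = "\<lambda>n. measure (M n) {\<omega> \<in> space (M n). f n (X n \<omega>) \<in> B}"
  fix c :: ereal assume c: "- enn2ereal (INF x\<in>closure B. I x) < c"
  obtain y where y: "- enn2ereal (INF x\<in>closure B. I x) < ereal y" "ereal y < c"
    using ereal_dense2[OF c] by blast
  have "\<forall>\<^sub>F n in along N. ereal (1 / v n) * log_prob (?P n) < ereal y"
  proof (cases "0 < y")
    case True
    show ?thesis using v_pos eventually_along_mem
    proof eventually_elim
      case (elim n)
      interpret prob_space "M n" by (rule M) (rule elim(2))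
      show ?case using True elim by (intro log_prob_div_less[where q = 0]) auto
    qed
  next
    case False
    have "ereal (- y) < enn2ereal (INF x\<in>closure B. I x)" using y(1) by (simp add: ereal_uminus_less_reorder)
    then obtain r where r: "ereal (- y) < ereal r" "ereal r < enn2ereal (INF x\<in>closure B. I x)"
      using ereal_dense2 by blast
    have r0: "0 < r" "- y < r" using r(1) False by auto
    have "ennreal r < (INF x\<in>closure B. I x)"
      using r(2) r0 by (simp add: less_ennreal.rep_eq enn2ereal_ennreal)
    then have "ennreal r < I x" if "x \<in> closure B" for x using that by (rule less_INF_D)
    from far_from_low_energy[OF r0(1) closed_closure this]
    obtain d where d: "0 < d" "\<And>n h y. n \<in> N \<Longrightarrow> h \<in> scaled_ball \<alpha> n (r powr (1 / \<alpha>)) \<Longrightarrow> y \<in> closure B \<Longrightarrow> d \<le> dist (F n h) y"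
      by blast
    \<comment> \<open>small enough that \<open>(1 - 2 * e) * r\<close> still exceeds \<open>- y\<close>; one \<open>e\<close> is lost in the concentration, the other absorbs \<open>C\<close>\<close>
    define e where "e = (r + y) / (3 * r)"
    have eq: "(1 - 2 * e) * r = (r - 2 * y) / 3" using r0 by (simp add: e_def field_simps)
    have "- y < (1 - 2 * e) * r" unfolding eq using r0 by simp
    moreover have "0 < e" "e < 1" using r0 False by (auto simp: e_def field_simps)
    ultimately have e: "0 < e" "e < 1" "- y < (1 - 2 * e) * r" by simp_all
    obtain C where C: "\<forall>\<^sub>F n in along N. ?P n \<le> C * exp (- ((1 - e) * (r * v n)))"
      using upper_tail[OF r0(1) e(1,2) d(1) B d(2)] closure_subset by blast
    define C' where "C' = max 1 C"
    have "\<forall>\<^sub>F n in along N. ln C' / (e * r) \<le> v n" using v unfolding filterlim_at_top by blast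
    with C v_pos show ?thesis
    proof eventually_elim
      case (elim n)
      have "?P n \<le> C' * exp (- ((1 - e) * (r * v n)))"
        using elim(1) by (rule order.trans) (auto simp: C'_def intro!: mult_right_mono)
      also have "C' = exp (ln C')" by (simp add: C'_def)
      also have "exp (ln C') * exp (- ((1 - e) * (r * v n))) \<le> exp (- (v n * ((1 - 2 * e) * r)))"
        using elim(3) e r0 by (simp add: mult_exp_exp field_simps)
      finally show ?case using e(3) elim(2) by (intro log_prob_div_less[where q = "(1 - 2 * e) * r"]) auto
    qed
  qed
  then show "\<forall>\<^sub>F n in along N. ereal (1 / v n) * log_prob (?P n) < c"
    by (rule eventually_mono) (use y(2) in \<open>auto intro: less_trans\<close>)
qed

text \<open>
  The limsup form of the rate provides, for all large \<open>n\<close> and not just for infinitely many, a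
  point \<open>h\<close> of energy less than \<open>q\<close> whose image is close to \<open>x\<close>. With high probability the
  sample shifted by \<open>h\<close> is mapped into \<open>B\<close>, and the translation bound removes the shift at the
  price \<open>exp (- v n * q)\<close>, up to a factor 2.
\<close>

lemma lower_bound:
  assumes B: "B \<in> sets borel"
  shows "- enn2ereal (INF x\<in>interior B. I x) \<le> Liminf (along N) (\<lambda>n. ereal (1 / v n) *
      log_prob (measure (M n) {\<omega> \<in> space (M n). f n (X n \<omega>) \<in> B}))"
  unfolding le_Liminf_iff
proof (intro allI impI)
  let ?P = "\<lambda>n. measure (M n) {\<omega> \<in> space (M n). f n (X n \<omega>) \<in> B}"
  fix c :: ereal assume c: "c < - enn2ereal (INF x\<in>interior B. I x)"
  then have "enn2ereal (INF x\<in>interior B. I x) < - c" by (simp add: ereal_less_uminus_reorder)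
  then obtain q where q: "enn2ereal (INF x\<in>interior B. I x) < ereal q" "ereal q < - c"
    using ereal_dense2 by blast
  have "0 \<le> enn2ereal (INF x\<in>interior B. I x)" by simp
  then have q0: "0 < q" using q(1) by (metis ereal_less(2) order.strict_trans1)
  have "(INF x\<in>interior B. I x) < ennreal q" using q(1) q0 by (simp add: less_ennreal.rep_eq enn2ereal_ennreal)
  then obtain x where x: "x \<in> interior B" "I x < ennreal q" unfolding INF_less_iff by blast
  obtain \<delta> where \<delta>: "0 < \<delta>" "ball x \<delta> \<subseteq> B" using x(1) unfolding mem_interior by blast
  obtain y where y: "c < ereal y" "y < - q"
  proof -
    have "c < ereal (- q)" using q(2) by (simp add: ereal_less_uminus_reorder)
    then show ?thesis using ereal_dense2[of c "ereal (- q)"] that by auto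
  qed
  have r': "0 < q powr (1 / \<alpha>)" and \<delta>2: "0 < \<delta> / 2" and p: "(0::real) < 1 / 4" using q0 \<delta> by auto
  have "Limsup (along N) (\<lambda>n. I_delta \<alpha> F n (\<delta> / 2) x) \<le> I x"
    unfolding limsup_rate using \<delta>2 by (intro SUP_upper) auto
  then have "Limsup (along N) (\<lambda>n. I_delta \<alpha> F n (\<delta> / 2) x) < ennreal q" using x(2) by (rule le_less_trans)
  then have ev: "\<forall>\<^sub>F n in along N. I_delta \<alpha> F n (\<delta> / 2) x < ennreal q" by (rule Limsup_lessD)
  \<comment> \<open>half of the gap \<open>s\<close> between the exponents absorbs the factor 2\<close>
  define s where "s = - y - q"
  have s: "0 < s" using y by (simp add: s_def)
  have "\<forall>\<^sub>F n in along N. 2 * ln 2 / s \<le> v n" using v unfolding filterlim_at_top by blast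
  with ev shift_close_event[OF r' \<delta>2 p] v_pos eventually_along_mem
  have "\<forall>\<^sub>F n in along N. ereal y < ereal (1 / v n) * log_prob (?P n)"
  proof eventually_elim
    case (elim n)
    note n = elim(4) and v0 = elim(3)
    obtain h where h: "h \<in> Rn n" "dist (F n h) x < \<delta> / 2" "ennreal (lp_norm \<alpha> n h powr \<alpha>) < ennreal q"
      using elim(1) unfolding I_delta_less_iff by blast
    have hb: "h \<in> scaled_ball \<alpha> n (q powr (1 / \<alpha>))" using radius_of_energy[OF q0 h(1)] h(3) by simp
    obtain W where W: "W \<in> sets (M n)" "3 / 4 \<le> measure (M n) W"
      "\<And>\<omega>. \<omega> \<in> W \<Longrightarrow> dist (f n (vadd n (X n \<omega>) (vscale n (v n powr (1 / \<alpha>)) h))) (F n h) \<le> \<delta> / 2"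
      using elim(2) hb by auto
    define g where "g = vscale n (v n powr (1 / \<alpha>)) h"
    define E where "E = {x \<in> Rn n. f n x \<in> B}"
    have E: "E \<in> sets (borel_Rn n)" unfolding E_def by (rule preimage_measurable[OF n B])
    have shift: "(\<lambda>x. vadd n x g) \<in> measurable (borel_Rn n) (borel_Rn n)" unfolding vadd_def by measurable
    have "X n ` W \<subseteq> {x \<in> Rn n. vadd n x g \<in> E}"
    proof (intro image_subsetI CollectI conjI)
      fix \<omega> assume \<omega>: "\<omega> \<in> W"
      then have "\<omega> \<in> space (M n)" using sets.sets_into_space[OF W(1)] by auto
      then show "X n \<omega> \<in> Rn n" using measurable_space[OF X[OF n]] by blast
      have "dist x (f n (vadd n (X n \<omega>) g)) < \<delta>"
        using W(3)[OF \<omega>] h(2) dist_triangle2[of x "f n (vadd n (X n \<omega>) g)" "F n h"]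
          dist_commute[of x "F n h"] unfolding g_def by linarith
      then have "f n (vadd n (X n \<omega>) g) \<in> B" using \<delta>(2) by auto
      then show "vadd n (X n \<omega>) g \<in> E" by (simp add: E_def space_Rn vadd_def)
    qed
    moreover have "{x \<in> Rn n. vadd n x g \<in> E} \<in> sets (borel_Rn n)"
      using measurable_sets[OF shift E] by (simp add: vimage_def Int_def conj_commute)
    ultimately have "3 / 4 \<le> measure (\<nu>_prod \<alpha> n) {x \<in> Rn n. vadd n x g \<in> E}"
      using thick_image[OF n W(1,2)] unfolding thick_def by blast
    from translation_lower_bound[OF alpha E this]
    have "exp (- (\<Sum>i<n. \<bar>g i\<bar> powr \<alpha>)) / 2 \<le> ?P n" unfolding measure_f[OF n B] E_def .
    moreover have "(\<Sum>i<n. \<bar>g i\<bar> powr \<alpha>) \<le> v n * q"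
    proof -
      have "(\<Sum>i<n. \<bar>h i\<bar> powr \<alpha>) \<le> q"
        using h(3) q0 unfolding lp_norm_powr[OF alpha(1)] by (simp add: ennreal_less_iff sum_nonneg)
      then show ?thesis unfolding g_def sum_powr_vscale[OF v0] using v0 by (intro mult_left_mono) auto
    qed
    moreover have "exp (- (v n * (q + s / 2))) \<le> exp (- (v n * q)) / 2"
    proof -
      have "ln 2 \<le> v n * s / 2" using elim(5) s by (simp add: field_simps)
      then have "- (v n * (q + s / 2)) \<le> - (v n * q) - ln 2" by (simp add: algebra_simps)
      then have "exp (- (v n * (q + s / 2))) \<le> exp (- (v n * q) - ln 2)" by simp
      also have "\<dots> = exp (- (v n * q)) / 2" by (simp add: exp_diff)
      finally show ?thesis .
    qed
    ultimately have "exp (- (v n * (q + s / 2))) \<le> ?P n"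
      by (smt (verit) divide_right_mono exp_le_cancel_iff)
    moreover have "y < - (q + s / 2)" using s by (simp add: s_def field_simps)
    ultimately show ?case using v0 by (intro log_prob_div_greater[where q = "q + s / 2"])
  qed
  then show "\<forall>\<^sub>F n in along N. c < ereal (1 / v n) * log_prob (?P n)"
    by (rule eventually_mono) (use y(1) in \<open>auto intro: less_trans\<close>)
qed

lemma LDP: "satisfies_LDP N M (\<lambda>n \<omega>. f n (X n \<omega>)) v I"
  unfolding satisfies_LDP_def Let_def
proof (intro conjI ballI)
  show "(\<lambda>\<omega>. f n (X n \<omega>)) \<in> borel_measurable (M n)" if "n \<in> N" for n
    using measurable_compose[OF X[OF that] f[OF that]] .
  show "filterlim v at_top (along N)" by (rule v)
  show "lower_semicontinuous I" by (rule lower_semicontinuous_I_rate)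
qed (rule lower_bound upper_bound Liminf_le_Limsup along_not_bot | assumption)+

end

theorem theorem2p1:
  fixes \<alpha> :: real
    and N :: "nat set"
    and M :: "nat \<Rightarrow> 'w measure"
    and X :: "nat \<Rightarrow> 'w \<Rightarrow> nat \<Rightarrow> real"
    and f F :: "nat \<Rightarrow> (nat \<Rightarrow> real) \<Rightarrow> 'x::metric_space"
    and v :: "nat \<Rightarrow> real"
  assumes alpha: "0 < \<alpha>" "\<alpha> \<le> 2"
    and N: "infinite N"
    and M: "\<And>n. n \<in> N \<Longrightarrow> prob_space (M n)"
    and X: "\<And>n. n \<in> N \<Longrightarrow> X n \<in> measurable (M n) (borel_Rn n)"
    and law: "\<And>n. n \<in> N \<Longrightarrow> distr (M n) (borel_Rn n) (X n) = \<nu>_prod \<alpha> n"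
    and f: "\<And>n. n \<in> N \<Longrightarrow> f n \<in> borel_measurable (borel_Rn n)"
    and F: "\<And>n. n \<in> N \<Longrightarrow> F n \<in> borel_measurable (borel_Rn n)"
    and v: "filterlim v at_top (along N)"
    and i: "\<And>r. 0 < r \<Longrightarrow>
      tendsto_0_in_prob N M (\<lambda>n \<omega>. SUP h \<in> scaled_ball \<alpha> n r.
        edist (f n (vadd n (X n \<omega>) (vscale n (v n powr (1 / \<alpha>)) h))) (F n h))"
    and ii: "\<alpha> < 2 \<Longrightarrow> (\<forall>\<delta>>0. \<forall>r>0. \<exists>t :: nat \<Rightarrow> real.
      (\<forall>n\<in>N. 0 < t n \<and>
        upper_expectation (M n) (\<lambda>\<omega>. SUP h \<in> {h \<in> Rn n. lp_norm 2 n h \<le> t n}.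
          osc \<alpha> n (f n) (X n \<omega>) (v n) r h) \<le> ennreal \<delta>) \<and>
      t_growth \<alpha> N v t)"
    and iii: "\<And>r. 0 < r \<Longrightarrow> compact (closure (\<Union>n\<in>N. F n ` scaled_ball \<alpha> n r))"
    and iv: "\<And>x. I_rate \<alpha> N F x =
      (SUP \<delta>\<in>{0<..}. Limsup (along N) (\<lambda>n. I_delta \<alpha> F n \<delta> x))"
  shows "satisfies_LDP N M (\<lambda>n \<omega>. f n (X n \<omega>)) v (I_rate \<alpha> N F)
    \<and> good_rate_function (I_rate \<alpha> N F)"
proof -
  interpret ldp_setting \<alpha> N M X f F v
    by (rule ldp_setting.intro) (fact alpha N M X law f v i ii iii iv)+
  show ?thesis using LDP good_rate_function_I by blast
qed

end
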